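(* Let $r,n_1,\ldots,n_r$ be positive integers and $n=n_1+\cdots+n_r$. For each positive integer $N$ let $M=M(N)$ be a positive integer with $M\to\infty$ as $N\to\infty$, let $X$ be the $M\times N$ random matrix with entries $\frac1{\sqrt N}f_{ij}$, where the $f_{ij}$ are independent real $N(0,1)$ random variables, and let $D_1,\ldots,D_{2n}$ (depending on $N$) be constant matrices, with $D_m$ of size $M\times M$ for $m$ odd and $N\times N$ for $m$ even. Assume that for every finite product of the matrices $D_m$ and their transposes (all factors having odd index, or all having even index, so that the product is defined; repetitions allowed), $\frac1N\mathrm{Tr}$ of the product converges to a finite limit as $N\to\infty$. Let $Y_1,\ldots,Y_r$ be as defined in the context. Then: (1) For each $k$, as $N\to\infty$ the random variable $Y_k$ converges weakly to the constant random variable with value $\lim_{N\to\infty}k_1(Y_k)=\lim_{N\to\infty}\mathbb{E}(Y_k)$. (2) As $N\to\infty$ the centred and rescaled random variables $N(Y_k-\mathbb{E}(Y_k))$, $1\le k\le r$, converge weakly (jointly) to a centred multivariate Gaussian random variable with covariances $\lim_{N\to\infty}N^2k_2(Y_k,Y_l)$, $1\le k,l\le r$.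
   Context: $\mathrm{Tr}$ is the usual trace and $\mathrm{tr}:=\frac1N\mathrm{Tr}$ (normalised by $N$ even for $M\times M$ matrices). Matrices have real entries. Put $s_0=0$ and $s_k=n_1+\cdots+n_k$. For $1\le k\le r$, $$Y_k:=\mathrm{tr}\left(X^TD_{2s_{k-1}+1}XD_{2s_{k-1}+2}X^TD_{2s_{k-1}+3}XD_{2s_{k-1}+4}\cdots X^TD_{2s_k-1}XD_{2s_k}\right).$$ $k_1$ and $k_2$ denote the first and second cumulants: $k_1(Y)=\mathbb{E}(Y)$ and $k_2(Y,Z)=\mathbb{E}(YZ)-\mathbb{E}(Y)\mathbb{E}(Z)$. The existence of the limits $\lim_{N\to\infty}k_1(Y_k)$ and $\lim_{N\to\infty}N^2k_2(Y_k,Y_l)$ is part of the assertion. *)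

theory Defs
  imports "HOL-Probability.Probability" "Jordan_Normal_Form.Matrix"
begin

subsection \<open>Matrices\<close>

text \<open>The trace is normalised by \<open>N\<close>, whatever the size of the square matrix.\<close>

definition ntr :: "nat \<Rightarrow> real mat \<Rightarrow> real" where
  "ntr N A = (\<Sum>i<dim_row A. A $$ (i, i)) / real N"

definition mat_prod :: "nat \<Rightarrow> real mat list \<Rightarrow> real mat" where
  "mat_prod d As = foldr (*) As (1\<^sub>m d)"

definition opt_transpose :: "bool \<Rightarrow> real mat \<Rightarrow> real mat" where
  "opt_transpose t A = (if t then transpose_mat A else A)"

text \<open>
  A word over the letters \<open>(m, t)\<close> stands for the product of the matrices \<open>D m\<close>, transposed where
  \<open>t\<close> holds. The word is admissible if it is nonempty and all of its indices have the same parity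
  (\<open>odd\<close>: size \<open>M\<close>, even: size \<open>N\<close>).
\<close>

definition admissible_word :: "nat \<Rightarrow> bool \<Rightarrow> (nat \<times> bool) list \<Rightarrow> bool" where
  "admissible_word n par w \<longleftrightarrow>
     w \<noteq> [] \<and> (\<forall>(m, t) \<in> set w. m \<in> {1..2 * n} \<and> odd m = par)"

definition word_prod :: "nat \<Rightarrow> (nat \<Rightarrow> real mat) \<Rightarrow> (nat \<times> bool) list \<Rightarrow> real mat" where
  "word_prod d D w = mat_prod d (map (\<lambda>(m, t). opt_transpose t (D m)) w)"

definition psum :: "(nat \<Rightarrow> nat) \<Rightarrow> nat \<Rightarrow> nat" where
  "psum ns k = (\<Sum>j = 1..k. ns j)"

text \<open>
  The random matrix is built from the array \<open>f\<close>, whose indices start at \<open>0\<close>; the indices of the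
  constant matrices \<open>D\<close> start at \<open>1\<close>.
\<close>

definition gauss_mat :: "nat \<Rightarrow> nat \<Rightarrow> (nat \<Rightarrow> nat \<Rightarrow> real) \<Rightarrow> real mat" where
  "gauss_mat M N f = Matrix.mat M N (\<lambda>(i, j). f i j / sqrt (real N))"

definition alternating_trace ::
  "nat \<Rightarrow> (nat \<Rightarrow> nat) \<Rightarrow> (nat \<Rightarrow> real mat) \<Rightarrow> real mat \<Rightarrow> nat \<Rightarrow> real" where
  "alternating_trace N ns D X k =
     ntr N (mat_prod N
       (map (\<lambda>j. transpose_mat X * D (2 * j - 1) * X * D (2 * j))
            [psum ns (k - 1) + 1 ..< psum ns k + 1]))"

subsection \<open>Cumulants, weak convergence and Gaussian laws\<close>

definition cumulant1 :: "'w measure \<Rightarrow> ('w \<Rightarrow> real) \<Rightarrow> real" where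
  "cumulant1 P Y = (\<integral>\<omega>. Y \<omega> \<partial>P)"

definition cumulant2 :: "'w measure \<Rightarrow> ('w \<Rightarrow> real) \<Rightarrow> ('w \<Rightarrow> real) \<Rightarrow> real" where
  "cumulant2 P Y Z = (\<integral>\<omega>. Y \<omega> * Z \<omega> \<partial>P) - (\<integral>\<omega>. Y \<omega> \<partial>P) * (\<integral>\<omega>. Z \<omega> \<partial>P)"

text \<open>
  Laws of random vectors with finite index set \<open>I\<close> live on the product \<open>euclid I\<close> of copies of the
  real line; its points are functions equal to \<open>undefined\<close> outside \<open>I\<close>, and the subspace topology
  that they inherit from the product topology on \<open>nat \<Rightarrow> real\<close> is the usual Euclidean one.
\<close>

definition euclid :: "nat set \<Rightarrow> (nat \<Rightarrow> real) measure" where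
  "euclid I = (\<Pi>\<^sub>M i\<in>I. borel)"

definition joint_law :: "'w measure \<Rightarrow> nat set \<Rightarrow> (nat \<Rightarrow> 'w \<Rightarrow> real) \<Rightarrow> (nat \<Rightarrow> real) measure" where
  "joint_law P I Z = distr P (euclid I) (\<lambda>\<omega>. \<lambda>k\<in>I. Z k \<omega>)"

definition weak_conv_vec ::
  "nat set \<Rightarrow> (nat \<Rightarrow> (nat \<Rightarrow> real) measure) \<Rightarrow> (nat \<Rightarrow> real) measure \<Rightarrow> bool" where
  "weak_conv_vec I \<mu> \<nu> \<longleftrightarrow>
     (\<forall>g :: (nat \<Rightarrow> real) \<Rightarrow> real.
        continuous_on (space (euclid I)) g \<and> bounded (g ` space (euclid I)) \<longrightarrow>
        (\<lambda>N. \<integral>x. g x \<partial>\<mu> N) \<longlonglongrightarrow> (\<integral>x. g x \<partial>\<nu>))"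

text \<open>Degenerate normal laws (point masses) are included, as covariance matrices may be singular.\<close>

definition normal_law :: "real \<Rightarrow> real \<Rightarrow> real measure" where
  "normal_law m \<sigma> = (if \<sigma> = 0 then return borel m else density lborel (normal_density m \<sigma>))"

text \<open>A random vector is Gaussian if each linear combination of its coordinates is normal.\<close>

definition gaussian_vec :: "nat set \<Rightarrow> (nat \<Rightarrow> real) measure \<Rightarrow> bool" where
  "gaussian_vec I \<nu> \<longleftrightarrow>
     prob_space \<nu> \<and> sets \<nu> = sets (euclid I) \<and>
     (\<forall>a :: nat \<Rightarrow> real. \<exists>m \<sigma>. \<sigma> \<ge> 0 \<and>
        distr \<nu> borel (\<lambda>x. \<Sum>i\<in>I. a i * x i) = normal_law m \<sigma>)"

definition centred_gaussian_vec ::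
  "nat set \<Rightarrow> (nat \<Rightarrow> nat \<Rightarrow> real) \<Rightarrow> (nat \<Rightarrow> real) measure \<Rightarrow> bool" where
  "centred_gaussian_vec I C \<nu> \<longleftrightarrow>
     gaussian_vec I \<nu> \<and>
     (\<forall>k\<in>I. cumulant1 \<nu> (\<lambda>x. x k) = 0) \<and>
     (\<forall>k\<in>I. \<forall>l\<in>I. cumulant2 \<nu> (\<lambda>x. x k) (\<lambda>x. x l) = C k l)"

end

theory Submission
  imports Defs
begin

text \<open>
  The proof rests on Gaussian integration by parts, \<open>E (x\<^sub>e F) = E (\<partial>\<^sub>e F)\<close> for polynomials \<open>F\<close> in
  independent standard normal variables (\<open>poly_integration_by_parts\<close>). Consider a product of traces
  of words in \<open>X\<close>, \<open>X\<^sup>T\<close> and constant matrices, and apply the identity to the first factor \<open>X\<close> of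
  the first trace. It is contracted with every other occurrence of \<open>X\<close>: an oppositely transposed one
  in the same trace splits this trace into two, an equally transposed one leaves a single trace that
  contains a reversed piece and is smaller by a factor of order \<open>N\<close>, and one in another trace merges
  the two traces. For the centred traces \<open>Tr w - E (Tr w)\<close> this gives a closed recursion
  (\<open>cmom_recursion\<close>), in which every step removes two factors \<open>X\<close>. Induction on the number of
  factors \<open>X\<close> shows that all normalised means and all centred mixed moments converge
  (\<open>convergent_moments\<close>). In the limiting recursion only two kinds of terms are left: one half of a
  split is replaced by its mean, or two centred traces are merged and replaced by the mean of the
  result. Induction then turns this recursion into the Wick formula (\<open>wick_lcmom\<close>), so that the
  limiting moments are Gaussian.

  Two consecutive factors \<open>X\<close> are always separated by a constant matrix, and contractions preserve
  this. Hence what remains after the last contraction is a product of traces of nonempty words in the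
  \<open>D\<close>'s and their transposes, which converge after normalisation by assumption. To avoid keeping
  track of the sizes \<open>M\<close> and \<open>N\<close>, all matrices are placed as blocks into square matrices of size
  \<open>M + N\<close>. Products of a \<open>D\<close> with odd index and one with even index then vanish, so the traces of
  all words in the \<open>D\<close>'s converge, and \<open>X\<close> can be taken to be a full square Gaussian matrix, as only
  its upper right block contributes.

  A linear combination of the centred traces has asymptotically Gaussian moments, whence convergence
  of its characteristic function (\<open>gaussian_char_of_moments\<close>). For random vectors, convergence of the
  characteristic functions together with bounded second moments implies weak convergence: on a large
  box, a bounded continuous function is approximated by a polynomial in functions
  \<open>sin (\<theta> x\<^sub>i)\<close>, which is bounded outside the box by its values on the box
  (\<open>weak_conv_vec_of_char\<close>). The Gaussian limit exists because a limit of covariance matrices is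
  positive semidefinite and hence of the form \<open>A A\<^sup>T\<close> (\<open>gaussian_vector_exists\<close>).
\<close>

section \<open>Gaussian integration by parts\<close>

text \<open>
  A single infinite array of independent standard normal variables serves all \<open>N\<close> at once.
\<close>

definition gauss_array :: "(nat \<times> nat \<Rightarrow> real) measure" where
  "gauss_array = (\<Pi>\<^sub>M e\<in>UNIV. std_normal_distribution)"

lemma prob_space_std_normal: "prob_space std_normal_distribution"
  using real_dist_normal_dist real_distribution_def by blast

lemma prob_space_gauss_array: "prob_space gauss_array"
  unfolding gauss_array_def by (intro prob_space_PiM prob_space_std_normal)

abbreviation gauss_expectation ::
    "((nat \<times> nat \<Rightarrow> real) \<Rightarrow> 'b::{banach, second_countable_topology}) \<Rightarrow> 'b" (binder "\<E>" 10) where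
  "gauss_expectation F \<equiv> integral\<^sup>L gauss_array F"

interpretation gauss: prob_space gauss_array
  by (rule prob_space_gauss_array)

lemma measurable_gauss_array_coord [measurable]: "(\<lambda>x. x e) \<in> borel_measurable gauss_array"
  unfolding gauss_array_def by measurable

abbreviation nmoment :: "nat \<Rightarrow> real" where
  "nmoment k \<equiv> (\<integral>t. t ^ k \<partial>std_normal_distribution)"

lemma std_normal_moment_recurrence:
  "nmoment (Suc k) = real k * nmoment (k - 1)"
proof -
  have I: "nmoment m = (\<integral>t. std_normal_density t * t ^ m \<partial>lborel)" for m
    by (subst integral_density) (auto simp: normal_density_nonneg)
  show ?thesis
  proof (cases "even k")
    case True
    then obtain j where k: "k = 2 * j" by blast
    have "nmoment (Suc k) = 0"
      unfolding I k using integral_std_normal_moment_odd[of j] by simp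
    moreover have "real k * nmoment (k - 1) = 0"
    proof (cases j)
      case (Suc i)
      then have "k - 1 = 2 * i + 1" using k by simp
      then show ?thesis unfolding I using integral_std_normal_moment_odd[of i] by simp
    qed (simp add: k)
    ultimately show ?thesis by simp
  next
    case False
    then obtain j where k: "k = 2 * j + 1" using oddE by blast
    have 1: "nmoment (Suc k) = fact (2 * Suc j) / (2 ^ Suc j * fact (Suc j))"
      unfolding I k using integral_std_normal_moment_even[of "Suc j"] by (simp add: algebra_simps)
    have 2: "nmoment (k - 1) = fact (2 * j) / (2 ^ j * fact j)"
      unfolding I k using integral_std_normal_moment_even[of j] by simp
    have F: "fact (2 * Suc j) = (2 * real (Suc j)) * ((2 * real j + 1) * fact (2 * j))"
      by (simp add: algebra_simps)
    have "fact (2 * Suc j) / (2 ^ Suc j * fact (Suc j)) = real k * (fact (2 * j) / (2 ^ j * fact j))"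
      unfolding F k by (simp add: divide_simps)
    then show ?thesis by (simp only: 1 2)
  qed
qed

lemma std_normal_power_integrable: "integrable std_normal_distribution (\<lambda>t. t ^ k)"
  by (subst integrable_density) (auto simp: normal_density_nonneg integrable_std_normal_moment)

text \<open>
  A monomial is encoded as the list of its coordinates, repeated according to their multiplicity.
\<close>

definition monom_val :: "(nat \<times> nat) list \<Rightarrow> (nat \<times> nat \<Rightarrow> real) \<Rightarrow> real" where
  "monom_val L x = (\<Prod>e\<leftarrow>L. x e)"

fun monom_deriv :: "nat \<times> nat \<Rightarrow> (nat \<times> nat) list \<Rightarrow> (nat \<times> nat \<Rightarrow> real) \<Rightarrow> real" where
  "monom_deriv e [] x = 0"
| "monom_deriv e (a # L) x = (if a = e then monom_val L x else 0) + x a * monom_deriv e L x"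

lemma monom_val_simps [simp]:
  "monom_val [] x = 1" "monom_val (a # L) x = x a * monom_val L x"
  "monom_val (L @ L') x = monom_val L x * monom_val L' x"
  by (simp_all add: monom_val_def)

lemma monom_val_replicate: "monom_val (replicate k e) x = x e ^ k"
  by (induction k) simp_all

lemma monom_deriv_append:
  "monom_deriv e (L @ L') x = monom_deriv e L x * monom_val L' x + monom_val L x * monom_deriv e L' x"
  by (induction L) (auto simp: algebra_simps)

lemma monom_val_split:
  "monom_val L x = x e ^ count_list L e * monom_val (filter (\<lambda>a. a \<noteq> e) L) x"
  by (induction L) auto

lemma monom_deriv_split:
  "monom_deriv e L x =
     real (count_list L e) * x e ^ (count_list L e - 1) * monom_val (filter (\<lambda>a. a \<noteq> e) L) x"
proof (induction L)
  case (Cons a L)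
  then show ?case
    by (cases "count_list L e") (auto simp: monom_val_split[of L x e] algebra_simps)
qed simp

lemma monom_val_prod:
  assumes "finite J" "set L \<subseteq> J"
  shows "monom_val L x = (\<Prod>e\<in>J. x e ^ count_list L e)"
  using assms(2)
proof (induction L)
  case (Cons a L)
  have "(\<Prod>e\<in>J. x e ^ count_list (a # L) e) = (\<Prod>e\<in>J. (if e = a then x e else 1) * x e ^ count_list L e)"
    by (intro prod.cong) auto
  also have "\<dots> = x a * (\<Prod>e\<in>J. x e ^ count_list L e)"
    using Cons assms(1) by (simp add: prod.distrib prod.delta)
  finally show ?case using Cons by simp
qed simp

lemma gauss_array_prod_powers:
  assumes "finite J"
  shows "integrable gauss_array (\<lambda>x. \<Prod>e\<in>J. x e ^ h e)"
    and "(\<E> x. (\<Prod>e\<in>J. x e ^ h e)) =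
         (\<Prod>e\<in>J. nmoment (h e))"
proof -
  let ?P = "\<Pi>\<^sub>M e\<in>J. std_normal_distribution"
  interpret product_sigma_finite "\<lambda>_::nat \<times> nat. std_normal_distribution"
    unfolding product_sigma_finite_def
    by (intro allI prob_space_imp_sigma_finite prob_space_std_normal)
  have D: "distr gauss_array ?P (\<lambda>x. \<lambda>e\<in>J. x e)
      = ?P"
    unfolding gauss_array_def
    using distr_PiM_reindex[of UNIV "\<lambda>_. std_normal_distribution" "\<lambda>e. e" J] prob_space_std_normal
    by auto
  have m: "(\<lambda>x. \<lambda>e\<in>J. x e) \<in> measurable gauss_array ?P"
    using measurable_gauss_array_coord by (intro measurable_restrict) (simp cong: measurable_cong_sets)
  have m': "(\<lambda>x. \<Prod>e\<in>J. x e ^ h e) \<in> borel_measurable ?P"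
  proof (intro borel_measurable_prod borel_measurable_power)
    fix e assume e: "e \<in> J"
    show "(\<lambda>x. x e) \<in> borel_measurable ?P"
      using measurable_component_singleton[OF e, of "\<lambda>_. std_normal_distribution"]
      by (simp cong: measurable_cong_sets)
  qed
  have i: "integrable ?P (\<lambda>x. \<Prod>e\<in>J. x e ^ h e)"
    by (rule product_integrable_prod[OF assms, of "\<lambda>e t. t ^ h e"]) (rule std_normal_power_integrable)
  have "integrable (distr gauss_array ?P (\<lambda>x. \<lambda>e\<in>J. x e))
      (\<lambda>x. \<Prod>e\<in>J. x e ^ h e)"
    unfolding D by (rule i)
  then have "integrable gauss_array (\<lambda>x. \<Prod>e\<in>J. (\<lambda>e\<in>J. x e) e ^ h e)"
    by (subst (asm) integrable_distr_eq[OF m m'])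
  then show "integrable gauss_array (\<lambda>x. \<Prod>e\<in>J. x e ^ h e)" by simp
  have "(\<E> x. (\<Prod>e\<in>J. x e ^ h e)) = (\<E> x. (\<Prod>e\<in>J. (\<lambda>e\<in>J. x e) e ^ h e))"
    by simp
  also have "\<dots> = (\<integral>x. (\<Prod>e\<in>J. x e ^ h e)
      \<partial>distr gauss_array ?P (\<lambda>x. \<lambda>e\<in>J. x e))"
    by (rule integral_distr[OF m m', symmetric])
  also have "\<dots> = (\<Prod>e\<in>J. nmoment (h e))"
    unfolding D by (rule product_integral_prod[OF assms, of "\<lambda>e t. t ^ h e"]) (rule std_normal_power_integrable)
  finally show "(\<E> x. (\<Prod>e\<in>J. x e ^ h e)) =
         (\<Prod>e\<in>J. nmoment (h e))" .
qed

lemma integrable_monom_val: "integrable gauss_array (monom_val L)"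
proof -
  have "monom_val L = (\<lambda>x. \<Prod>e\<in>set L. x e ^ count_list L e)"
    by (rule ext, rule monom_val_prod) auto
  then show ?thesis using gauss_array_prod_powers(1)[of "set L"] by simp
qed

lemma integrable_monom_deriv: "integrable gauss_array (monom_deriv e L)"
proof -
  have "integrable gauss_array (\<lambda>x. real (count_list L e) *
      monom_val (replicate (count_list L e - 1) e @ filter (\<lambda>a. a \<noteq> e) L) x)"
    by (intro integrable_mult_right integrable_monom_val)
  then show ?thesis
    by (simp only: monom_deriv_split[of e L, abs_def] monom_val_simps monom_val_replicate mult.assoc)
qed

text \<open>
  Separate the power of \<open>x e\<close> from the other coordinates by independence. What is left is the
  one-dimensional identity \<open>E t\<^sup>k\<^sup>+\<^sup>1 = k E t\<^sup>k\<^sup>-\<^sup>1\<close>, which can be read off the known normal moments.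
\<close>

lemma monom_integration_by_parts:
  "(\<E> x. x e * monom_val L x) = (\<E> x. monom_deriv e L x)"
proof -
  let ?n = "count_list L e" and ?R = "filter (\<lambda>a. a \<noteq> e) L"
  define J where "J = set ?R"
  have J: "finite J" "e \<notin> J" by (auto simp: J_def)
  have R: "monom_val ?R x = (\<Prod>a\<in>J. x a ^ count_list ?R a)" for x
    by (rule monom_val_prod) (auto simp: J_def)
  have P: "(\<E> x. x e ^ k * monom_val ?R x) =
      nmoment k * (\<Prod>a\<in>J. nmoment (count_list ?R a))" for k
  proof -
    let ?h = "\<lambda>a. if a = e then k else count_list ?R a"
    have 1: "x e ^ k * monom_val ?R x = (\<Prod>a\<in>insert e J. x a ^ ?h a)" for x
    proof -
      have "(\<Prod>a\<in>J. x a ^ ?h a) = (\<Prod>a\<in>J. x a ^ count_list ?R a)"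
        using J(2) by (intro prod.cong) auto
      moreover have "(\<Prod>a\<in>insert e J. x a ^ ?h a) = x e ^ ?h e * (\<Prod>a\<in>J. x a ^ ?h a)"
        by (rule prod.insert[OF J])
      ultimately show ?thesis unfolding R by simp
    qed
    have "(\<Prod>a\<in>J. nmoment (?h a)) =
        (\<Prod>a\<in>J. nmoment (count_list ?R a))"
      using J(2) by (intro prod.cong) auto
    moreover have "(\<Prod>a\<in>insert e J. nmoment (?h a))
        = (nmoment (?h e)) * (\<Prod>a\<in>J. nmoment (?h a))"
      by (rule prod.insert[OF J])
    ultimately have 2: "(\<Prod>a\<in>insert e J. nmoment (?h a))
       = nmoment k * (\<Prod>a\<in>J. nmoment (count_list ?R a))"
      by simp
    have "finite (insert e J)" using J by simp
    from gauss_array_prod_powers(2)[OF this, of ?h] show ?thesis unfolding 1 2 .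
  qed
  have "(\<E> x. x e * monom_val L x) = (\<E> x. x e ^ Suc ?n * monom_val ?R x)"
    by (subst monom_val_split[of L _ e]) (simp add: mult.assoc)
  also have "\<dots> = real ?n * (\<E> x. x e ^ (?n - 1) * monom_val ?R x)"
    unfolding P std_normal_moment_recurrence by simp
  also have "\<dots> = (\<E> x. monom_deriv e L x)"
    unfolding monom_deriv_split by (simp add: mult.assoc)
  finally show ?thesis .
qed

abbreviation poly_val :: "(real \<times> (nat \<times> nat) list) list \<Rightarrow> (nat \<times> nat \<Rightarrow> real) \<Rightarrow> real" where
  "poly_val ps \<equiv> (\<lambda>x. \<Sum>(c, L)\<leftarrow>ps. c * monom_val L x)"

abbreviation poly_diff ::
  "nat \<times> nat \<Rightarrow> (real \<times> (nat \<times> nat) list) list \<Rightarrow> (nat \<times> nat \<Rightarrow> real) \<Rightarrow> real" where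
  "poly_diff e ps \<equiv> (\<lambda>x. \<Sum>(c, L)\<leftarrow>ps. c * monom_deriv e L x)"

text \<open>
  \<open>F\<close> is a polynomial in finitely many coordinates, and \<open>G\<close> is its partial derivative in direction
  \<open>e\<close>. The two are related instead of computing \<open>G\<close>, so that derivatives can be assembled by the
  rules of calculus.
\<close>

definition poly_deriv ::
  "nat \<times> nat \<Rightarrow> ((nat \<times> nat \<Rightarrow> real) \<Rightarrow> real) \<Rightarrow> ((nat \<times> nat \<Rightarrow> real) \<Rightarrow> real) \<Rightarrow> bool" where
  "poly_deriv e F G \<longleftrightarrow> (\<exists>ps. F = poly_val ps \<and> G = poly_diff e ps)"

lemma integrable_sum_list:
  fixes f :: "'b \<Rightarrow> 'a \<Rightarrow> real"
  assumes "\<And>i. i \<in> set xs \<Longrightarrow> integrable M (f i)"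
  shows "integrable M (\<lambda>x. \<Sum>i\<leftarrow>xs. f i x)"
  using assms by (induction xs) auto

lemma integral_sum_list:
  fixes f :: "'b \<Rightarrow> 'a \<Rightarrow> real"
  assumes "\<And>i. i \<in> set xs \<Longrightarrow> integrable M (f i)"
  shows "(\<integral>x. (\<Sum>i\<leftarrow>xs. f i x) \<partial>M) = (\<Sum>i\<leftarrow>xs. \<integral>x. f i x \<partial>M)"
  using assms
proof (induction xs)
  case (Cons a xs)
  then show ?case by (simp add: integrable_sum_list)
qed simp

lemma poly_deriv_integrable:
  assumes "poly_deriv e F G"
  shows "integrable gauss_array F" "integrable gauss_array G"
proof -
  obtain ps where "F = poly_val ps" "G = poly_diff e ps"
    using assms unfolding poly_deriv_def by blast
  then show "integrable gauss_array F" "integrable gauss_array G"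
    by (auto simp: split_def intro!: integrable_sum_list integrable_mult_right integrable_monom_val integrable_monom_deriv)
qed

lemma poly_integration_by_parts:
  assumes "poly_deriv e F G"
  shows "(\<E> x. x e * F x) = (\<E> x. G x)"
proof -
  obtain ps where F: "F = poly_val ps"
    and G: "G = poly_diff e ps"
    using assms unfolding poly_deriv_def by blast
  have eq: "x e * F x = (\<Sum>(c, L)\<leftarrow>ps. c * (x e * monom_val L x))" for x
    unfolding F by (simp add: sum_list_const_mult[symmetric] split_def mult.left_commute)
  have i: "integrable gauss_array (\<lambda>x. x e * monom_val L x)" for L
    using integrable_monom_val[of "e # L"] unfolding monom_val_def by simp
  show ?thesis
    unfolding eq G split_def
    by (subst (1 2) integral_sum_list)
       (auto intro!: integrable_mult_right i integrable_monom_deriv simp: monom_integration_by_parts)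
qed

lemma poly_deriv_cong:
  "poly_deriv e F G \<Longrightarrow> (\<And>x. F x = F' x) \<Longrightarrow> (\<And>x. G x = G' x) \<Longrightarrow> poly_deriv e F' G'"
  by (subst (asm) ext[of F F'], simp, subst (asm) ext[of G G'], simp_all)

lemma poly_deriv_const: "poly_deriv e (\<lambda>x. c) (\<lambda>x. 0)"
  unfolding poly_deriv_def by (rule exI[of _ "[(c, [])]"]) simp

lemma poly_deriv_coord: "poly_deriv e (\<lambda>x. x a) (\<lambda>x. if a = e then 1 else 0)"
  unfolding poly_deriv_def by (rule exI[of _ "[(1, [a])]"]) (auto simp: fun_eq_iff)

lemma poly_deriv_add:
  assumes "poly_deriv e F G" "poly_deriv e F' G'"
  shows "poly_deriv e (\<lambda>x. F x + F' x) (\<lambda>x. G x + G' x)"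
proof -
  obtain ps ps' where
    "F = poly_val ps" "G = poly_diff e ps"
    "F' = poly_val ps'" "G' = poly_diff e ps'"
    using assms unfolding poly_deriv_def by blast
  then show ?thesis
    unfolding poly_deriv_def by (intro exI[of _ "ps @ ps'"]) simp
qed

lemma poly_deriv_mult:
  assumes "poly_deriv e F G" "poly_deriv e F' G'"
  shows "poly_deriv e (\<lambda>x. F x * F' x) (\<lambda>x. G x * F' x + F x * G' x)"
proof -
  obtain ps ps' where *:
    "F = poly_val ps" "G = poly_diff e ps"
    "F' = poly_val ps'" "G' = poly_diff e ps'"
    using assms unfolding poly_deriv_def by blast
  define qs where "qs = concat (map (\<lambda>(c, L). map (\<lambda>(c', L'). (c * c', L @ L')) ps') ps)"
  have "F x * F' x = (\<Sum>(c, L)\<leftarrow>qs. c * monom_val L x)" for x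
    unfolding * qs_def
    by (induction ps)
       (auto simp: split_def distrib_right sum_list_const_mult[symmetric] o_def algebra_simps)
  moreover have "G x * F' x + F x * G' x = (\<Sum>(c, L)\<leftarrow>qs. c * monom_deriv e L x)" for x
  proof -
    have 1: "(\<Sum>(c', L')\<leftarrow>ps'. c * c' * monom_deriv e (L @ L') x) =
       c * monom_deriv e L x * (\<Sum>(c, L)\<leftarrow>ps'. c * monom_val L x) +
       c * monom_val L x * (\<Sum>(c, L)\<leftarrow>ps'. c * monom_deriv e L x)" for c L
      by (induction ps') (auto simp: monom_deriv_append algebra_simps)
    show ?thesis
      unfolding * qs_def
    proof (induction ps)
      case (Cons p ps)
      obtain c L where p: "p = (c, L)" by (cases p)
      show ?case using Cons 1[of c L] by (simp add: p split_def o_def algebra_simps)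
    qed simp
  qed
  ultimately show ?thesis unfolding poly_deriv_def by (intro exI[of _ qs]) auto
qed

lemma poly_deriv_cmult: "poly_deriv e F G \<Longrightarrow> poly_deriv e (\<lambda>x. c * F x) (\<lambda>x. c * G x)"
  using poly_deriv_mult[OF poly_deriv_const[of e c]] by simp

lemma poly_deriv_sum:
  assumes "\<And>i. i \<in> I \<Longrightarrow> poly_deriv e (F i) (G i)"
  shows "poly_deriv e (\<lambda>x. \<Sum>i\<in>I. F i x) (\<lambda>x. \<Sum>i\<in>I. G i x)"
  using assms
proof (induction I rule: infinite_finite_induct)
  case (insert i I)
  then show ?case using poly_deriv_add[of e "F i" "G i"] by simp
qed (use poly_deriv_const[of e 0] in auto)

definition poly_fn :: "((nat \<times> nat \<Rightarrow> real) \<Rightarrow> real) \<Rightarrow> bool" where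
  "poly_fn F \<longleftrightarrow> (\<forall>e. \<exists>G. poly_deriv e F G)"

lemma poly_fn_integrable: "poly_fn F \<Longrightarrow> integrable gauss_array F"
  using poly_deriv_integrable(1) unfolding poly_fn_def by blast

lemma poly_fn_const: "poly_fn (\<lambda>x. c)"
  using poly_deriv_const unfolding poly_fn_def by blast

lemma poly_fn_coord: "poly_fn (\<lambda>x. x a)"
  using poly_deriv_coord unfolding poly_fn_def by blast

lemma poly_fn_add: "poly_fn F \<Longrightarrow> poly_fn G \<Longrightarrow> poly_fn (\<lambda>x. F x + G x)"
  using poly_deriv_add unfolding poly_fn_def by meson

lemma poly_fn_mult: "poly_fn F \<Longrightarrow> poly_fn G \<Longrightarrow> poly_fn (\<lambda>x. F x * G x)"
  using poly_deriv_mult unfolding poly_fn_def by meson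

lemma poly_fn_diff: "poly_fn F \<Longrightarrow> poly_fn G \<Longrightarrow> poly_fn (\<lambda>x. F x - G x)"
  using poly_fn_add[OF _ poly_fn_mult[OF poly_fn_const[of "-1"]]] by simp

lemma poly_fn_power: "poly_fn F \<Longrightarrow> poly_fn (\<lambda>x. F x ^ n)"
  by (induction n) (simp_all add: poly_fn_const poly_fn_mult)

lemma poly_fn_sum: "(\<And>i. i \<in> I \<Longrightarrow> poly_fn (F i)) \<Longrightarrow> poly_fn (\<lambda>x. \<Sum>i\<in>I. F i x)"
  unfolding poly_fn_def
proof
  fix e assume h: "\<And>i. i \<in> I \<Longrightarrow> \<forall>e. \<exists>G. poly_deriv e (F i) G"
  have "\<forall>i\<in>I. \<exists>G. poly_deriv e (F i) G" by (intro ballI spec[OF h])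
  then obtain G where "\<forall>i\<in>I. poly_deriv e (F i) (G i)" by (rule bchoice[THEN exE])
  then show "\<exists>G. poly_deriv e (\<lambda>x. \<Sum>i\<in>I. F i x) G" using poly_deriv_sum[of I e F G] by auto
qed

lemma poly_fn_sum_list: "(\<And>i. i \<in> set I \<Longrightarrow> poly_fn (F i)) \<Longrightarrow> poly_fn (\<lambda>x. \<Sum>i\<leftarrow>I. F i x)"
  by (induction I) (auto intro: poly_fn_const poly_fn_add)

lemma poly_fn_prod_list: "(\<And>i. i \<in> set I \<Longrightarrow> poly_fn (F i)) \<Longrightarrow> poly_fn (\<lambda>x. \<Prod>i\<leftarrow>I. F i x)"
  by (induction I) (auto intro: poly_fn_const poly_fn_mult)

lemmas poly_fn_intros = poly_fn_const poly_fn_coord poly_fn_add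
  poly_fn_mult poly_fn_diff poly_fn_power poly_fn_sum
  poly_fn_sum_list poly_fn_prod_list

section \<open>Characteristic functions from Gaussian moments\<close>

lemma gaussian_moment_values:
  fixes m :: "nat \<Rightarrow> real"
  assumes "m 0 = 1" "m 1 = 0" "\<And>p. m (Suc (Suc p)) = real (Suc p) * v * m p"
  shows "m (2 * j + 1) = 0" "m (2 * j) / fact (2 * j) = (v / 2) ^ j / fact j"
proof -
  show "m (2 * j + 1) = 0" using assms by (induction j) auto
  show "m (2 * j) / fact (2 * j) = (v / 2) ^ j / fact j"
  proof (induction j)
    case (Suc j)
    have "m (2 * Suc j) / fact (2 * Suc j) = (v / (2 * real (Suc j))) * (m (2 * j) / fact (2 * j))"
      using assms(3)[of "2 * j"] by (simp add: divide_simps)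
    also have "\<dots> = (v / 2) ^ Suc j / fact (Suc j)"
      unfolding Suc by (simp add: field_simps)
    finally show ?case .
  qed (simp add: assms)
qed

text \<open>
  The moments \<open>m\<close> are those of a centred normal law with variance \<open>v\<close>. The Taylor polynomial of degree
  \<open>2n\<close> of the characteristic function of \<open>S N\<close> has an error of at most \<open>2 E (S N)\<^sup>2\<^sup>n / (2n)!\<close>, which tends to
  \<open>2 (v/2)\<^sup>n / n!\<close> as \<open>N\<close> grows and is therefore small for large \<open>n\<close>; the Taylor polynomial itself
  converges to a partial sum of the exponential series at \<open>- v / 2\<close>.
\<close>

lemma gaussian_char_of_moments:
  fixes S :: "nat \<Rightarrow> 'a \<Rightarrow> real" and m :: "nat \<Rightarrow> real"
  assumes "prob_space M"
    and int: "\<And>N p. integrable M (\<lambda>x. S N x ^ p)"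
    and m: "m 0 = 1" "m 1 = 0" "\<And>p. m (Suc (Suc p)) = real (Suc p) * v * m p"
    and lim: "\<And>p. (\<lambda>N. \<integral>x. S N x ^ p \<partial>M) \<longlonglongrightarrow> m p"
  shows "(\<lambda>N. \<integral>x. iexp (S N x) \<partial>M) \<longlonglongrightarrow> complex_of_real (exp (- v / 2))"
proof -
  interpret prob_space M by fact
  note mv = gaussian_moment_values[of m v, OF m]
  have meas [measurable]: "S N \<in> borel_measurable M" for N
    using borel_measurable_integrable[OF int[of N 1]] by simp
  define L where "L = complex_of_real (exp (- v / 2))"
  define T where "T n = (\<Sum>k\<le>2 * n. (\<i> ^ k / fact k) * complex_of_real (m k))" for n
  define A where "A n N = (\<Sum>k\<le>2 * n. (\<i> ^ k / fact k) * complex_of_real (\<integral>x. S N x ^ k \<partial>M))" for n N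
  have T: "T n = complex_of_real (\<Sum>j\<le>n. (- v / 2) ^ j / fact j)" for n
  proof (induction n)
    case 0
    then show ?case by (simp add: T_def m)
  next
    case (Suc n)
    have "T (Suc n) = T n + (\<i> ^ (2 * n + 1) / fact (2 * n + 1)) * complex_of_real (m (2 * n + 1))
        + (\<i> ^ (2 * Suc n) / fact (2 * Suc n)) * complex_of_real (m (2 * Suc n))"
      by (simp add: T_def)
    also have "(\<i> ^ (2 * Suc n) / fact (2 * Suc n)) * complex_of_real (m (2 * Suc n)) =
        (-1) ^ Suc n * complex_of_real (m (2 * Suc n) / fact (2 * Suc n))"
      by (simp only: power_mult power2_i) simp
    also have "\<dots> = complex_of_real ((- v / 2) ^ Suc n / fact (Suc n))"
    proof -
      have "(- v / 2) ^ Suc n = (-1) ^ Suc n * (v / 2) ^ Suc n"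
        by (simp add: power_mult_distrib[symmetric] del: power_Suc)
      then show ?thesis unfolding mv by (simp del: power_Suc)
    qed
    finally show ?case unfolding mv Suc by simp
  qed
  have "(\<lambda>n. \<Sum>j\<le>n. (- v / 2) ^ j / fact j) \<longlonglongrightarrow> exp (- v / 2)"
  proof -
    have "(- v / 2) ^ j /\<^sub>R fact j = (- v / 2) ^ j / fact j" for j
      by (simp only: scaleR_conv_of_real of_real_inverse of_real_fact of_real_eq_id id_apply divide_inverse mult.commute)
    then show ?thesis using exp_converges[of "- v / 2"] by (simp only: sums_def_le)
  qed
  then have "T \<longlonglongrightarrow> L"
    unfolding T[abs_def] L_def by (rule tendsto_of_real)
  then have 1: "(\<lambda>n. cmod (T n - L)) \<longlonglongrightarrow> 0"
    by (intro tendsto_norm_zero LIM_zero)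
  have "(\<lambda>n. inverse (fact n) * (v / 2) ^ n) \<longlonglongrightarrow> 0"
    by (rule summable_LIMSEQ_zero[OF summable_exp])
  then have 2: "(\<lambda>n. (v / 2) ^ n / fact n) \<longlonglongrightarrow> 0"
    by (simp only: divide_inverse mult.commute)
  have bound: "(\<lambda>n. cmod (T n - L) + 2 * ((v / 2) ^ n / fact n)) \<longlonglongrightarrow> 0"
    using tendsto_add[OF 1 tendsto_mult_right_zero[OF 2, of 2]] by simp
  show ?thesis
  proof (rule LIMSEQ_I)
    fix e :: real assume "0 < e"
    then obtain n where n: "cmod (T n - L) + 2 * ((v / 2) ^ n / fact n) < e"
      using order_tendstoD(2)[OF bound] unfolding eventually_sequentially by blast
    let ?b = "\<lambda>N. 2 / fact (2 * n) * (\<integral>x. S N x ^ (2 * n) \<partial>M) + cmod (A n N - T n) + cmod (T n - L)"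
    have "(\<lambda>N. A n N) \<longlonglongrightarrow> T n"
      unfolding A_def T_def by (intro tendsto_intros lim)
    then have "(\<lambda>N. cmod (A n N - T n)) \<longlonglongrightarrow> 0"
      by (intro tendsto_norm_zero LIM_zero)
    moreover have "(\<lambda>N. 2 / fact (2 * n) * (\<integral>x. S N x ^ (2 * n) \<partial>M)) \<longlonglongrightarrow> 2 / fact (2 * n) * m (2 * n)"
      by (intro tendsto_intros lim)
    ultimately have "?b
        \<longlonglongrightarrow> 2 / fact (2 * n) * m (2 * n) + 0 + cmod (T n - L)"
      by (intro tendsto_add tendsto_const)
    moreover have "2 / fact (2 * n) * m (2 * n) + 0 + cmod (T n - L) < e"
    proof -
      have "2 / fact (2 * n) * m (2 * n) = 2 * ((v / 2) ^ n / fact n)"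
        unfolding mv(2)[symmetric] by simp
      then show ?thesis using n by simp
    qed
    ultimately have "\<forall>\<^sub>F N in sequentially.
        ?b N < e"
      by (rule order_tendstoD(2))
    moreover have "cmod ((\<integral>x. iexp (S N x) \<partial>M) - L) \<le>
        ?b N" for N
    proof -
      have "(\<integral>x. iexp (S N x) \<partial>M) = char (distr M borel (S N)) 1"
        unfolding char_def by (simp add: integral_distr)
      then have "cmod ((\<integral>x. iexp (S N x) \<partial>M) - A n N) \<le> 2 / fact (2 * n) * (\<integral>x. S N x ^ (2 * n) \<partial>M)"
        using char_approx1'[of "2 * n" "S N" "distr M borel (S N)" 1, OF int meas refl]
        by (simp add: A_def power_even_abs)
      moreover have "cmod ((\<integral>x. iexp (S N x) \<partial>M) - L) \<le>
          cmod ((\<integral>x. iexp (S N x) \<partial>M) - A n N) + cmod (A n N - T n) + cmod (T n - L)"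
        using norm_triangle_ineq[of "(\<integral>x. iexp (S N x) \<partial>M) - A n N" "(A n N - T n) + (T n - L)"]
          norm_triangle_ineq[of "A n N - T n" "T n - L"] by simp
      ultimately show ?thesis by linarith
    qed
    ultimately have "\<forall>\<^sub>F N in sequentially. cmod ((\<integral>x. iexp (S N x) \<partial>M) - L) < e"
      by (auto elim!: eventually_mono intro: le_less_trans)
    then show "\<exists>no. \<forall>N\<ge>no. norm ((\<integral>x. iexp (S N x) \<partial>M) - complex_of_real (exp (- v / 2))) < e"
      unfolding eventually_sequentially L_def .
  qed
qed

section \<open>Gaussian vectors with prescribed covariance\<close>

abbreviation quad_form :: "nat set \<Rightarrow> (nat \<Rightarrow> nat \<Rightarrow> real) \<Rightarrow> (nat \<Rightarrow> real) \<Rightarrow> real" where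
  "quad_form I C a \<equiv> (\<Sum>i\<in>I. \<Sum>j\<in>I. a i * a j * C i j)"

text \<open>
  Cholesky factorization, by induction on the index set: a new index \<open>p\<close> with \<open>C p p > 0\<close> is
  eliminated by passing to the Schur complement \<open>C'\<close>; if \<open>C p p = 0\<close>, its whole row vanishes.
\<close>

lemma psd_factorization:
  fixes C :: "nat \<Rightarrow> nat \<Rightarrow> real"
  assumes "finite I"
    and "\<And>i j. i \<in> I \<Longrightarrow> j \<in> I \<Longrightarrow> C i j = C j i"
    and "\<And>a. 0 \<le> quad_form I C a"
  shows "\<exists>A. \<forall>i\<in>I. \<forall>j\<in>I. C i j = (\<Sum>k\<in>I. A i k * A j k)"
  using assms
proof (induction I arbitrary: C rule: finite_induct)
  case (insert p I)
  note sym = insert.prems(1) and psd = insert.prems(2)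
  have Q: "(\<Sum>i\<in>insert p I. \<Sum>j\<in>insert p I. a i * a j * C i j) =
      a p * a p * C p p + 2 * a p * (\<Sum>i\<in>I. a i * C i p) + quad_form I C a" for a
  proof -
    have "(\<Sum>j\<in>I. a p * a j * C p j) = a p * (\<Sum>i\<in>I. a i * C i p)"
      using sym by (simp add: sum_distrib_left mult.assoc)
    moreover have "(\<Sum>i\<in>I. a i * a p * C i p) = a p * (\<Sum>i\<in>I. a i * C i p)"
      by (simp add: sum_distrib_left mult_ac)
    ultimately show ?thesis
      using insert.hyps by (simp add: sum.distrib)
  qed
  have cpp: "0 \<le> C p p"
    using psd[of "\<lambda>i. if i = p then 1 else 0"] insert.hyps unfolding Q
    by (simp add: sum.neutral)
  define q where "q = sqrt (C p p)"
  define C' where "C' i j = C i j - (if C p p = 0 then 0 else C i p * C j p / C p p)" for i j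
  have "\<exists>A. \<forall>i\<in>I. \<forall>j\<in>I. C' i j = (\<Sum>k\<in>I. A i k * A j k)"
  proof (rule insert.IH)
    show "C' i j = C' j i" if "i \<in> I" "j \<in> I" for i j
      using sym that by (simp add: C'_def mult.commute)
    fix a :: "nat \<Rightarrow> real"
    show "0 \<le> quad_form I C' a"
    proof (cases "C p p = 0")
      case True
      then have "quad_form I C' a = quad_form I C a"
        by (simp add: C'_def)
      moreover have "(\<Sum>i\<in>I. \<Sum>j\<in>I. (a(p := 0)) i * (a(p := 0)) j * C i j) = quad_form I C a"
        using insert.hyps by (intro sum.cong) auto
      ultimately show ?thesis using psd[of "a(p := 0)"] unfolding Q by simp
    next
      case False
      define s where "s = (\<Sum>i\<in>I. a i * C i p)"
      \<comment> \<open>The value at \<open>p\<close> that minimises the quadratic form.\<close>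
      let ?b = "a(p := - s / C p p)"
      have 1: "(\<Sum>i\<in>I. ?b i * C i p) = s"
        unfolding s_def using insert.hyps by (intro sum.cong) auto
      have 2: "quad_form I C ?b = quad_form I C a"
        using insert.hyps by (intro sum.cong) auto
      have 3: "quad_form I C' a = quad_form I C a - s * s / C p p"
      proof -
        have "s * s / C p p = (\<Sum>i\<in>I. \<Sum>j\<in>I. a i * a j * (C i p * C j p / C p p))"
          by (simp add: s_def sum_product sum_divide_distrib mult_ac)
        then show ?thesis
          using False by (simp add: C'_def right_diff_distrib sum_subtractf)
      qed
      have "0 \<le> (- s / C p p) * (- s / C p p) * C p p + 2 * (- s / C p p) * s + quad_form I C a"
        using psd[of ?b] unfolding Q 1 2 by simp
      then show ?thesis unfolding 3 using False by (simp add: field_simps)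
    qed
  qed
  then obtain A where A: "\<And>i j. i \<in> I \<Longrightarrow> j \<in> I \<Longrightarrow> C' i j = (\<Sum>k\<in>I. A i k * A j k)" by blast
  \<comment> \<open>Otherwise the quadratic form would be affine and not constant, hence negative somewhere, on a line in direction \<open>p\<close>.\<close>
  have zero: "C i p = 0" if "C p p = 0" "i \<in> I" for i
  proof -
    have key: "0 \<le> 2 * t * C i p + C i i" for t
    proof -
      let ?a = "\<lambda>j. if j = p then t else if j = i then 1 else 0::real"
      have pick: "(\<Sum>j\<in>I. ?a j * h j) = h i" for h
      proof -
        have "(\<Sum>j\<in>I. ?a j * h j) = (\<Sum>j\<in>I. if j = i then h j else 0)"
          using insert.hyps by (intro sum.cong) auto
        then show ?thesis using that insert.hyps by (simp add: sum.delta)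
      qed
      have a1: "(\<Sum>j\<in>I. ?a j * C j p) = C i p" by (rule pick)
      have a2: "(\<Sum>j\<in>I. \<Sum>k\<in>I. ?a j * ?a k * C j k) = C i i"
        by (simp only: mult.assoc sum_distrib_left[symmetric] pick)
      show ?thesis using psd[of ?a] that unfolding Q a1 a2 by simp
    qed
    show ?thesis
    proof (rule ccontr)
      assume "C i p \<noteq> 0"
      then show False using key[of "- (C i i + 1) / (2 * C i p)"] by (simp add: field_simps)
    qed
  qed
  define B where "B i k = (if k = p then (if i = p then q else if C p p = 0 then 0 else C i p / q)
      else if i = p then 0 else A i k)" for i k
  have qq: "q * q = C p p" using cpp by (simp add: q_def)
  have "C i j = (\<Sum>k\<in>insert p I. B i k * B j k)" if ij: "i \<in> insert p I" "j \<in> insert p I" for i j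
  proof -
    have S: "(\<Sum>k\<in>insert p I. B i k * B j k) = B i p * B j p + (\<Sum>k\<in>I. B i k * B j k)"
      using insert.hyps by simp
    have P: "(\<Sum>k\<in>I. B i k * B j k) = (if i = p \<or> j = p then 0 else C' i j)"
    proof (cases "i = p \<or> j = p")
      case True
      then show ?thesis using insert.hyps by (auto simp: B_def intro!: sum.neutral)
    next
      case False
      then have "(\<Sum>k\<in>I. B i k * B j k) = (\<Sum>k\<in>I. A i k * A j k)"
        using insert.hyps by (intro sum.cong) (auto simp: B_def)
      then show ?thesis using A[of i j] ij False by auto
    qed
    have q0: "q = 0 \<longleftrightarrow> C p p = 0" using qq by auto
    consider "i = p" "j = p" | "i = p" "j \<in> I" "j \<noteq> p" | "i \<in> I" "i \<noteq> p" "j = p" | "i \<in> I" "i \<noteq> p" "j \<in> I" "j \<noteq> p"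
      using ij by blast
    then show ?thesis
    proof cases
      case 1
      then show ?thesis unfolding S P by (simp add: B_def qq)
    next
      case 2
      then show ?thesis unfolding S P using zero[of j] q0 sym[of p j] by (auto simp: B_def)
    next
      case 3
      then show ?thesis unfolding S P using zero[of i] q0 by (auto simp: B_def)
    next
      case 4
      then show ?thesis unfolding S P using zero[of i] q0 qq by (auto simp: B_def C'_def)
    qed
  qed
  then show ?case by blast
qed simp

lemma gauss_coord_covariance: "(\<E> x. x e * x a) = (if a = e then 1 else 0)"
  using poly_integration_by_parts[OF poly_deriv_coord[of e a]] by (simp add: gauss.prob_space)

lemma gauss_coord_mean: "(\<E> x. x e) = 0"
  using poly_integration_by_parts[OF poly_deriv_const[of e 1]] by simp

lemma gauss_linear_form_moments:
  fixes b :: "nat \<times> nat \<Rightarrow> real"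
  assumes "finite J"
  defines "l \<equiv> (\<lambda>x. \<Sum>e\<in>J. b e * x e)"
  shows "(\<E> x. l x ^ Suc (Suc p)) = real (Suc p) * (\<Sum>e\<in>J. (b e)\<^sup>2) * (\<E> x. l x ^ p)"
proof -
  have pl: "poly_fn l" unfolding l_def by (intro poly_fn_intros)
  have dl: "poly_deriv e l (\<lambda>x. b e)" if "e \<in> J" for e
  proof (rule poly_deriv_cong)
    show "poly_deriv e l (\<lambda>x. \<Sum>a\<in>J. b a * (if a = e then 1 else 0))"
      unfolding l_def by (intro poly_deriv_sum poly_deriv_cmult poly_deriv_coord)
  qed (use assms that in \<open>simp_all add: mult_delta_right sum.delta\<close>)
  have dp: "poly_deriv e (\<lambda>x. l x ^ Suc p) (\<lambda>x. real (Suc p) * b e * l x ^ p)" if "e \<in> J" for e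
  proof (induction p)
    case 0
    then show ?case using dl[OF that] by simp
  next
    case (Suc p)
    show ?case
      using poly_deriv_mult[OF dl[OF that] Suc]
      by (rule poly_deriv_cong) (simp_all add: algebra_simps)
  qed
  have i: "integrable gauss_array (\<lambda>x. b e * (x e * l x ^ Suc p))" for e
    by (intro poly_fn_integrable poly_fn_intros pl)
  have "l x ^ Suc (Suc p) = (\<Sum>e\<in>J. b e * (x e * l x ^ Suc p))" for x
    by (simp add: l_def sum_distrib_right mult.assoc)
  then have "(\<E> x. l x ^ Suc (Suc p)) = (\<Sum>e\<in>J. b e * (\<E> x. x e * l x ^ Suc p))"
    using i by (simp only: Bochner_Integration.integral_sum integral_mult_right_zero)
  also have "\<dots> = (\<Sum>e\<in>J. b e * (real (Suc p) * b e * (\<E> x. l x ^ p)))"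
    by (intro sum.cong refl) (simp add: poly_integration_by_parts[OF dp] del: power_Suc of_nat_Suc)
  also have "\<dots> = real (Suc p) * (\<Sum>e\<in>J. (b e)\<^sup>2) * (\<E> x. l x ^ p)"
    by (simp only: sum_distrib_left sum_distrib_right power2_eq_square mult_ac)
  finally show ?thesis .
qed

text \<open>
  Integration by parts gives a linear form the moments of a normal variable, so the preceding moment
  criterion, applied to a constant sequence, yields its characteristic function.
\<close>

lemma gauss_linear_form_char:
  assumes "finite J"
  shows "(\<E> x. iexp (\<Sum>e\<in>J. b e * x e)) = complex_of_real (exp (- (\<Sum>e\<in>J. (b e)\<^sup>2) / 2))"
proof -
  let ?l = "\<lambda>x. \<Sum>e\<in>J. b e * x e"
  have pl: "poly_fn ?l" by (intro poly_fn_intros)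
  have "(\<E> x. ?l x ^ 1) = 0"
    by (simp, subst Bochner_Integration.integral_sum)
       (auto simp: gauss_coord_mean intro!: poly_fn_integrable poly_fn_intros)
  then have "(\<lambda>N::nat. \<E> x. iexp (?l x)) \<longlonglongrightarrow> complex_of_real (exp (- (\<Sum>e\<in>J. (b e)\<^sup>2) / 2))"
    using assms
    by (intro gaussian_char_of_moments[where m = "\<lambda>p. \<E> x. ?l x ^ p"]
         prob_space_gauss_array poly_fn_integrable poly_fn_power pl gauss_linear_form_moments)
       (auto simp: gauss.prob_space)
  then show ?thesis by (simp only: LIMSEQ_const_iff)
qed

lemma distr_gauss_coord: "distr gauss_array borel (\<lambda>x. x e) = std_normal_distribution"
proof -
  have "distr gauss_array std_normal_distribution (\<lambda>x. x e) = std_normal_distribution"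
    unfolding gauss_array_def by (rule distr_PiM_component) (auto intro: prob_space_std_normal)
  moreover have "distr gauss_array borel (\<lambda>x. x e) = distr gauss_array std_normal_distribution (\<lambda>x. x e)"
    by (rule distr_cong) auto
  ultimately show ?thesis by simp
qed

lemma normal_law_scaled_coord:
  assumes "0 \<le> \<sigma>"
  shows "distr gauss_array borel (\<lambda>x. \<sigma> * x e) = normal_law 0 \<sigma>"
proof (cases "\<sigma> = 0")
  case True
  have "distr gauss_array borel (\<lambda>x. 0::real) = return borel 0"
    by (intro measure_eqI) (auto simp: emeasure_distr gauss.emeasure_space_1 indicator_def)
  then show ?thesis using True by (simp add: normal_law_def)
next
  case False
  have "distributed gauss_array lborel (\<lambda>x. x e) (normal_density 0 1)"
    unfolding distributed_def using distr_gauss_coord[of e] by (simp cong: distr_cong)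
  from gauss.normal_density_affine[OF this, of \<sigma> 0] False assms
  have "distributed gauss_array lborel (\<lambda>x. \<sigma> * x e) (normal_density 0 \<sigma>)" by simp
  then show ?thesis
    using False unfolding distributed_def normal_law_def by (simp cong: distr_cong)
qed

text \<open>
  The linear form has the same characteristic function as a multiple of a single coordinate, whose law
  is known, including the degenerate case.
\<close>

lemma gauss_linear_form_law:
  assumes "finite J"
  shows "distr gauss_array borel (\<lambda>x. \<Sum>e\<in>J. b e * x e) = normal_law 0 (sqrt (\<Sum>e\<in>J. (b e)\<^sup>2))"
proof -
  let ?l = "\<lambda>x. \<Sum>e\<in>J. b e * x e" and ?s = "sqrt (\<Sum>e\<in>J. (b e)\<^sup>2)"
  have [measurable]: "?l \<in> borel_measurable gauss_array"
    by (intro borel_measurable_sum borel_measurable_times) auto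
  have "distr gauss_array borel ?l = distr gauss_array borel (\<lambda>x. ?s * x (0, 0))"
  proof (rule Levy_uniqueness)
    show "real_distribution (distr gauss_array borel ?l)"
      by (rule gauss.real_distribution_distr) measurable
    show "real_distribution (distr gauss_array borel (\<lambda>x. ?s * x (0, 0)))"
      by (rule gauss.real_distribution_distr) measurable
    show "char (distr gauss_array borel ?l) = char (distr gauss_array borel (\<lambda>x. ?s * x (0, 0)))"
    proof
      fix t
      have "char (distr gauss_array borel ?l) t = (\<E> x. iexp (\<Sum>e\<in>J. (t * b e) * x e))"
        unfolding char_def by (subst integral_distr) (simp_all add: sum_distrib_left mult.assoc)
      also have "\<dots> = complex_of_real (exp (- (t\<^sup>2 * (\<Sum>e\<in>J. (b e)\<^sup>2)) / 2))"
        unfolding gauss_linear_form_char[OF assms] by (simp add: power_mult_distrib sum_distrib_left)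
      also have "\<dots> = (\<E> x. iexp (\<Sum>e\<in>{(0, 0)}. (t * ?s) * x e))"
        by (subst gauss_linear_form_char) (simp_all add: power_mult_distrib sum_nonneg)
      also have "\<dots> = char (distr gauss_array borel (\<lambda>x. ?s * x (0, 0))) t"
        unfolding char_def by (subst integral_distr) (simp_all add: mult.assoc)
      finally show "char (distr gauss_array borel ?l) t = char (distr gauss_array borel (\<lambda>x. ?s * x (0, 0))) t" .
    qed
  qed
  then show ?thesis by (simp add: normal_law_scaled_coord sum_nonneg)
qed

text \<open>
  If \<open>C = A A\<^sup>T\<close>, then \<open>A\<close> applied to a vector of independent standard normal variables has
  covariance \<open>C\<close>. The characteristic function and the second moments are recorded for the
  convergence theorem.
\<close>

lemma gaussian_vector_exists:
  fixes C :: "nat \<Rightarrow> nat \<Rightarrow> real"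
  assumes fin: "finite I"
    and sym: "\<And>i j. i \<in> I \<Longrightarrow> j \<in> I \<Longrightarrow> C i j = C j i"
    and psd: "\<And>a. 0 \<le> quad_form I C a"
  obtains \<nu> where "centred_gaussian_vec I C \<nu>"
    and "\<And>a. (\<integral>x. iexp (\<Sum>i\<in>I. a i * x i) \<partial>\<nu>) = complex_of_real (exp (- quad_form I C a / 2))"
    and "\<And>i. i \<in> I \<Longrightarrow> integrable \<nu> (\<lambda>x. (x i)\<^sup>2)"
proof -
  obtain A where A: "\<And>i j. i \<in> I \<Longrightarrow> j \<in> I \<Longrightarrow> C i j = (\<Sum>k\<in>I. A i k * A j k)"
    using psd_factorization[OF fin sym psd] by blast
  \<comment> \<open>The coordinates \<open>(k, 0)\<close> of the Gaussian array serve as the independent normal variables.\<close>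
  define J where "J = (\<lambda>k. (k, 0::nat)) ` I"
  have J: "finite J" using fin by (simp add: J_def)
  have sumJ: "(\<Sum>e\<in>J. h e) = (\<Sum>k\<in>I. h (k, 0))" for h :: "nat \<times> nat \<Rightarrow> real"
    unfolding J_def by (subst sum.reindex) (auto simp: inj_on_def)
  define z where "z i x = (\<Sum>e\<in>J. A i (fst e) * x e)" for i and x :: "nat \<times> nat \<Rightarrow> real"
  have pz: "poly_fn (z i)" for i unfolding z_def[abs_def] by (intro poly_fn_intros)
  note mz [measurable] = borel_measurable_integrable[OF poly_fn_integrable[OF pz]]
  define Z where "Z x = (\<lambda>i\<in>I. z i x)" for x
  have mZ [measurable]: "Z \<in> measurable gauss_array (euclid I)"
    unfolding Z_def[abs_def] euclid_def by (intro measurable_restrict mz)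
  define \<nu> where "\<nu> = distr gauss_array (euclid I) Z"
  have mc [measurable]: "(\<lambda>x. x i) \<in> borel_measurable (euclid I)" if "i \<in> I" for i
    unfolding euclid_def by (rule measurable_component_singleton[OF that])
  have lin: "(\<Sum>i\<in>I. a i * Z x i) = (\<Sum>e\<in>J. (\<Sum>i\<in>I. a i * A i (fst e)) * x e)" for a x
    unfolding Z_def z_def
    by (simp add: sum_distrib_left sum_distrib_right mult.assoc) (rule sum.swap)
  have ml [measurable]: "(\<lambda>x. \<Sum>i\<in>I. a i * x i) \<in> borel_measurable (euclid I)" for a
    by (intro borel_measurable_sum borel_measurable_times) auto
  have var: "(\<Sum>e\<in>J. (\<Sum>i\<in>I. a i * A i (fst e))\<^sup>2) = quad_form I C a" for a
  proof -
    have "(\<Sum>e\<in>J. (\<Sum>i\<in>I. a i * A i (fst e))\<^sup>2) = (\<Sum>k\<in>I. \<Sum>i\<in>I. \<Sum>j\<in>I. a i * a j * (A i k * A j k))"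
      unfolding sumJ by (simp add: power2_eq_square sum_product mult_ac)
    also have "\<dots> = (\<Sum>i\<in>I. \<Sum>k\<in>I. \<Sum>j\<in>I. a i * a j * (A i k * A j k))" by (rule sum.swap)
    also have "\<dots> = (\<Sum>i\<in>I. \<Sum>j\<in>I. \<Sum>k\<in>I. a i * a j * (A i k * A j k))"
      by (intro sum.cong refl sum.swap)
    also have "\<dots> = quad_form I C a"
      using A by (simp add: sum_distrib_left)
    finally show ?thesis .
  qed
  have iz: "integrable gauss_array (\<lambda>x. z i x * z j x)" for i j
    by (intro poly_fn_integrable poly_fn_mult pz)
  have Ez: "(\<E> x. z i x) = 0" for i
    unfolding z_def
    by (subst Bochner_Integration.integral_sum)
       (auto simp: gauss_coord_mean intro!: poly_fn_integrable poly_fn_intros)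
  have Ezz: "(\<E> x. z i x * z j x) = C i j" if ij: "i \<in> I" "j \<in> I" for i j
  proof -
    have "z i x * z j x = (\<Sum>e\<in>J. \<Sum>a\<in>J. A i (fst e) * A j (fst a) * (x e * x a))" for x
      unfolding z_def by (simp add: sum_product mult_ac)
    moreover have int: "integrable gauss_array (\<lambda>x. A i (fst e) * A j (fst a) * (x e * x a))" for e a
      by (intro poly_fn_integrable poly_fn_intros)
    ultimately have "(\<E> x. z i x * z j x) =
        (\<Sum>e\<in>J. \<Sum>a\<in>J. A i (fst e) * A j (fst a) * (\<E> x. x e * x a))"
      by (simp add: Bochner_Integration.integral_sum int)
    also have "\<dots> = (\<Sum>e\<in>J. A i (fst e) * A j (fst e))"
      using J by (simp add: gauss_coord_covariance mult_delta_right sum.delta)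
    also have "\<dots> = C i j" unfolding sumJ using A ij by simp
    finally show ?thesis .
  qed
  have "prob_space \<nu>" unfolding \<nu>_def by (rule gauss.prob_space_distr) measurable
  have "centred_gaussian_vec I C \<nu>"
    unfolding centred_gaussian_vec_def gaussian_vec_def
  proof (intro conjI allI ballI)
    show "prob_space \<nu>" by fact
    show "sets \<nu> = sets (euclid I)" by (simp add: \<nu>_def)
    show "\<exists>m \<sigma>. 0 \<le> \<sigma> \<and> distr \<nu> borel (\<lambda>x. \<Sum>i\<in>I. a i * x i) = normal_law m \<sigma>" for a
    proof -
      have "distr \<nu> borel (\<lambda>x. \<Sum>i\<in>I. a i * x i) =
          distr gauss_array borel (\<lambda>x. \<Sum>e\<in>J. (\<Sum>i\<in>I. a i * A i (fst e)) * x e)"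
        unfolding \<nu>_def by (subst distr_distr) (auto simp: o_def lin)
      then show ?thesis
        unfolding gauss_linear_form_law[OF J] by (intro exI conjI) (auto intro: sum_nonneg)
    qed
    show "cumulant1 \<nu> (\<lambda>x. x k) = 0" if "k \<in> I" for k
      unfolding cumulant1_def \<nu>_def using that Ez by (subst integral_distr) (auto simp: Z_def)
    show "cumulant2 \<nu> (\<lambda>x. x k) (\<lambda>x. x l) = C k l" if kl: "k \<in> I" "l \<in> I" for k l
    proof -
      have "(\<integral>x. x k * x l \<partial>\<nu>) = C k l"
        unfolding \<nu>_def using kl Ezz by (subst integral_distr) (auto simp: Z_def intro: mc)
      moreover have "(\<integral>x. x k \<partial>\<nu>) = 0"
        unfolding \<nu>_def using kl Ez by (subst integral_distr) (auto simp: Z_def)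
      ultimately show ?thesis by (simp add: cumulant2_def)
    qed
  qed
  moreover have "(\<integral>x. iexp (\<Sum>i\<in>I. a i * x i) \<partial>\<nu>) =
      complex_of_real (exp (- quad_form I C a / 2))" for a
  proof -
    have "(\<integral>x. iexp (\<Sum>i\<in>I. a i * x i) \<partial>\<nu>) = (\<E> x. iexp (\<Sum>i\<in>I. a i * Z x i))"
      unfolding \<nu>_def by (rule integral_distr[OF mZ]) measurable
    then show ?thesis by (simp only: lin gauss_linear_form_char[OF J] var)
  qed
  moreover have "integrable \<nu> (\<lambda>x. (x i)\<^sup>2)" if "i \<in> I" for i
    unfolding \<nu>_def using that iz[of i i]
    by (subst integrable_distr_eq) (auto simp: Z_def power2_eq_square intro: mc)
  ultimately show ?thesis using that by blast
qed

section \<open>Weak convergence of random vectors from characteristic functions\<close>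

text \<open>
  Functions whose expectations are controlled by the characteristic function. Phase shifts \<open>b\<close> cover
  sines, so that cosines suffice.
\<close>

definition trig_poly :: "nat set \<Rightarrow> ((nat \<Rightarrow> real) \<Rightarrow> real) \<Rightarrow> bool" where
  "trig_poly I h \<longleftrightarrow> (\<exists>ps :: (real \<times> (nat \<Rightarrow> real) \<times> real) list.
     h = (\<lambda>x. \<Sum>(c, a, b)\<leftarrow>ps. c * cos ((\<Sum>i\<in>I. a i * x i) + b)))"

lemma trig_poly_const: "trig_poly I (\<lambda>x. c)"
  unfolding trig_poly_def by (rule exI[of _ "[(c, \<lambda>_. 0, 0)]"]) simp

lemma trig_poly_sin:
  assumes "finite I" "i \<in> I"
  shows "trig_poly I (\<lambda>x. sin (\<theta> * x i))"
  unfolding trig_poly_def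
  by (rule exI[of _ "[(1, \<lambda>j. if j = i then \<theta> else 0, - pi / 2)]"])
     (use assms in \<open>simp add: mult_delta_left sum.delta cos_diff\<close>)

lemma trig_poly_add: "trig_poly I f \<Longrightarrow> trig_poly I g \<Longrightarrow> trig_poly I (\<lambda>x. f x + g x)"
proof -
  assume "trig_poly I f" "trig_poly I g"
  then obtain ps qs where
    "f = (\<lambda>x. \<Sum>(c, a, b)\<leftarrow>ps. c * cos ((\<Sum>i\<in>I. a i * x i) + b))"
    "g = (\<lambda>x. \<Sum>(c, a, b)\<leftarrow>qs. c * cos ((\<Sum>i\<in>I. a i * x i) + b))"
    unfolding trig_poly_def by blast
  then show ?thesis unfolding trig_poly_def by (intro exI[of _ "ps @ qs"]) simp
qed

lemma trig_poly_term: "trig_poly I (\<lambda>x. c * cos ((\<Sum>i\<in>I. a i * x i) + b))"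
  unfolding trig_poly_def by (rule exI[of _ "[(c, a, b)]"]) simp

lemma trig_poly_sum_list: "(\<And>p. p \<in> set ps \<Longrightarrow> trig_poly I (f p)) \<Longrightarrow> trig_poly I (\<lambda>x. \<Sum>p\<leftarrow>ps. f p x)"
  by (induction ps) (auto intro: trig_poly_const trig_poly_add)

lemma trig_poly_mult:
  assumes "trig_poly I f" "trig_poly I g"
  shows "trig_poly I (\<lambda>x. f x * g x)"
proof -
  let ?t = "\<lambda>p x. case p of (c, a, b) \<Rightarrow> c * cos ((\<Sum>i\<in>I. a i * x i) + b)"
  obtain ps qs where f: "f = (\<lambda>x. \<Sum>p\<leftarrow>ps. ?t p x)" and g: "g = (\<lambda>x. \<Sum>p\<leftarrow>qs. ?t p x)"
    using assms unfolding trig_poly_def by blast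
  have prod: "trig_poly I (\<lambda>x. ?t p x * ?t q x)" for p q :: "real \<times> (nat \<Rightarrow> real) \<times> real"
  proof -
    obtain c a b c' a' b' where pq: "p = (c, a, b)" "q = (c', a', b')" by (cases p; cases q)
    have "?t p x * ?t q x = c * c' / 2 * cos ((\<Sum>i\<in>I. (a i - a' i) * x i) + (b - b')) +
        c * c' / 2 * cos ((\<Sum>i\<in>I. (a i + a' i) * x i) + (b + b'))" for x
    proof -
      define s s' where "s = (\<Sum>i\<in>I. a i * x i)" "s' = (\<Sum>i\<in>I. a' i * x i)"
      have 1: "(\<Sum>i\<in>I. (a i - a' i) * x i) + (b - b') = (s + b) - (s' + b')"
        unfolding s_s'_def by (simp add: left_diff_distrib sum_subtractf)
      have 2: "(\<Sum>i\<in>I. (a i + a' i) * x i) + (b + b') = (s + b) + (s' + b')"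
        unfolding s_s'_def by (simp add: distrib_right sum.distrib)
      show ?thesis
        unfolding 1 2 pq prod.case s_s'_def[symmetric] cos_diff[of "s + b"] cos_add[of "s + b"]
        by (simp add: algebra_simps)
    qed
    then show ?thesis by (simp only: trig_poly_add trig_poly_term)
  qed
  have "f x * g x = (\<Sum>p\<leftarrow>ps. \<Sum>q\<leftarrow>qs. ?t p x * ?t q x)" for x
    unfolding f g by (simp add: sum_list_mult_const sum_list_const_mult)
  then show ?thesis using prod by (simp only: trig_poly_sum_list)
qed

lemma trig_poly_continuous: "trig_poly I h \<Longrightarrow> continuous_on S h"
proof -
  assume "trig_poly I h"
  then obtain ps where h: "h = (\<lambda>x. \<Sum>(c, a, b)\<leftarrow>ps. c * cos ((\<Sum>i\<in>I. a i * x i) + b))"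
    unfolding trig_poly_def by blast
  have "continuous_on S (\<lambda>x::nat \<Rightarrow> real. x i)" for i
    by (rule continuous_on_subset[OF continuous_on_product_coordinates subset_UNIV])
  then have t: "continuous_on S (\<lambda>x. c * cos ((\<Sum>i\<in>I. a i * x i) + b))" for a b c
    by (intro continuous_intros)
  show ?thesis unfolding h
    by (induction ps) (auto intro!: continuous_intros t)
qed

text \<open>
  As a set of functions on all of \<open>nat\<close>, the box is a product of compact sets, which are singletons
  outside \<open>I\<close>.
\<close>

lemma compact_box: "compact (PiE I (\<lambda>_. {- R..R}) :: (nat \<Rightarrow> real) set)"
proof -
  have eq: "PiE I (\<lambda>_. {- R..R}) = PiE UNIV (\<lambda>i::nat. if i \<in> I then {- R..R} else {undefined::real})"
    by (auto simp: PiE_def Pi_def extensional_def split: if_splits)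
  have "compactin (product_topology (\<lambda>_::nat. euclidean :: real topology) UNIV)
      (PiE UNIV (\<lambda>i::nat. if i \<in> I then {- R..R} else {undefined::real}))"
    by (subst compactin_PiE) auto
  then show ?thesis unfolding eq euclidean_product_topology by simp
qed

text \<open>
  On the box \<open>[- R, R]\<^sup>I\<close> the functions \<open>sin (\<theta> x\<^sub>i)\<close> with \<open>\<theta> = \<pi> / (2 R)\<close> separate points, hence the
  polynomials in them are dense by the Stone-Weierstrass theorem. Their values outside the box are
  also attained inside it, because \<open>sin (\<theta> x\<^sub>i)\<close> already runs through all of \<open>[- 1, 1]\<close> there. This
  gives the global bound on \<open>h\<close>, which a trigonometric polynomial with arbitrary frequencies need
  not satisfy.
\<close>

lemma sin_poly_approximation:
  fixes g :: "(nat \<Rightarrow> real) \<Rightarrow> real"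
  assumes fin: "finite I" and R: "R > 0" and e: "e > 0"
    and g: "continuous_on (PiE I (\<lambda>_. UNIV)) g" and C: "\<And>x. x \<in> PiE I (\<lambda>_. UNIV) \<Longrightarrow> \<bar>g x\<bar> \<le> C"
  obtains h where "trig_poly I h"
    "\<And>x. x \<in> PiE I (\<lambda>_. {- R..R}) \<Longrightarrow> \<bar>g x - h x\<bar> < e"
    "\<And>x. x \<in> PiE I (\<lambda>_. UNIV) \<Longrightarrow> \<bar>h x\<bar> \<le> C + e"
proof -
  define \<theta> where "\<theta> = pi / (2 * R)"
  have \<theta>: "\<theta> > 0" using R by (simp add: \<theta>_def)
  define Q where "Q h \<longleftrightarrow> trig_poly I h \<and>
      (\<forall>x y. (\<forall>i\<in>I. sin (\<theta> * x i) = sin (\<theta> * y i)) \<longrightarrow> h x = h y)" for h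
  let ?S = "PiE I (\<lambda>_. {- R..R}) :: (nat \<Rightarrow> real) set"
  have "\<exists>h. Q h \<and> (\<forall>x\<in>?S. \<bar>g x - h x\<bar> < e)"
  proof (rule Stone_Weierstrass_HOL[OF compact_box])
    show "Q (\<lambda>x. c)" for c unfolding Q_def by (simp add: trig_poly_const)
    show "continuous_on ?S f" if "Q f" for f using that trig_poly_continuous unfolding Q_def by blast
    show "Q (\<lambda>x. f x + f' x)" if "Q f \<and> Q f'" for f f'
    proof -
      have "f x + f' x = f y + f' y" if "\<forall>i\<in>I. sin (\<theta> * x i) = sin (\<theta> * y i)" for x y
        using \<open>Q f \<and> Q f'\<close> that unfolding Q_def by (intro arg_cong2[of _ _ _ _ "(+)"]) blast+
      then show ?thesis using that unfolding Q_def by (simp add: trig_poly_add)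
    qed
    show "Q (\<lambda>x. f x * f' x)" if "Q f \<and> Q f'" for f f'
    proof -
      have "f x * f' x = f y * f' y" if "\<forall>i\<in>I. sin (\<theta> * x i) = sin (\<theta> * y i)" for x y
        using \<open>Q f \<and> Q f'\<close> that unfolding Q_def by (intro arg_cong2[of _ _ _ _ "(*)"]) blast+
      then show ?thesis using that unfolding Q_def by (simp add: trig_poly_mult)
    qed
    show "\<exists>f. Q f \<and> f x \<noteq> f y" if xy: "x \<in> ?S \<and> y \<in> ?S \<and> x \<noteq> y" for x y
    proof -
      obtain i where i: "i \<in> I" "x i \<noteq> y i" using xy by (metis PiE_ext)
      have b: "- (pi / 2) \<le> \<theta> * u" "\<theta> * u \<le> pi / 2" if "u \<in> {- R..R}" for u
      proof -
        have "\<theta> * (- R) \<le> \<theta> * u" "\<theta> * u \<le> \<theta> * R" using that \<theta> mult_left_mono[of "- R" u \<theta>] mult_left_mono[of u R \<theta>] by auto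
        moreover have "\<theta> * R = pi / 2" using R by (simp add: \<theta>_def)
        ultimately show "- (pi / 2) \<le> \<theta> * u" "\<theta> * u \<le> pi / 2" by auto
      qed
      have "x i \<in> {- R..R}" "y i \<in> {- R..R}" using xy i by auto
      then have "sin (\<theta> * x i) \<noteq> sin (\<theta> * y i)"
        using sin_inj_pi[OF b(1) b(2) b(1) b(2), of "x i" "y i"] i \<theta> by auto
      moreover have "Q (\<lambda>x. sin (\<theta> * x i))" unfolding Q_def using trig_poly_sin[OF fin i(1)] i by auto
      ultimately show ?thesis by blast
    qed
    show "continuous_on ?S g" by (rule continuous_on_subset[OF g]) auto
    show "0 < e" by (rule e)
  qed
  then obtain h where h: "trig_poly I h" "\<And>x y. (\<forall>i\<in>I. sin (\<theta> * x i) = sin (\<theta> * y i)) \<Longrightarrow> h x = h y"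
    and gh: "\<And>x. x \<in> ?S \<Longrightarrow> \<bar>g x - h x\<bar> < e"
    unfolding Q_def by blast
  have "\<bar>h x\<bar> \<le> C + e" for x
  proof -
    \<comment> \<open>A point of the box at which all the sines take the same values as at \<open>x\<close>.\<close>
    define y where "y = (\<lambda>i\<in>I. arcsin (sin (\<theta> * x i)) / \<theta>)"
    have "y \<in> ?S"
    proof (intro PiE_I)
      fix i assume "i \<in> I"
      have "- (pi / 2) \<le> arcsin (sin (\<theta> * x i))" "arcsin (sin (\<theta> * x i)) \<le> pi / 2"
        by (rule arcsin_lbound arcsin_ubound, simp, simp)+
      moreover have "\<theta> * R = pi / 2" using R by (simp add: \<theta>_def)
      moreover have "y i * \<theta> = arcsin (sin (\<theta> * x i))"
        using \<open>i \<in> I\<close> \<theta> by (simp add: y_def)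
      ultimately have "- R * \<theta> \<le> y i * \<theta>" "y i * \<theta> \<le> R * \<theta>"
        by (simp_all add: mult.commute)
      then show "y i \<in> {- R..R}"
        using \<theta> by (simp only: mult_le_cancel_right_pos atLeastAtMost_iff)
    qed (simp add: y_def)
    moreover have "h x = h y" using \<theta> by (intro h(2)) (simp add: y_def sin_arcsin)
    moreover have "\<bar>g y\<bar> \<le> C" using \<open>y \<in> ?S\<close> by (intro C) auto
    ultimately show ?thesis using gh[of y] by auto
  qed
  with h gh that show ?thesis by blast
qed

text \<open>
  The inclusion of \<open>euclid I\<close> into \<open>nat \<Rightarrow> real\<close> is Borel measurable, as the coordinates outside \<open>I\<close> are
  constant.
\<close>

lemma euclid_continuous_measurable:
  fixes g :: "(nat \<Rightarrow> real) \<Rightarrow> real"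
  assumes "continuous_on (space (euclid I)) g"
  shows "g \<in> borel_measurable (euclid I)"
proof -
  have "(\<lambda>x. x i) \<in> borel_measurable (euclid I)" for i
  proof (cases "i \<in> I")
    case True
    then show ?thesis unfolding euclid_def by (rule measurable_component_singleton)
  next
    case False
    have "(\<lambda>x. x i) \<in> borel_measurable (euclid I) \<longleftrightarrow> (\<lambda>x. undefined :: real) \<in> borel_measurable (euclid I)"
      by (rule measurable_cong) (use False in \<open>auto simp: euclid_def space_PiM PiE_def extensional_def\<close>)
    then show ?thesis by simp
  qed
  then have "(\<lambda>x. x) \<in> borel_measurable (euclid I)"
    by (rule measurable_coordinatewise_then_product)
  then have "(\<lambda>x. x) \<in> measurable (euclid I) (restrict_space borel (space (euclid I)))"
    by (rule measurable_restrict_space2[rotated]) simp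
  from measurable_compose[OF this borel_measurable_continuous_on_restrict[OF assms]]
  show ?thesis .
qed

text \<open>
  The estimate \<open>cut\<close> bounds the error of replacing \<open>g\<close> by its approximation \<open>h\<close>: outside the box
  \<open>\<Sum>\<^sub>i x\<^sub>i\<^sup>2 \<ge> R\<^sup>2\<close> holds, so the error there is at most a multiple of \<open>\<Sum>\<^sub>i x\<^sub>i\<^sup>2 / R\<^sup>2\<close>, whose
  expectation is uniformly small for large \<open>R\<close>. The expectations of \<open>h\<close> converge by hypothesis.
\<close>

lemma weak_conv_vec_of_char:
  fixes \<mu> :: "nat \<Rightarrow> (nat \<Rightarrow> real) measure"
  assumes fin: "finite I"
    and prob: "\<And>N. N > 0 \<Longrightarrow> prob_space (\<mu> N)" "prob_space \<nu>"
    and sets: "\<And>N. N > 0 \<Longrightarrow> sets (\<mu> N) = sets (euclid I)" "sets \<nu> = sets (euclid I)"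
    and sq: "\<And>N i. N > 0 \<Longrightarrow> i \<in> I \<Longrightarrow> integrable (\<mu> N) (\<lambda>x. (x i)\<^sup>2)" "\<And>i. i \<in> I \<Longrightarrow> integrable \<nu> (\<lambda>x. (x i)\<^sup>2)"
    and bdd: "\<And>i. i \<in> I \<Longrightarrow> convergent (\<lambda>N. \<integral>x. (x i)\<^sup>2 \<partial>\<mu> N)"
    and char: "\<And>a. (\<lambda>N. \<integral>x. iexp (\<Sum>i\<in>I. a i * x i) \<partial>\<mu> N) \<longlonglongrightarrow> (\<integral>x. iexp (\<Sum>i\<in>I. a i * x i) \<partial>\<nu>)"
  shows "weak_conv_vec I \<mu> \<nu>"
  unfolding weak_conv_vec_def
proof (intro allI impI, elim conjE)
  let ?l = "\<lambda>a x. \<Sum>i\<in>I. a i * x i :: real"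
  fix g :: "(nat \<Rightarrow> real) \<Rightarrow> real"
  assume gc: "continuous_on (space (euclid I)) g" and gb: "bounded (g ` space (euclid I))"
  have sp: "space (euclid I) = PiE I (\<lambda>_. UNIV)" by (simp add: euclid_def space_PiM)
  have ml [measurable]: "(\<lambda>x. x i) \<in> borel_measurable (euclid I)" if "i \<in> I" for i
    unfolding euclid_def by (rule measurable_component_singleton[OF that])
  obtain C where "C > 0" "\<forall>y\<in>g ` PiE I (\<lambda>_. UNIV). norm y \<le> C"
    using gb unfolding bounded_pos sp by blast
  then have C: "C \<ge> 0" "\<And>x. x \<in> PiE I (\<lambda>_. UNIV) \<Longrightarrow> \<bar>g x\<bar> \<le> C" by auto
  have lin [measurable]: "(\<lambda>x. ?l a x) \<in> borel_measurable (euclid I)" for a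
    by (intro borel_measurable_sum borel_measurable_times) auto
  have ms: "measurable M borel = (measurable (euclid I) borel :: ((nat \<Rightarrow> real) \<Rightarrow> 'b::topological_space) set)"
    if "sets M = sets (euclid I)" for M
    using that by (rule measurable_cong_sets) simp

  have cos_eq: "(\<integral>x. cos (?l a x + b) \<partial>M) =
       cos b * Re (\<integral>x. iexp (?l a x) \<partial>M) - sin b * Im (\<integral>x. iexp (?l a x) \<partial>M)"
    if M: "prob_space M" "sets M = sets (euclid I)" for M a b
  proof -
    interpret prob_space M by fact
    have [measurable]: "(\<lambda>x. ?l a x) \<in> borel_measurable M" using lin[of a] ms[OF M(2)] by blast
    have i: "integrable M (\<lambda>x. iexp (?l a x))"
    proof (rule integrable_const_bound[where B = 1])
      have "(\<lambda>s. iexp s) \<in> borel_measurable borel" by measurable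
      then show "(\<lambda>x. iexp (?l a x)) \<in> borel_measurable M"
        by (rule measurable_compose[rotated]) fact
      show "AE x in M. cmod (iexp (?l a x)) \<le> 1"
        by (simp only: norm_exp_i_times) simp
    qed
    have "cos (?l a x + b) = cos b * Re (iexp (?l a x)) - sin b * Im (iexp (?l a x))" for x
      by (simp only: cos_add Re_exp Im_exp) simp
    then show ?thesis
      using integrable_Re[OF i] integrable_Im[OF i]
      by (simp only: Bochner_Integration.integral_diff integrable_mult_right integral_mult_right_zero
          integral_Re[OF i] integral_Im[OF i])
  qed
  have trig_conv: "(\<lambda>N. \<integral>x. h x \<partial>\<mu> N) \<longlonglongrightarrow> (\<integral>x. h x \<partial>\<nu>)" if tp: "trig_poly I h" for h
  proof -
    let ?t = "\<lambda>p x. case p of (c, a, b) \<Rightarrow> c * cos (?l a x + b)"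
    obtain ps where h: "h = (\<lambda>x. \<Sum>p\<leftarrow>ps. ?t p x)"
      using tp unfolding trig_poly_def by blast
    have ti: "integrable M (?t p)" if M: "prob_space M" "sets M = sets (euclid I)" for M p
    proof -
      interpret prob_space M by fact
      obtain c a b where p: "p = (c, a, b)" by (cases p)
      have [measurable]: "(\<lambda>x. ?l a x) \<in> borel_measurable M" using lin[of a] ms[OF M(2)] by blast
      show ?thesis unfolding p prod.case
        by (rule integrable_const_bound[where B = "\<bar>c\<bar>"]) (auto simp: abs_mult mult_left_le)
    qed
    have eq: "(\<integral>x. h x \<partial>M) = (\<Sum>p\<leftarrow>ps. \<integral>x. ?t p x \<partial>M)" if M: "prob_space M" "sets M = sets (euclid I)" for M
    proof -
      have "integrable M (\<lambda>x. \<Sum>p\<leftarrow>qs. ?t p x) \<and> (\<integral>x. (\<Sum>p\<leftarrow>qs. ?t p x) \<partial>M) = (\<Sum>p\<leftarrow>qs. \<integral>x. ?t p x \<partial>M)" for qs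
        using ti[OF M] by (induction qs) auto
      then show ?thesis unfolding h by blast
    qed
    have t_conv: "(\<lambda>N. \<integral>x. ?t p x \<partial>\<mu> N) \<longlonglongrightarrow> (\<integral>x. ?t p x \<partial>\<nu>)" for p
    proof -
      obtain c a b where p: "p = (c, a, b)" by (cases p)
      let ?E = "\<lambda>M. \<integral>x. iexp (?l a x) \<partial>M"
      have c1: "(\<lambda>N. c * (cos b * Re (?E (\<mu> N)) - sin b * Im (?E (\<mu> N)))) \<longlonglongrightarrow>
          c * (cos b * Re (?E \<nu>) - sin b * Im (?E \<nu>))"
        by (intro tendsto_intros char)
      have c2: "\<forall>\<^sub>F N in sequentially. c * (cos b * Re (?E (\<mu> N)) - sin b * Im (?E (\<mu> N))) = (\<integral>x. ?t p x \<partial>\<mu> N)"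
        using eventually_gt_at_top[of 0]
        by eventually_elim (simp add: p cos_eq[OF prob(1) sets(1)])
      have c3: "c * (cos b * Re (?E \<nu>) - sin b * Im (?E \<nu>)) = (\<integral>x. ?t p x \<partial>\<nu>)"
        by (simp add: p cos_eq[OF prob(2) sets(2)])
      from Lim_transform_eventually[OF c1 c2] show ?thesis unfolding c3 .
    qed
    have "(\<lambda>N. \<Sum>p\<leftarrow>ps. \<integral>x. ?t p x \<partial>\<mu> N) \<longlonglongrightarrow> (\<Sum>p\<leftarrow>ps. \<integral>x. ?t p x \<partial>\<nu>)"
      using t_conv by (induction ps) (auto intro: tendsto_add)
    moreover have "\<forall>\<^sub>F N in sequentially. (\<Sum>p\<leftarrow>ps. \<integral>x. ?t p x \<partial>\<mu> N) = (\<integral>x. h x \<partial>\<mu> N)"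
      using eventually_gt_at_top[of 0] by eventually_elim (simp add: eq[OF prob(1) sets(1)])
    ultimately have "(\<lambda>N. \<integral>x. h x \<partial>\<mu> N) \<longlonglongrightarrow> (\<Sum>p\<leftarrow>ps. \<integral>x. ?t p x \<partial>\<nu>)"
      by (rule Lim_transform_eventually)
    then show ?thesis by (simp add: eq[OF prob(2) sets(2)])
  qed

  define B where "B M = (\<Sum>i\<in>I. \<integral>x. (x i)\<^sup>2 \<partial>M)" for M :: "(nat \<Rightarrow> real) measure"
  have B0: "B M \<ge> 0" for M unfolding B_def by (intro sum_nonneg) simp
  have cut: "\<bar>(\<integral>x. g x \<partial>M) - (\<integral>x. h x \<partial>M)\<bar> \<le> e + (2 * C + e) * (B M / R\<^sup>2)"
    if M: "prob_space M" "sets M = sets (euclid I)" "\<And>i. i \<in> I \<Longrightarrow> integrable M (\<lambda>x. (x i)\<^sup>2)"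
      and R: "R > 0" and e: "e > 0" and h: "trig_poly I h"
        "\<And>x. x \<in> PiE I (\<lambda>_. {- R..R}) \<Longrightarrow> \<bar>g x - h x\<bar> < e"
        "\<And>x. x \<in> PiE I (\<lambda>_. UNIV) \<Longrightarrow> \<bar>h x\<bar> \<le> C + e" for M R e h
  proof -
    interpret prob_space M by fact
    have spM: "space M = PiE I (\<lambda>_. UNIV)" using sets_eq_imp_space_eq[OF M(2)] sp by simp
    have gm: "g \<in> borel_measurable M" using euclid_continuous_measurable[OF gc] ms[OF M(2)] by blast
    have hm: "h \<in> borel_measurable M"
      using euclid_continuous_measurable[OF trig_poly_continuous[OF h(1)]] ms[OF M(2)] by blast
    have gi: "integrable M g"
      by (rule integrable_const_bound[where B = C]) (use C spM gm in auto)
    have hi: "integrable M h"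
      by (rule integrable_const_bound[where B = "C + e"]) (use h spM hm in auto)
    have si: "integrable M (\<lambda>x. \<Sum>i\<in>I. (x i)\<^sup>2)" using M(3) by (intro Bochner_Integration.integrable_sum) auto
    have pt: "\<bar>g x - h x\<bar> \<le> e + (2 * C + e) * ((\<Sum>i\<in>I. (x i)\<^sup>2) / R\<^sup>2)" if xM: "x \<in> space M" for x
    proof (cases "x \<in> PiE I (\<lambda>_. {- R..R})")
      case True
      have "0 \<le> (2 * C + e) * ((\<Sum>i\<in>I. (x i)\<^sup>2) / R\<^sup>2)"
        using C e by (intro mult_nonneg_nonneg divide_nonneg_nonneg sum_nonneg) auto
      then show ?thesis using h(2)[OF True] by linarith
    next
      case False
      then obtain i where i: "i \<in> I" "x i \<notin> {- R..R}" using xM spM by (auto simp: PiE_def Pi_def)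
      then have "R \<le> \<bar>x i\<bar>" by auto
      then have "R\<^sup>2 \<le> (x i)\<^sup>2" using R by (metis abs_le_square_iff abs_of_pos)
      also have "\<dots> \<le> (\<Sum>i\<in>I. (x i)\<^sup>2)" using i fin by (intro member_le_sum) auto
      finally have "1 \<le> (\<Sum>i\<in>I. (x i)\<^sup>2) / R\<^sup>2" using R by simp
      then have "(2 * C + e) * 1 \<le> (2 * C + e) * ((\<Sum>i\<in>I. (x i)\<^sup>2) / R\<^sup>2)"
        using C e by (intro mult_left_mono) auto
      moreover have "\<bar>g x - h x\<bar> \<le> (2 * C + e) * 1"
      proof -
        have "\<bar>g x\<bar> \<le> C" "\<bar>h x\<bar> \<le> C + e" using C h xM spM by auto
        then show ?thesis using abs_triangle_ineq4[of "g x" "h x"] by simp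
      qed
      ultimately have "\<bar>g x - h x\<bar> \<le> (2 * C + e) * ((\<Sum>i\<in>I. (x i)\<^sup>2) / R\<^sup>2)"
        by (rule order_trans[rotated])
      then show ?thesis using e by (simp only: add_increasing less_imp_le)
    qed
    have "\<bar>(\<integral>x. g x \<partial>M) - (\<integral>x. h x \<partial>M)\<bar> = \<bar>\<integral>x. g x - h x \<partial>M\<bar>"
      by (simp add: Bochner_Integration.integral_diff gi hi)
    also have "\<dots> \<le> (\<integral>x. \<bar>g x - h x\<bar> \<partial>M)" by (rule integral_abs_bound)
    also have "\<dots> \<le> (\<integral>x. e + (2 * C + e) * ((\<Sum>i\<in>I. (x i)\<^sup>2) / R\<^sup>2) \<partial>M)"
      using pt si gi hi by (intro integral_mono) auto
    also have "\<dots> = e + (2 * C + e) * (B M / R\<^sup>2)"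
      unfolding B_def using si M(3) by (simp add: prob_space Bochner_Integration.integral_sum)
    finally show ?thesis .
  qed
  have "convergent (\<lambda>N. B (\<mu> N))"
    unfolding B_def
    using fin bdd
  proof (induction I rule: finite_induct)
    case (insert i I)
    then show ?case by (auto intro!: convergent_add)
  qed (simp add: convergent_const)
  from convergent_imp_Bseq[OF this] obtain b where "\<forall>N. norm (B (\<mu> N)) \<le> b"
    unfolding Bseq_def by blast
  then have b: "\<bar>B (\<mu> N)\<bar> \<le> b" for N by simp
  define b' where "b' = max b (B \<nu>)"
  have b': "B (\<mu> N) \<le> b'" "B \<nu> \<le> b'" "0 \<le> b'" for N
    using b[of N] B0[of \<nu>] by (auto simp: b'_def)
  show "(\<lambda>N. \<integral>x. g x \<partial>\<mu> N) \<longlonglongrightarrow> (\<integral>x. g x \<partial>\<nu>)"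
  proof (rule LIMSEQ_I)
    fix d :: real assume d: "0 < d"
    define e where "e = d / 8"
    \<comment> \<open>Makes both tail terms in \<open>cut\<close> at most \<open>d / 8\<close>; the summand 1 keeps \<open>R\<close> positive.\<close>
    define R where "R = sqrt (8 * (2 * C + e) * b' / d + 1)"
    have e: "0 < e" using d by (simp add: e_def)
    have R2: "R\<^sup>2 = 8 * (2 * C + e) * b' / d + 1"
      unfolding R_def using C e d b' by (intro real_sqrt_pow2) (auto intro!: add_nonneg_nonneg divide_nonneg_pos mult_nonneg_nonneg)
    have "0 \<le> 8 * (2 * C + e) * b' / d"
      using C e d b' by (auto intro!: divide_nonneg_pos mult_nonneg_nonneg)
    then have R: "0 < R" "0 < R\<^sup>2" unfolding R2 by (simp_all add: R_def)
    have small: "(2 * C + e) * (B M / R\<^sup>2) \<le> d / 8" if "B M \<le> b'" for M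
    proof -
      have "(2 * C + e) * B M \<le> (2 * C + e) * b'"
        using that C e by (intro mult_left_mono) auto
      also have "\<dots> \<le> d / 8 * R\<^sup>2" unfolding R2 using d by (simp add: field_simps)
      finally show ?thesis using R by (simp add: field_simps)
    qed
    obtain h where h: "trig_poly I h"
        "\<And>x. x \<in> PiE I (\<lambda>_. {- R..R}) \<Longrightarrow> \<bar>g x - h x\<bar> < e"
        "\<And>x. x \<in> PiE I (\<lambda>_. UNIV) \<Longrightarrow> \<bar>h x\<bar> \<le> C + e"
      using sin_poly_approximation[OF fin R(1) e gc[unfolded sp] C(2)] by blast
    obtain no where no: "\<And>N. N \<ge> no \<Longrightarrow> norm ((\<integral>x. h x \<partial>\<mu> N) - (\<integral>x. h x \<partial>\<nu>)) < d / 8"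
      using LIMSEQ_D[OF trig_conv[OF h(1)], of "d / 8"] d by auto
    have "norm ((\<integral>x. g x \<partial>\<mu> N) - (\<integral>x. g x \<partial>\<nu>)) < d" if N: "N \<ge> Suc no" for N
    proof -
      have N0: "N > 0" using N by simp
      have "\<bar>(\<integral>x. g x \<partial>\<mu> N) - (\<integral>x. h x \<partial>\<mu> N)\<bar> \<le> e + (2 * C + e) * (B (\<mu> N) / R\<^sup>2)"
        using cut[OF prob(1)[OF N0] sets(1)[OF N0] sq(1)[OF N0] R(1) e h] by blast
      moreover have "\<bar>(\<integral>x. g x \<partial>\<nu>) - (\<integral>x. h x \<partial>\<nu>)\<bar> \<le> e + (2 * C + e) * (B \<nu> / R\<^sup>2)"
        using cut[OF prob(2) sets(2) sq(2) R(1) e h] by blast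
      moreover have "\<bar>(\<integral>x. h x \<partial>\<mu> N) - (\<integral>x. h x \<partial>\<nu>)\<bar> < d / 8" using no[of N] N by simp
      ultimately show ?thesis
        using small[OF b'(1)[of N]] small[OF b'(2)] d unfolding e_def real_norm_def by linarith
    qed
    then show "\<exists>no. \<forall>N\<ge>no. norm ((\<integral>x. g x \<partial>\<mu> N) - (\<integral>x. g x \<partial>\<nu>)) < d" by blast
  qed
qed

section \<open>Trace words\<close>

text \<open>
  Square matrices are represented by their entries, with the size \<open>K\<close> passed to the operations. The
  algebraic laws then hold without any conditions on dimensions.
\<close>

type_synonym kernel = "nat \<Rightarrow> nat \<Rightarrow> real"

definition kmul :: "nat \<Rightarrow> kernel \<Rightarrow> kernel \<Rightarrow> kernel" where
  "kmul K A B = (\<lambda>i j. \<Sum>k<K. A i k * B k j)"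

definition ktrace :: "nat \<Rightarrow> kernel \<Rightarrow> real" where
  "ktrace K A = (\<Sum>i<K. A i i)"

definition ktransp :: "kernel \<Rightarrow> kernel" where
  "ktransp A = (\<lambda>i j. A j i)"

lemma kmul_assoc: "kmul K (kmul K A B) C = kmul K A (kmul K B C)"
proof (intro ext)
  fix i j
  have "kmul K (kmul K A B) C i j = (\<Sum>k<K. \<Sum>l<K. A i l * B l k * C k j)"
    by (simp add: kmul_def sum_distrib_right)
  also have "\<dots> = (\<Sum>l<K. \<Sum>k<K. A i l * B l k * C k j)" by (rule sum.swap)
  also have "\<dots> = kmul K A (kmul K B C) i j"
    by (simp add: kmul_def sum_distrib_left mult.assoc)
  finally show "kmul K (kmul K A B) C i j = kmul K A (kmul K B C) i j" .
qed

lemma ktransp_kmul: "ktransp (kmul K A B) = kmul K (ktransp B) (ktransp A)"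
  by (simp add: ktransp_def kmul_def mult.commute)

lemma ktrace_kmul_commute: "ktrace K (kmul K A B) = ktrace K (kmul K B A)"
proof -
  have "ktrace K (kmul K A B) = (\<Sum>k<K. \<Sum>i<K. A i k * B k i)"
    unfolding ktrace_def kmul_def by (rule sum.swap)
  then show ?thesis by (simp add: ktrace_def kmul_def mult.commute)
qed

text \<open>
  An \<open>atom\<close> is a product of constant matrices and transposes of such. A \<open>segment\<close> stands for
  \<open>a\<^sub>0 X\<^sup>s\<^sup>1 a\<^sub>1 X\<^sup>s\<^sup>2 \<dots> a\<^sub>k\<close>, which begins and ends with an atom; the Boolean values mark the transposed
  factors \<open>X\<close>. A cyclic word is either the trace of an atom or the trace of \<open>X\<^sup>s\<close> times a segment. Thus
  the syntax itself ensures that neighbouring factors \<open>X\<close> are separated by an atom.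
\<close>

datatype atom = Base nat | Mul atom atom | Transp atom

datatype segment = At atom | Nd atom bool segment

datatype cword = Closed atom | Cyc bool segment

fun link :: "segment \<Rightarrow> bool \<Rightarrow> segment \<Rightarrow> segment" where
  "link (At a) s V = Nd a s V"
| "link (Nd a t U) s V = Nd a t (link U s V)"

fun smul :: "segment \<Rightarrow> segment \<Rightarrow> segment" where
  "smul (At a) (At b) = At (Mul a b)"
| "smul (At a) (Nd b s V) = Nd (Mul a b) s V"
| "smul (Nd a s U) V = Nd a s (smul U V)"

fun stransp :: "segment \<Rightarrow> segment" where
  "stransp (At a) = At (Transp a)"
| "stransp (Nd a s V) = link (stransp V) (\<not> s) (At (Transp a))"

text \<open>
  All ways of writing a segment as \<open>P X\<^sup>t Q\<close>, one for each factor \<open>X\<close> in it.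
\<close>

fun splits :: "segment \<Rightarrow> (segment \<times> bool \<times> segment) list" where
  "splits (At a) = []"
| "splits (Nd a s V) = (At a, s, V) # map (\<lambda>(P, t, Q). (Nd a s P, t, Q)) (splits V)"

text \<open>
  The trace of a segment; its last atom is moved cyclically to the front and multiplied with the
  first one, so that neighbouring atoms merge.
\<close>

fun closure_word :: "segment \<Rightarrow> cword" where
  "closure_word (At a) = Closed a"
| "closure_word (Nd a s V) = Cyc s (smul V (At a))"

text \<open>
  By cyclicity of the trace, each factor \<open>X\<close> can be moved to the front; these are the results.
\<close>

fun rotations :: "cword \<Rightarrow> (bool \<times> segment) list" where
  "rotations (Closed a) = []"
| "rotations (Cyc s V) = (s, V) # map (\<lambda>(P, t, Q). (t, link Q s P)) (splits V)"

text \<open>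
  The word left after a factor \<open>X\<^sup>s\<close> of one trace \<open>Tr (X\<^sup>s U)\<close> has been contracted with a factor \<open>X\<^sup>t\<close> of
  another trace \<open>Tr (X\<^sup>t V)\<close>: the two traces are merged, with one of them reversed if both factors have
  the same orientation.
\<close>

definition pair_word :: "bool \<Rightarrow> segment \<Rightarrow> bool \<Rightarrow> segment \<Rightarrow> cword" where
  "pair_word s U t V = closure_word (smul U (if s = t then stransp V else V))"

fun sdeg :: "segment \<Rightarrow> nat" where
  "sdeg (At a) = 0"
| "sdeg (Nd a s V) = Suc (sdeg V)"

fun wdeg :: "cword \<Rightarrow> nat" where
  "wdeg (Closed a) = 0"
| "wdeg (Cyc s V) = Suc (sdeg V)"

lemma sdeg_link [simp]: "sdeg (link U s V) = Suc (sdeg U + sdeg V)"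
  by (induction U s V rule: link.induct) auto

lemma sdeg_smul [simp]: "sdeg (smul U V) = sdeg U + sdeg V"
  by (induction U V rule: smul.induct) auto

lemma sdeg_stransp [simp]: "sdeg (stransp V) = sdeg V"
  by (induction V) auto

lemma wdeg_closure_word [simp]: "wdeg (closure_word V) = sdeg V"
  by (cases V) auto

lemma sdeg_splits: "(P, t, Q) \<in> set (splits V) \<Longrightarrow> Suc (sdeg P + sdeg Q) = sdeg V"
  by (induction V arbitrary: P) auto

lemma sdeg_rotations: "(t, U) \<in> set (rotations w) \<Longrightarrow> Suc (sdeg U) = wdeg w"
  by (cases w) (auto dest: sdeg_splits)

lemma wdeg_pair_word [simp]: "wdeg (pair_word s U t V) = sdeg U + sdeg V"
  by (auto simp: pair_word_def)

text \<open>
  In the Wick formula a word is paired with one of the other words. Each pick is a choice of this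
  partner together with the words that remain.
\<close>

fun picks :: "'a list \<Rightarrow> ('a \<times> 'a list) list" where
  "picks [] = []"
| "picks (w # ws) = (w, ws) # map (\<lambda>(v, r). (v, w # r)) (picks ws)"

lemma sum_indicator_pair:
  fixes c :: "nat \<Rightarrow> real"
  assumes "k0 < K" "l0 < K"
  shows "(\<Sum>k<K. c k * (\<Sum>l<K. (if (k, l) = (k0, l0) then 1 else 0) * g k l)) = c k0 * g k0 l0"
proof -
  have "(\<Sum>l<K. (if (k, l) = (k0, l0) then 1 else 0) * g k l) = (if k = k0 then g k0 l0 else 0)" for k
    using assms by (cases "k = k0") (simp_all add: mult_delta_left sum.delta)
  then show ?thesis using assms by (simp add: mult_delta_right sum.delta)
qed

definition oriented :: "bool \<Rightarrow> kernel \<Rightarrow> kernel" where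
  "oriented s A = (if s then A else ktransp A)"


locale matrix_words =
  fixes K :: "nat \<Rightarrow> nat" and B :: "nat \<Rightarrow> nat \<Rightarrow> kernel"
begin

fun atom_val :: "nat \<Rightarrow> atom \<Rightarrow> kernel" where
  "atom_val N (Base m) = B N m"
| "atom_val N (Mul a b) = kmul (K N) (atom_val N a) (atom_val N b)"
| "atom_val N (Transp a) = ktransp (atom_val N a)"

definition xval :: "nat \<Rightarrow> (nat \<times> nat \<Rightarrow> real) \<Rightarrow> bool \<Rightarrow> kernel" where
  "xval N x s = (\<lambda>i j. (if s then x (j, i) else x (i, j)) / sqrt (real N))"

fun seg_val :: "nat \<Rightarrow> (nat \<times> nat \<Rightarrow> real) \<Rightarrow> segment \<Rightarrow> kernel" where
  "seg_val N x (At a) = atom_val N a"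
| "seg_val N x (Nd a s V) = kmul (K N) (atom_val N a) (kmul (K N) (xval N x s) (seg_val N x V))"

fun word_val :: "nat \<Rightarrow> (nat \<times> nat \<Rightarrow> real) \<Rightarrow> cword \<Rightarrow> real" where
  "word_val N x (Closed a) = ktrace (K N) (atom_val N a)"
| "word_val N x (Cyc s V) = ktrace (K N) (kmul (K N) (xval N x s) (seg_val N x V))"

lemma seg_val_link:
  "seg_val N x (link U s V) = kmul (K N) (seg_val N x U) (kmul (K N) (xval N x s) (seg_val N x V))"
  by (induction U s V rule: link.induct) (simp_all add: kmul_assoc)

lemma seg_val_smul: "seg_val N x (smul U V) = kmul (K N) (seg_val N x U) (seg_val N x V)"
  by (induction U V rule: smul.induct) (simp_all add: kmul_assoc)

lemma ktransp_xval: "ktransp (xval N x s) = xval N x (\<not> s)"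
  by (auto simp: ktransp_def xval_def fun_eq_iff)

lemma seg_val_stransp: "seg_val N x (stransp V) = ktransp (seg_val N x V)"
  by (induction V) (simp_all add: seg_val_link ktransp_kmul ktransp_xval kmul_assoc)

text \<open>
  Cyclicity of the trace.
\<close>

lemma word_val_closure_word: "word_val N x (closure_word V) = ktrace (K N) (seg_val N x V)"
  by (cases V) (simp_all add: seg_val_smul kmul_assoc ktrace_kmul_commute[of _ "atom_val _ _"])

text \<open>
  The right-hand side is what Gaussian contraction of two factors \<open>X\<close> in different traces produces,
  since \<open>Tr (X\<^sup>s U)\<close> is the sum of \<open>X a b * oriented s U a b\<close>.
\<close>

lemma word_val_pair_word:
  "word_val N x (pair_word s U t V) =
     (\<Sum>a<K N. \<Sum>b<K N. oriented s (seg_val N x U) a b * oriented t (seg_val N x V) a b)"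
proof -
  let ?U = "seg_val N x U" and ?V = "seg_val N x V"
  have "word_val N x (pair_word s U t V) =
      (\<Sum>i<K N. \<Sum>k<K N. ?U i k * (if s = t then ?V i k else ?V k i))"
    by (simp add: pair_word_def word_val_closure_word seg_val_smul seg_val_stransp ktrace_def kmul_def ktransp_def)
  also have "\<dots> = (\<Sum>a<K N. \<Sum>b<K N. oriented s ?U a b * oriented t ?V a b)"
  proof (cases s)
    case False
    show ?thesis using False
      by (subst sum.swap) (auto simp: oriented_def ktransp_def intro!: sum.cong)
  qed (auto simp: oriented_def ktransp_def intro!: sum.cong)
  finally show ?thesis .
qed

lemma poly_deriv_xval:
  "poly_deriv (a, b) (\<lambda>x. xval N x s k l)
     (\<lambda>x. (if (k, l) = (if s then (b, a) else (a, b)) then 1 else 0) / sqrt (real N))"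
  unfolding xval_def divide_inverse
  by (rule poly_deriv_cong[OF poly_deriv_cmult[OF poly_deriv_coord[of "(a, b)" "if s then (l, k) else (k, l)"],
        of "inverse (sqrt (real N))"]]) auto

text \<open>
  The product rule: differentiating the factor \<open>X\<^sup>t\<close> in \<open>P X\<^sup>t Q\<close> with respect to its \<open>(a, b)\<close> entry
  leaves the product of a column of \<open>P\<close> and a row of \<open>Q\<close>.
\<close>

lemma poly_deriv_seg_val:
  assumes ab: "a < K N" "b < K N"
  shows "poly_deriv (a, b) (\<lambda>x. seg_val N x V i j)
     (\<lambda>x. (\<Sum>(P, t, Q)\<leftarrow>splits V. if t then seg_val N x P i b * seg_val N x Q a j
            else seg_val N x P i a * seg_val N x Q b j) / sqrt (real N))"
proof (induction V arbitrary: i)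
  case (At c)
  show ?case using poly_deriv_const[of "(a, b)" "atom_val N c i j"] by simp
next
  case (Nd c s V)
  let ?f = "\<lambda>i x (P, t, Q). if t then seg_val N x P i b * seg_val N x Q a j
            else seg_val N x P i a * seg_val N x Q b j"
  have IH: "poly_deriv (a, b) (\<lambda>x. seg_val N x V i j) (\<lambda>x. (\<Sum>p\<leftarrow>splits V. ?f i x p) / sqrt (real N))" for i
    by (rule Nd)
  let ?d = "\<lambda>k l. (if (k, l) = (if s then (b, a) else (a, b)) then 1 else 0::real)"
  let ?G = "\<lambda>x. \<Sum>k<K N. atom_val N c i k * (\<Sum>l<K N. ?d k l / sqrt (real N) * seg_val N x V l j +
         xval N x s k l * ((\<Sum>p\<leftarrow>splits V. ?f l x p) / sqrt (real N)))"
  have eq: "(\<lambda>x. seg_val N x (Nd c s V) i j) =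
      (\<lambda>x. \<Sum>k<K N. atom_val N c i k * (\<Sum>l<K N. xval N x s k l * seg_val N x V l j))"
    by (simp add: kmul_def)
  have "poly_deriv (a, b) (\<lambda>x. seg_val N x (Nd c s V) i j)
     ?G"
    unfolding eq
    by (intro poly_deriv_sum poly_deriv_cmult poly_deriv_mult[OF poly_deriv_xval IH])
  moreover have "?G x =
      (\<Sum>p\<leftarrow>splits (Nd c s V). ?f i x p) / sqrt (real N)" for x
  proof -
    have 1: "(\<Sum>k<K N. atom_val N c i k * (\<Sum>l<K N. ?d k l * seg_val N x V l j)) = ?f i x (At c, s, V)"
      using ab sum_indicator_pair[of b "K N" a "atom_val N c i" "\<lambda>k l. seg_val N x V l j"]
        sum_indicator_pair[of a "K N" b "atom_val N c i" "\<lambda>k l. seg_val N x V l j"]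
      by (cases s) simp_all
    have 2: "(\<Sum>k<K N. atom_val N c i k * (\<Sum>l<K N. xval N x s k l * (\<Sum>p\<leftarrow>L. ?f l x p))) =
        (\<Sum>p\<leftarrow>map (\<lambda>(P, t, Q). (Nd c s P, t, Q)) L. ?f i x p)" for L
    proof (induction L)
      case (Cons p L)
      obtain P t Q where p: "p = (P, t, Q)" by (cases p)
      have "(\<Sum>k<K N. atom_val N c i k * (\<Sum>l<K N. xval N x s k l * ?f l x p)) = ?f i x (Nd c s P, t, Q)"
        by (auto simp: p kmul_def sum_distrib_left sum_distrib_right mult_ac)
      then show ?case
        using Cons by (simp add: distrib_left sum.distrib p)
    qed simp
    have "?G x =
      ((\<Sum>k<K N. atom_val N c i k * (\<Sum>l<K N. ?d k l * seg_val N x V l j)) +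
       (\<Sum>k<K N. atom_val N c i k * (\<Sum>l<K N. xval N x s k l * (\<Sum>p\<leftarrow>splits V. ?f l x p)))) / sqrt (real N)"
      by (simp only: times_divide_eq_left times_divide_eq_right add_divide_distrib[symmetric]
           sum_divide_distrib[symmetric] sum.distrib distrib_left)
    also have "\<dots> = (\<Sum>p\<leftarrow>splits (Nd c s V). ?f i x p) / sqrt (real N)"
      unfolding 1 2 by simp
    finally show ?thesis .
  qed
  ultimately show ?case by (rule poly_deriv_cong[OF _ refl])
qed

text \<open>
  The product rule once more. By cyclicity of the trace the differentiated factor can be rotated to
  the front, which leaves an entry of the remaining segment.
\<close>

lemma poly_deriv_word_val:
  assumes ab: "a < K N" "b < K N"
  shows "poly_deriv (a, b) (\<lambda>x. word_val N x w)
     (\<lambda>x. (\<Sum>(s, U)\<leftarrow>rotations w. oriented s (seg_val N x U) a b) / sqrt (real N))"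
proof (cases w)
  case (Closed c)
  then show ?thesis using poly_deriv_const[of "(a, b)" "ktrace (K N) (atom_val N c)"] by simp
next
  case (Cyc s V)
  let ?f = "\<lambda>i j x (P, t, Q). if t then seg_val N x P i b * seg_val N x Q a j
            else seg_val N x P i a * seg_val N x Q b j"
  let ?g = "\<lambda>x (s, U). oriented s (seg_val N x U) a b"
  let ?d = "\<lambda>k l. (if (k, l) = (if s then (b, a) else (a, b)) then 1 else 0::real)"
  let ?G = "\<lambda>x. \<Sum>k<K N. \<Sum>l<K N. ?d k l / sqrt (real N) * seg_val N x V l k +
         xval N x s k l * ((\<Sum>p\<leftarrow>splits V. ?f l k x p) / sqrt (real N))"
  have eq: "(\<lambda>x. word_val N x w) = (\<lambda>x. \<Sum>k<K N. \<Sum>l<K N. xval N x s k l * seg_val N x V l k)"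
    by (simp add: Cyc kmul_def ktrace_def)
  have "poly_deriv (a, b) (\<lambda>x. word_val N x w)
     ?G"
    unfolding eq
    by (intro poly_deriv_sum poly_deriv_mult[OF poly_deriv_xval poly_deriv_seg_val[OF ab]])
  moreover have "?G x =
      (\<Sum>p\<leftarrow>rotations w. ?g x p) / sqrt (real N)" for x
  proof -
    have 1: "(\<Sum>k<K N. \<Sum>l<K N. ?d k l * seg_val N x V l k) = ?g x (s, V)"
      using ab sum_indicator_pair[of b "K N" a "\<lambda>_. 1" "\<lambda>k l. seg_val N x V l k"]
        sum_indicator_pair[of a "K N" b "\<lambda>_. 1" "\<lambda>k l. seg_val N x V l k"]
      by (cases s) (simp_all add: oriented_def ktransp_def)
    have 2: "(\<Sum>k<K N. \<Sum>l<K N. xval N x s k l * (\<Sum>p\<leftarrow>L. ?f l k x p)) =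
        (\<Sum>p\<leftarrow>map (\<lambda>(P, t, Q). (t, link Q s P)) L. ?g x p)" for L
    proof (induction L)
      case (Cons p L)
      obtain P t Q where p: "p = (P, t, Q)" by (cases p)
      have "(\<Sum>k<K N. \<Sum>l<K N. xval N x s k l * ?f l k x p) = ?g x (t, link Q s P)"
        by (auto simp: p oriented_def ktransp_def seg_val_link kmul_def sum_distrib_left sum_distrib_right mult_ac)
      then show ?case
        using Cons by (simp add: distrib_left sum.distrib p)
    qed simp
    have "?G x =
      ((\<Sum>k<K N. \<Sum>l<K N. ?d k l * seg_val N x V l k) +
       (\<Sum>k<K N. \<Sum>l<K N. xval N x s k l * (\<Sum>p\<leftarrow>splits V. ?f l k x p))) / sqrt (real N)"
      by (simp only: times_divide_eq_left times_divide_eq_right add_divide_distrib[symmetric]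
           sum_divide_distrib[symmetric] sum.distrib distrib_left)
    also have "\<dots> = (\<Sum>p\<leftarrow>rotations w. ?g x p) / sqrt (real N)"
      unfolding 1 2 Cyc by simp
    finally show ?thesis .
  qed
  ultimately show ?thesis by (rule poly_deriv_cong[OF _ refl])
qed

lemma poly_fn_xval: "poly_fn (\<lambda>x. xval N x s i j)"
  by (cases s) (auto simp: xval_def divide_inverse intro!: poly_fn_intros)

lemma poly_fn_seg_val: "poly_fn (\<lambda>x. seg_val N x V i j)"
  by (induction V arbitrary: i)
     (auto simp: kmul_def intro!: poly_fn_intros poly_fn_xval)

lemma poly_fn_word_val: "poly_fn (\<lambda>x. word_val N x w)"
  by (cases w) (auto simp: ktrace_def kmul_def
      intro!: poly_fn_intros poly_fn_xval poly_fn_seg_val)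

text \<open>
  The result of contracting the leading \<open>X\<^sup>s\<close> of \<open>Tr (X\<^sup>s P X\<^sup>t Q)\<close> with \<open>X\<^sup>t\<close>: two traces if the
  orientations differ, a single one with reversed \<open>Q\<close> if they agree.
\<close>

definition split_val :: "nat \<Rightarrow> (nat \<times> nat \<Rightarrow> real) \<Rightarrow> bool \<Rightarrow> segment \<times> bool \<times> segment \<Rightarrow> real" where
  "split_val N x s = (\<lambda>(P, t, Q). if s = t then word_val N x (closure_word (smul P (stransp Q)))
      else word_val N x (closure_word P) * word_val N x (closure_word Q))"

text \<open>
  The contribution of one entry \<open>(a, b)\<close> to \<open>split_val\<close>, in the form in which it comes out of the
  product rule.
\<close>

definition split_entry ::
  "nat \<Rightarrow> (nat \<times> nat \<Rightarrow> real) \<Rightarrow> bool \<Rightarrow> nat \<Rightarrow> nat \<Rightarrow> segment \<times> bool \<times> segment \<Rightarrow> real" where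
  "split_entry N x s a b = (\<lambda>(P, t, Q).
     if s then (if t then seg_val N x P a b * seg_val N x Q a b else seg_val N x P a a * seg_val N x Q b b)
     else (if t then seg_val N x P b b * seg_val N x Q a a else seg_val N x P b a * seg_val N x Q b a))"

lemma sum_deriv_oriented:
  "(\<Sum>a<K N. \<Sum>b<K N. \<Sum>p\<leftarrow>L. split_entry N x s a b p) =
     (\<Sum>p\<leftarrow>L. split_val N x s p)"
proof (induction L)
  case (Cons p L)
  obtain P t Q where p: "p = (P, t, Q)" by (cases p)
  have c: "word_val N x (closure_word P) * word_val N x (closure_word Q) =
      (\<Sum>a<K N. \<Sum>b<K N. seg_val N x P a a * seg_val N x Q b b)"
    by (simp add: word_val_closure_word ktrace_def sum_product)
  then have c': "word_val N x (closure_word P) * word_val N x (closure_word Q) =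
      (\<Sum>a<K N. \<Sum>b<K N. seg_val N x P b b * seg_val N x Q a a)"
    by (subst sum.swap)
  have d: "word_val N x (closure_word (smul P (stransp Q))) =
      (\<Sum>a<K N. \<Sum>b<K N. seg_val N x P a b * seg_val N x Q a b)"
    by (simp add: word_val_closure_word seg_val_smul seg_val_stransp ktrace_def kmul_def ktransp_def)
  then have d': "word_val N x (closure_word (smul P (stransp Q))) =
      (\<Sum>a<K N. \<Sum>b<K N. seg_val N x P b a * seg_val N x Q b a)"
    by (subst sum.swap)
  have "(\<Sum>a<K N. \<Sum>b<K N. 
       split_entry N x s a b p) =
     split_val N x s p"
    using c c' d d' by (cases s; cases t) (simp_all add: p split_val_def split_entry_def)
  then show ?case using Cons by (simp add: p sum.distrib)
qed simp

text \<open>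
  Integration by parts in every entry of the leading factor \<open>X\<^sup>s\<close>. The first sum comes from derivatives
  that hit the word itself, the second from derivatives that hit \<open>F\<close>.
\<close>

lemma schwinger_dyson:
  assumes dF: "\<And>a b. a < K N \<Longrightarrow> b < K N \<Longrightarrow> poly_deriv (a, b) F (dF a b)"
  shows "(\<E> x. word_val N x (Cyc s V) * F x) =
     (\<E> x. (\<Sum>p\<leftarrow>splits V. split_val N x s p) / real N * F x +
          (\<Sum>a<K N. \<Sum>b<K N. oriented s (seg_val N x V) a b * dF a b x) / sqrt (real N))"
proof -
  let ?o = "\<lambda>a b x. oriented s (seg_val N x V) a b"
  define DO where "DO a b x = (\<Sum>p\<leftarrow>splits V. split_entry N x s a b p)
         / sqrt (real N)" for a b x
  let ?A = "\<lambda>x. (\<Sum>a<K N. \<Sum>b<K N. DO a b x * F x + ?o a b x * dF a b x) / sqrt (real N)"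
  let ?R = "\<lambda>x. (\<Sum>p\<leftarrow>splits V. split_val N x s p) / real N * F x +
          (\<Sum>a<K N. \<Sum>b<K N. ?o a b x * dF a b x) / sqrt (real N)"
  have pd: "poly_deriv (a, b) (\<lambda>x. ?o a b x * F x) (\<lambda>x. DO a b x * F x + ?o a b x * dF a b x)"
    if "a < K N" "b < K N" for a b
  proof (rule poly_deriv_mult[OF _ dF[OF that]])
    show "poly_deriv (a, b) (?o a b) (DO a b)"
    proof (cases s)
      case True
      then show ?thesis
        using poly_deriv_seg_val[OF that, of V a b] unfolding DO_def oriented_def split_entry_def by simp
    next
      case False
      then show ?thesis
        using poly_deriv_seg_val[OF that, of V b a] unfolding DO_def oriented_def ktransp_def split_entry_def by simp
    qed
  qed
  have ix: "integrable gauss_array (\<lambda>x. x (a, b) * (?o a b x * F x))" if "a < K N" "b < K N" for a b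
    using poly_deriv_integrable(1)[OF poly_deriv_mult[OF poly_deriv_coord pd[OF that]]] .
  note id = poly_deriv_integrable(2)[OF pd]
  have "word_val N x (Cyc s V) * F x =
      (\<Sum>a<K N. \<Sum>b<K N. x (a, b) * (?o a b x * F x)) / sqrt (real N)" for x
  proof -
    have "word_val N x (Cyc s V) = (\<Sum>a<K N. \<Sum>b<K N. x (a, b) * ?o a b x) / sqrt (real N)"
    proof (cases s)
      case True
      then show ?thesis
        by (simp add: ktrace_def kmul_def xval_def oriented_def sum_divide_distrib) (rule sum.swap)
    next
      case False
      then show ?thesis
        by (simp add: ktrace_def kmul_def xval_def oriented_def ktransp_def sum_divide_distrib)
    qed
    then show ?thesis by (simp add: sum_distrib_right mult.assoc)
  qed
  then have "(\<E> x. word_val N x (Cyc s V) * F x) =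
      (\<E> x. (\<Sum>a<K N. \<Sum>b<K N. x (a, b) * (?o a b x * F x))) / sqrt (real N)"
    by simp
  also have "(\<E> x. (\<Sum>a<K N. \<Sum>b<K N. x (a, b) * (?o a b x * F x))) =
      (\<Sum>a<K N. \<Sum>b<K N. \<E> x. x (a, b) * (?o a b x * F x))"
    using ix by (subst Bochner_Integration.integral_sum) (auto intro!: Bochner_Integration.integrable_sum sum.cong Bochner_Integration.integral_sum)
  also have "\<dots> = (\<Sum>a<K N. \<Sum>b<K N. \<E> x. DO a b x * F x + ?o a b x * dF a b x)"
    by (intro sum.cong refl poly_integration_by_parts pd) auto
  also have "\<dots> = (\<E> x. (\<Sum>a<K N. \<Sum>b<K N. DO a b x * F x + ?o a b x * dF a b x))"
    using id by (subst Bochner_Integration.integral_sum) (auto intro!: Bochner_Integration.integrable_sum sum.cong Bochner_Integration.integral_sum[symmetric])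
  also have "\<dots> / sqrt (real N) = (\<E> x. ?A x)"
    by simp
  also have "?A = ?R"
  proof
    fix x
    have "(\<Sum>a<K N. \<Sum>b<K N. DO a b x) = (\<Sum>p\<leftarrow>splits V. split_val N x s p) / sqrt (real N)"
      unfolding DO_def sum_divide_distrib[symmetric] sum_deriv_oriented by simp
    then have "(\<Sum>a<K N. \<Sum>b<K N. DO a b x) / sqrt (real N) = (\<Sum>p\<leftarrow>splits V. split_val N x s p) / real N"
      by simp
    moreover have "?A x =
       (\<Sum>a<K N. \<Sum>b<K N. DO a b x) / sqrt (real N) * F x + (\<Sum>a<K N. \<Sum>b<K N. ?o a b x * dF a b x) / sqrt (real N)"
      by (simp add: sum.distrib add_divide_distrib sum_distrib_right)
    ultimately show "?A x =
       ?R x" by simp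
  qed
  finally show ?thesis .
qed

end

section \<open>The recursion for centred moments\<close>

lemma sum_list_divide:
  fixes f :: "'a \<Rightarrow> real"
  shows "(\<Sum>i\<leftarrow>xs. f i) / c = (\<Sum>i\<leftarrow>xs. f i / c)"
  by (induction xs) (simp_all add: add_divide_distrib)

lemma sum_list_swap:
  fixes g :: "'a \<Rightarrow> 'b \<Rightarrow> real"
  shows "(\<Sum>i\<leftarrow>xs. \<Sum>j\<leftarrow>ys. g i j) = (\<Sum>j\<leftarrow>ys. \<Sum>i\<leftarrow>xs. g i j)"
  by (induction xs) (simp_all add: sum_list_addf)

lemma sum_list_map_cong: "(\<And>i. i \<in> set xs \<Longrightarrow> f i = g i) \<Longrightarrow> (\<Sum>i\<leftarrow>xs. f i) = (\<Sum>i\<leftarrow>xs. g i)"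
  by (metis map_cong)

lemma tendsto_sum_list:
  fixes f :: "'a \<Rightarrow> 'b \<Rightarrow> real"
  assumes "\<And>i. i \<in> set xs \<Longrightarrow> ((f i) \<longlongrightarrow> l i) F"
  shows "((\<lambda>N. \<Sum>i\<leftarrow>xs. f i N) \<longlongrightarrow> (\<Sum>i\<leftarrow>xs. l i)) F"
  using assms by (induction xs) (auto intro: tendsto_add)

lemma picks_sum: "(v, r) \<in> set (picks ws) \<Longrightarrow> f v + sum_list (map f r) = (sum_list (map f ws) :: nat)"
  by (induction ws arbitrary: r) auto

lemma sum_list_picks_map:
  fixes g :: "'a \<Rightarrow> 'a list \<Rightarrow> real"
  shows "(\<Sum>(v, r)\<leftarrow>picks (w # ws). g v r) = g w ws + (\<Sum>(v, r)\<leftarrow>picks ws. g v (w # r))"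
  by (simp add: o_def split_def)

context matrix_words
begin

text \<open>
  The trace in \<open>centred\<close> is not normalised, so that its moments have finite limits; the expectation
  in \<open>mean\<close> is normalised by \<open>N\<close>.
\<close>

definition centred :: "nat \<Rightarrow> cword \<Rightarrow> (nat \<times> nat \<Rightarrow> real) \<Rightarrow> real" where
  "centred N w x = word_val N x w - (\<E> y. word_val N y w)"

definition mean :: "nat \<Rightarrow> cword \<Rightarrow> real" where
  "mean N w = (\<E> y. word_val N y w) / real N"

definition cprod :: "nat \<Rightarrow> cword list \<Rightarrow> (nat \<times> nat \<Rightarrow> real) \<Rightarrow> real" where
  "cprod N ws x = (\<Prod>w\<leftarrow>ws. centred N w x)"

definition cmom :: "nat \<Rightarrow> cword list \<Rightarrow> real" where
  "cmom N ws = (\<E> x. cprod N ws x)"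

lemma cprod_simps [simp]:
  "cprod N [] x = 1" "cprod N (w # ws) x = centred N w x * cprod N ws x"
  by (simp_all add: cprod_def)

lemma poly_fn_centred: "poly_fn (centred N w)"
  unfolding centred_def[abs_def] by (intro poly_fn_intros poly_fn_word_val)

lemma poly_fn_cprod: "poly_fn (cprod N ws)"
  unfolding cprod_def[abs_def] by (intro poly_fn_intros poly_fn_centred)

lemma cmom_Nil: "cmom N [] = 1"
  by (simp add: cmom_def gauss.prob_space)

lemma cmom_Closed: "cmom N (Closed a # ws) = 0"
  by (simp add: cmom_def centred_def gauss.prob_space)

lemma cmom_single: "cmom N [w] = 0"
  by (simp add: cmom_def centred_def gauss.prob_space poly_fn_integrable[OF poly_fn_word_val])

lemma expectation_mult_cprod:
  assumes "N > 0"
  shows "(\<E> x. word_val N x u * cprod N ws x) =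
    cmom N (u # ws) + real N * mean N u * cmom N ws"
proof -
  have "word_val N x u * cprod N ws x =
      cprod N (u # ws) x + real N * mean N u * cprod N ws x" for x
    using assms by (simp add: centred_def mean_def algebra_simps)
  then show ?thesis
    by (simp only: cmom_def) (subst Bochner_Integration.integral_add;
      simp add: poly_fn_integrable poly_fn_cprod poly_fn_mult poly_fn_centred)
qed

lemma poly_deriv_cprod:
  assumes ab: "a < K N" "b < K N"
  shows "poly_deriv (a, b) (cprod N ws)
     (\<lambda>x. (\<Sum>(v, r)\<leftarrow>picks ws. (\<Sum>(t, U)\<leftarrow>rotations v. oriented t (seg_val N x U) a b) * cprod N r x)
        / sqrt (real N))"
proof (induction ws)
  case Nil
  then show ?case using poly_deriv_const[of "(a, b)" 1] by (simp add: cprod_def)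
next
  case (Cons w ws)
  have "poly_deriv (a, b) (centred N w)
      (\<lambda>x. (\<Sum>(t, U)\<leftarrow>rotations w. oriented t (seg_val N x U) a b) / sqrt (real N))"
    using poly_deriv_add[OF poly_deriv_word_val[OF ab, of w]
        poly_deriv_const[of "(a, b)" "- (\<E> y. word_val N y w)"]]
    by (simp add: centred_def[abs_def])
  from poly_deriv_mult[OF this Cons] show ?case
  proof (rule poly_deriv_cong)
    fix x
    let ?d = "\<lambda>v. (\<Sum>(t, U)\<leftarrow>rotations v. oriented t (seg_val N x U) a b)"
    have "(\<Sum>(v, r)\<leftarrow>L. ?d v * cprod N (w # r) x) =
        centred N w x * (\<Sum>(v, r)\<leftarrow>L. ?d v * cprod N r x)" for L
      by (induction L) (auto simp: algebra_simps)
    then show "?d w / sqrt (real N) * cprod N ws x +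
        centred N w x * ((\<Sum>(v, r)\<leftarrow>picks ws. ?d v * cprod N r x) / sqrt (real N)) =
        (\<Sum>(v, r)\<leftarrow>picks (w # ws). ?d v * cprod N r x) / sqrt (real N)"
      unfolding sum_list_picks_map by (simp add: add_divide_distrib)
  qed simp
qed

lemma poly_fn_split_val: "poly_fn (\<lambda>x. split_val N x s p)"
proof -
  obtain P t Q where p: "p = (P, t, Q)" by (cases p)
  show ?thesis
    by (cases "s = t") (simp_all add: p split_val_def poly_fn_word_val poly_fn_mult)
qed

text \<open>
  The derivative of a product of centred traces hits one of them, \<open>v\<close>, and summation over the entries
  merges it with the leading word.
\<close>

lemma schwinger_dyson_centred:
  "(\<E> x. word_val N x (Cyc s V) * cprod N ws x) =
     (\<Sum>p\<leftarrow>splits V. (\<E> x. split_val N x s p * cprod N ws x)) / real N +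
     (\<Sum>(v, r)\<leftarrow>picks ws. \<Sum>(t, U)\<leftarrow>rotations v.
        (\<E> x. word_val N x (pair_word s V t U) * cprod N r x)) / real N"
  (is "_ = ?rhs")
proof -
  let ?o = "\<lambda>a b x. oriented s (seg_val N x V) a b"
  let ?d = "\<lambda>v a b x. (\<Sum>(t, U)\<leftarrow>rotations v. oriented t (seg_val N x U) a b)"
  let ?dF = "\<lambda>a b x. (\<Sum>(v, r)\<leftarrow>picks ws. ?d v a b x * cprod N r x) / sqrt (real N)"
  have A: "(\<Sum>a<K N. \<Sum>b<K N. ?o a b x * (\<Sum>(t, U)\<leftarrow>R. oriented t (seg_val N x U) a b)) =
      (\<Sum>(t, U)\<leftarrow>R. word_val N x (pair_word s V t U))" for R x
    by (induction R) (auto simp: word_val_pair_word distrib_left sum.distrib)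
  have B: "(\<Sum>a<K N. \<Sum>b<K N. ?o a b x * (\<Sum>(v, r)\<leftarrow>L. ?d v a b x * cprod N r x)) =
      (\<Sum>(v, r)\<leftarrow>L. (\<Sum>(t, U)\<leftarrow>rotations v. word_val N x (pair_word s V t U)) * cprod N r x)" for L x
    by (induction L)
       (auto simp: A[symmetric] distrib_left sum.distrib sum_distrib_right mult.assoc)
  have C: "(\<Sum>a<K N. \<Sum>b<K N. ?o a b x * ?dF a b x) / sqrt (real N) =
      (\<Sum>(v, r)\<leftarrow>picks ws. \<Sum>(t, U)\<leftarrow>rotations v. word_val N x (pair_word s V t U) * cprod N r x) / real N" for x
  proof -
    have "(\<Sum>a<K N. \<Sum>b<K N. ?o a b x * ?dF a b x) / sqrt (real N) =
       (\<Sum>a<K N. \<Sum>b<K N. ?o a b x * (\<Sum>(v, r)\<leftarrow>picks ws. ?d v a b x * cprod N r x)) / real N"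
      by (simp only: times_divide_eq_right sum_divide_distrib[symmetric] divide_divide_eq_left) simp
    then show ?thesis unfolding B by (simp add: split_def sum_list_mult_const[symmetric])
  qed
  have SD: "(\<E> x. word_val N x (Cyc s V) * cprod N ws x) =
      (\<E> x. (\<Sum>p\<leftarrow>splits V. split_val N x s p) / real N * cprod N ws x +
          (\<Sum>a<K N. \<Sum>b<K N. ?o a b x * ?dF a b x) / sqrt (real N))"
    by (rule schwinger_dyson) (rule poly_deriv_cprod)
  have I: "integrable gauss_array (\<lambda>x. word_val N x u * cprod N r x)" for u r
    by (intro poly_fn_integrable poly_fn_mult poly_fn_word_val poly_fn_cprod)
  have J: "integrable gauss_array (\<lambda>x. split_val N x s p * cprod N r x)" for p r
    by (intro poly_fn_integrable poly_fn_mult poly_fn_split_val poly_fn_cprod)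
  have "(\<E> x. word_val N x (Cyc s V) * cprod N ws x) =
     (\<E> x. (\<Sum>p\<leftarrow>splits V. split_val N x s p * cprod N ws x) / real N +
       (\<Sum>(v, r)\<leftarrow>picks ws. \<Sum>(t, U)\<leftarrow>rotations v. word_val N x (pair_word s V t U) * cprod N r x) / real N)"
    unfolding SD C
    by (simp add: sum_list_mult_const[symmetric] sum_list_divide)
  also have "\<dots> = ?rhs"
    using I J
    by (subst Bochner_Integration.integral_add)
       (auto simp: integral_sum_list split_def integrable_sum_list simp del: word_val.simps
         intro!: integrable_sum_list Bochner_Integration.integrable_divide)
  finally show ?thesis .
qed

text \<open>
  Contributions to the recursion for \<open>cmom N (Cyc s V # ws)\<close>. A split into words \<open>p\<close> and \<open>q\<close> is expanded
  by writing both traces as sums of their means and centred parts; the product of the two means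
  cancels when \<open>Cyc s V\<close> is centred.
\<close>

definition split_mom :: "nat \<Rightarrow> bool \<Rightarrow> cword list \<Rightarrow> segment \<times> bool \<times> segment \<Rightarrow> real" where
  "split_mom N s ws = (\<lambda>(P, t, Q).
     let p = closure_word P; q = closure_word Q; u = closure_word (smul P (stransp Q)) in
     if s = t then cmom N (u # ws) / N
     else (cmom N (p # q # ws) - cmom N [p, q] * cmom N ws) / N
          + mean N q * cmom N (p # ws) + mean N p * cmom N (q # ws))"

definition split_mean :: "nat \<Rightarrow> bool \<Rightarrow> segment \<times> bool \<times> segment \<Rightarrow> real" where
  "split_mean N s = (\<lambda>(P, t, Q).
     let p = closure_word P; q = closure_word Q; u = closure_word (smul P (stransp Q)) in
     if s = t then mean N u / N else cmom N [p, q] / N / N + mean N p * mean N q)"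

definition merge_mom :: "nat \<Rightarrow> bool \<Rightarrow> segment \<Rightarrow> cword list \<Rightarrow> bool \<times> segment \<Rightarrow> real" where
  "merge_mom N s V r = (\<lambda>(t, U). cmom N (pair_word s V t U # r) / N + mean N (pair_word s V t U) * cmom N r)"

abbreviation merges :: "nat \<Rightarrow> bool \<Rightarrow> segment \<Rightarrow> cword \<times> cword list \<Rightarrow> real" where
  "merges N s V \<equiv> (\<lambda>(v, r). \<Sum>k\<leftarrow>rotations v. merge_mom N s V r k)"

lemma expectation_split_val:
  assumes N: "N > 0"
  shows "(\<E> x. split_val N x s p * cprod N ws x) / N =
     split_mom N s ws p + N * split_mean N s p * cmom N ws"
proof -
  obtain P t Q where p: "p = (P, t, Q)" by (cases p)
  let ?p = "closure_word P" and ?q = "closure_word Q"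
  show ?thesis
  proof (cases "s = t")
    case True
    then show ?thesis
      using N by (simp add: p split_val_def split_mom_def split_mean_def Let_def
          expectation_mult_cprod add_divide_distrib)
  next
    case False
    let ?n = "real N"
    have eq: "word_val N x ?p * word_val N x ?q * cprod N ws x =
       cprod N (?p # ?q # ws) x + ?n * mean N ?q * cprod N (?p # ws) x +
       ?n * mean N ?p * cprod N (?q # ws) x + ?n * mean N ?p * (?n * mean N ?q) * cprod N ws x" for x
      using N by (simp add: centred_def mean_def algebra_simps)
    have I: "integrable gauss_array (cprod N w)" for w
      by (rule poly_fn_integrable[OF poly_fn_cprod])
    have "(\<E> x. word_val N x ?p * word_val N x ?q * cprod N ws x) =
      cmom N (?p # ?q # ws) + ?n * mean N ?q * cmom N (?p # ws) + ?n * mean N ?p * cmom N (?q # ws) +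
      ?n * mean N ?p * (?n * mean N ?q) * cmom N ws"
      unfolding eq cmom_def
      using I by (simp only: Bochner_Integration.integral_add Bochner_Integration.integrable_add
          integrable_mult_right integral_mult_right_zero)
    then show ?thesis
      using N False by (simp add: p split_val_def split_mom_def split_mean_def Let_def field_simps)
  qed
qed

lemma mean_recursion:
  assumes N: "N > 0"
  shows "mean N (Cyc s V) = (\<Sum>p\<leftarrow>splits V. split_mean N s p)"
proof -
  have "split_mom N s [] p = 0" for p
    by (auto simp: split_mom_def Let_def cmom_Nil cmom_single split: prod.split)
  then have "(\<E> x. word_val N x (Cyc s V) * cprod N [] x) =
      (\<Sum>p\<leftarrow>splits V. real N * split_mean N s p)"
    unfolding schwinger_dyson_centred
    using expectation_split_val[OF N, of s _ "[]"] by (simp add: sum_list_divide cmom_Nil)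
  then show ?thesis using N by (simp add: mean_def sum_list_divide)
qed

text \<open>
  Centring the leading word amounts to subtracting its mean, expanded by \<open>mean_recursion\<close>, times the
  remaining moment; this cancels the largest part of every splitting term.
\<close>

lemma cmom_recursion:
  assumes N: "N > 0"
  shows "cmom N (Cyc s V # ws) = (\<Sum>p\<leftarrow>splits V. split_mom N s ws p) +
     (\<Sum>(v, r)\<leftarrow>picks ws. \<Sum>k\<leftarrow>rotations v. merge_mom N s V r k)"
proof -
  have M: "(\<E> x. word_val N x (pair_word s V t U) * cprod N r x) / N =
      merge_mom N s V r (t, U)" for t U r
    unfolding expectation_mult_cprod[OF N] using N by (simp add: merge_mom_def add_divide_distrib)
  have "cmom N (Cyc s V # ws) + real N * mean N (Cyc s V) * cmom N ws =
     (\<Sum>p\<leftarrow>splits V. split_mom N s ws p + N * split_mean N s p * cmom N ws) +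
     (\<Sum>(v, r)\<leftarrow>picks ws. \<Sum>k\<leftarrow>rotations v. merge_mom N s V r k)"
    unfolding expectation_mult_cprod[OF N, symmetric] schwinger_dyson_centred
    by (simp add: sum_list_divide split_def expectation_split_val[OF N] M del: word_val.simps)
  moreover have "real N * mean N (Cyc s V) * cmom N ws = (\<Sum>p\<leftarrow>splits V. N * split_mean N s p * cmom N ws)"
    unfolding mean_recursion[OF N] by (simp add: sum_list_mult_const sum_list_const_mult)
  ultimately show ?thesis by (simp add: sum_list_addf)
qed

end

section \<open>Limits of the moments and the Wick formula\<close>

lemma tendsto_over_N:
  fixes f :: "nat \<Rightarrow> real"
  assumes "f \<longlonglongrightarrow> l"
  shows "(\<lambda>N. f N / real N) \<longlonglongrightarrow> 0"
  using tendsto_mult[OF assms lim_inverse_n] by (simp add: divide_inverse)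

lemma convergent_over_N:
  fixes f :: "nat \<Rightarrow> real"
  shows "convergent f \<Longrightarrow> convergent (\<lambda>N. f N / real N)"
  using tendsto_over_N unfolding convergent_def by blast

lemma convergent_sum_list:
  fixes f :: "nat \<Rightarrow> 'a \<Rightarrow> real"
  assumes "\<And>i. i \<in> set xs \<Longrightarrow> convergent (\<lambda>N. f N i)"
  shows "convergent (\<lambda>N. \<Sum>i\<leftarrow>xs. f N i)"
  using assms by (induction xs) (auto intro: convergent_const convergent_add)

lemma convergent_eventually:
  fixes f :: "nat \<Rightarrow> real"
  shows "convergent f \<Longrightarrow> \<forall>\<^sub>F N in sequentially. f N = g N \<Longrightarrow> convergent g"
  unfolding convergent_def by (blast intro: Lim_transform_eventually)

locale matrix_model = matrix_words +
  assumes atom_trace_convergent: "\<And>a. convergent (\<lambda>N. ktrace (K N) (atom_val N a) / real N)"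
begin

definition lmean :: "cword \<Rightarrow> real" where "lmean w = lim (\<lambda>N. mean N w)"
definition lcmom :: "cword list \<Rightarrow> real" where "lcmom ws = lim (\<lambda>N. cmom N ws)"

definition lsplit_mom :: "bool \<Rightarrow> cword list \<Rightarrow> segment \<times> bool \<times> segment \<Rightarrow> real" where
  "lsplit_mom s ws = (\<lambda>(P, t, Q).
     let p = closure_word P; q = closure_word Q in
     if s = t then 0 else lmean q * lcmom (p # ws) + lmean p * lcmom (q # ws))"

lemma mean_Closed: "mean N (Closed a) = ktrace (K N) (atom_val N a) / real N"
  by (simp add: mean_def gauss.prob_space)

text \<open>
  Simultaneous induction on the total number \<open>n\<close> of factors \<open>X\<close>. Every word and every list of words on
  the right-hand sides of the two recursions contains fewer of them, and their moments are combined
  by sums, products and division by \<open>N\<close>.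
\<close>

lemma convergent_moments:
  "(wdeg w = n \<longrightarrow> convergent (\<lambda>N. mean N w)) \<and>
   (sum_list (map wdeg ws) = n \<longrightarrow> convergent (\<lambda>N. cmom N ws))"
proof (induction n arbitrary: w ws rule: less_induct)
  case (less n)
  have m: "convergent (\<lambda>N. mean N w)" if "wdeg w < n" for w
    using less[OF that] by simp
  have c: "convergent (\<lambda>N. cmom N ws)" if "sum_list (map wdeg ws) < n" for ws
    using less[OF that] by simp
  note conv = convergent_add convergent_diff convergent_mult convergent_over_N m c
  have "convergent (\<lambda>N. mean N w)" if w: "wdeg w = n"
  proof (cases w)
    case (Closed a)
    then show ?thesis using atom_trace_convergent[of a] by (simp add: mean_Closed)
  next
    case (Cyc s V)
    have "convergent (\<lambda>N. split_mean N s p)" if "p \<in> set (splits V)" for p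
    proof -
      obtain P t Q where p: "p = (P, t, Q)" by (cases p)
      have "Suc (sdeg P + sdeg Q) = sdeg V" using sdeg_splits that unfolding p by blast
      then show ?thesis
        using w Cyc unfolding split_mean_def p prod.case Let_def by (cases "s = t") (auto intro!: conv simp del: divide_divide_eq_left)
    qed
    then have "convergent (\<lambda>N. \<Sum>p\<leftarrow>splits V. split_mean N s p)" by (rule convergent_sum_list)
    moreover have "\<forall>\<^sub>F N in sequentially. (\<Sum>p\<leftarrow>splits V. split_mean N s p) = mean N w"
      using eventually_gt_at_top[of 0] by eventually_elim (simp add: Cyc mean_recursion)
    ultimately show ?thesis by (rule convergent_eventually)
  qed
  moreover have "convergent (\<lambda>N. cmom N ws)" if ws: "sum_list (map wdeg ws) = n"
  proof (cases ws)
    case Nil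
    then show ?thesis by (simp add: cmom_Nil convergent_const)
  next
    case Cons1: (Cons w ws')
    show ?thesis
    proof (cases w)
      case (Closed a)
      then show ?thesis by (simp add: Cons1 cmom_Closed convergent_const)
    next
      case (Cyc s V)
      have deg: "Suc (sdeg V) + sum_list (map wdeg ws') = n" using ws Cons1 Cyc by simp
      have 1: "convergent (\<lambda>N. split_mom N s ws' p)" if "p \<in> set (splits V)" for p
      proof -
        obtain P t Q where p: "p = (P, t, Q)" by (cases p)
        have "Suc (sdeg P + sdeg Q) = sdeg V" using sdeg_splits that unfolding p by blast
        then show ?thesis
          using deg unfolding split_mom_def p prod.case Let_def by (cases "s = t") (auto intro!: conv)
      qed
      have 2: "convergent (\<lambda>N. merges N s V vr)"
        if "vr \<in> set (picks ws')" for vr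
      proof -
        obtain v r where vr: "vr = (v, r)" by (cases vr)
        have d: "wdeg v + sum_list (map wdeg r) = sum_list (map wdeg ws')"
          by (rule picks_sum[OF that[unfolded vr]])
        have "convergent (\<lambda>N. merge_mom N s V r k)" if "k \<in> set (rotations v)" for k
        proof -
          obtain t U where k: "k = (t, U)" by (cases k)
          have "Suc (sdeg U) = wdeg v" using sdeg_rotations that unfolding k by blast
          then show ?thesis using d deg unfolding merge_mom_def k prod.case by (auto intro!: conv)
        qed
        then show ?thesis unfolding vr prod.case by (rule convergent_sum_list)
      qed
      have "convergent (\<lambda>N. (\<Sum>p\<leftarrow>splits V. split_mom N s ws' p) +
         (\<Sum>vr\<leftarrow>picks ws'. merges N s V vr))"
        by (intro convergent_add convergent_sum_list 1 2)
      moreover have "\<forall>\<^sub>F N in sequentially. (\<Sum>p\<leftarrow>splits V. split_mom N s ws' p) +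
         (\<Sum>vr\<leftarrow>picks ws'. merges N s V vr) = cmom N ws"
        using eventually_gt_at_top[of 0] by eventually_elim (simp add: Cons1 Cyc cmom_recursion)
      ultimately show ?thesis by (rule convergent_eventually)
    qed
  qed
  ultimately show ?case by blast
qed

lemma tendsto_mean: "(\<lambda>N. mean N w) \<longlonglongrightarrow> lmean w"
  using convergent_moments[of w "wdeg w" "[]"] unfolding lmean_def by (simp add: convergent_LIMSEQ_iff)

lemma tendsto_cmom: "(\<lambda>N. cmom N ws) \<longlonglongrightarrow> lcmom ws"
  using convergent_moments[of _ "sum_list (map wdeg ws)" ws] unfolding lcmom_def
  by (simp add: convergent_LIMSEQ_iff)

lemma lcmom_Nil: "lcmom [] = 1"
  using tendsto_cmom[of "[]"] by (simp add: cmom_Nil LIMSEQ_const_iff)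

lemma lcmom_single: "lcmom [w] = 0"
  using tendsto_cmom[of "[w]"] by (simp add: cmom_single LIMSEQ_const_iff)

lemma lcmom_Closed: "lcmom (Closed a # ws) = 0"
  using tendsto_cmom[of "Closed a # ws"] by (simp add: cmom_Closed LIMSEQ_const_iff)

text \<open>
  The limit of \<open>cmom_recursion\<close>, in which all terms with a factor \<open>1 / N\<close> have disappeared.
\<close>

lemma lcmom_recursion:
  "lcmom (Cyc s V # ws) = (\<Sum>p\<leftarrow>splits V. lsplit_mom s ws p) +
     (\<Sum>(v, r)\<leftarrow>picks ws. (\<Sum>(t, U)\<leftarrow>rotations v. lmean (pair_word s V t U)) * lcmom r)"
  (is "_ = ?L")
proof (rule LIMSEQ_unique[OF tendsto_cmom])
  have 1: "(\<lambda>N. split_mom N s ws p) \<longlonglongrightarrow> lsplit_mom s ws p" for p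
  proof -
    obtain P t Q where p: "p = (P, t, Q)" by (cases p)
    let ?p = "closure_word P" and ?q = "closure_word Q" and ?u = "closure_word (smul P (stransp Q))"
    have 1: "(\<lambda>N. cmom N (?u # ws) / real N) \<longlonglongrightarrow> 0"
      by (rule tendsto_over_N[OF tendsto_cmom])
    have 2: "(\<lambda>N. (cmom N (?p # ?q # ws) - cmom N [?p, ?q] * cmom N ws) / real N
        + mean N ?q * cmom N (?p # ws) + mean N ?p * cmom N (?q # ws)) \<longlonglongrightarrow>
        0 + lmean ?q * lcmom (?p # ws) + lmean ?p * lcmom (?q # ws)"
      by (intro tendsto_add tendsto_mult tendsto_mean tendsto_cmom
           tendsto_over_N[OF tendsto_diff[OF tendsto_cmom tendsto_mult[OF tendsto_cmom tendsto_cmom]]])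
    show ?thesis unfolding split_mom_def lsplit_mom_def p using 1 2 by (cases "s = t") (auto simp: Let_def)
  qed
  have 2: "(\<lambda>N. merge_mom N s V r k) \<longlonglongrightarrow> (case k of (t, U) \<Rightarrow> lmean (pair_word s V t U) * lcmom r)" for r k
  proof -
    obtain t U where k: "k = (t, U)" by (cases k)
    have "(\<lambda>N. merge_mom N s V r (t, U)) \<longlonglongrightarrow> 0 + lmean (pair_word s V t U) * lcmom r"
      unfolding merge_mom_def prod.case
      by (intro tendsto_add tendsto_mult tendsto_mean tendsto_cmom tendsto_over_N[OF tendsto_cmom])
    then show ?thesis by (simp add: k)
  qed
  have 3: "(\<lambda>N. merges N s V vr) \<longlonglongrightarrow>
     (case vr of (v, r) \<Rightarrow> (\<Sum>(t, U)\<leftarrow>rotations v. lmean (pair_word s V t U)) * lcmom r)" for vr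
    using tendsto_sum_list[OF 2[of "snd vr"], where xs = "rotations (fst vr)"]
    by (simp add: split_def sum_list_mult_const)
  have "(\<lambda>N. (\<Sum>p\<leftarrow>splits V. split_mom N s ws p) +
     (\<Sum>vr\<leftarrow>picks ws. merges N s V vr)) \<longlonglongrightarrow>
     ?L"
    by (intro tendsto_add tendsto_sum_list 1 3)
  moreover have "\<forall>\<^sub>F N in sequentially. (\<Sum>p\<leftarrow>splits V. split_mom N s ws p) +
     (\<Sum>vr\<leftarrow>picks ws. merges N s V vr) = cmom N (Cyc s V # ws)"
    using eventually_gt_at_top[of 0] by eventually_elim (simp add: cmom_recursion)
  ultimately show "(\<lambda>N. cmom N (Cyc s V # ws)) \<longlonglongrightarrow> ?L"
    by (rule Lim_transform_eventually)
qed

text \<open>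
  Induction on the length of the first word. Splitting replaces it by shorter words, to which the
  induction hypothesis applies; collecting the terms in which it is paired with \<open>v\<close> gives the
  recursion for \<open>lcmom [w, v]\<close>, times the limiting moment of the remaining words.
\<close>

lemma wick_lcmom: "lcmom (w # ws) = (\<Sum>(v, r)\<leftarrow>picks ws. lcmom [w, v] * lcmom r)"
proof (induction "wdeg w" arbitrary: w rule: less_induct)
  case less
  show ?case
  proof (cases w)
    case (Closed a)
    then show ?thesis by (simp add: lcmom_Closed split_def)
  next
    case (Cyc s V)
    let ?R = "\<lambda>v. (\<Sum>(t, U)\<leftarrow>rotations v. lmean (pair_word s V t U))"
    have two: "lcmom [w, v] = (\<Sum>p\<leftarrow>splits V. lsplit_mom s [v] p) + ?R v" for v
      unfolding Cyc lcmom_recursion by (simp add: lcmom_Nil)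
    have split: "lsplit_mom s ws p = (\<Sum>(v, r)\<leftarrow>picks ws. lsplit_mom s [v] p * lcmom r)"
      if "p \<in> set (splits V)" for p
    proof -
      obtain P t Q where p: "p = (P, t, Q)" by (cases p)
      have d: "Suc (sdeg P + sdeg Q) = sdeg V" using sdeg_splits that unfolding p by blast
      let ?p = "closure_word P" and ?q = "closure_word Q"
      have "lcmom (?p # ws) = (\<Sum>(v, r)\<leftarrow>picks ws. lcmom [?p, v] * lcmom r)"
        "lcmom (?q # ws) = (\<Sum>(v, r)\<leftarrow>picks ws. lcmom [?q, v] * lcmom r)"
        by (rule less; use d Cyc in simp)+
      then show ?thesis
        by (simp add: p lsplit_mom_def Let_def split_def sum_list_const_mult[symmetric]
            sum_list_addf[symmetric] algebra_simps)
    qed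
    have "lcmom (w # ws) = (\<Sum>p\<leftarrow>splits V. \<Sum>(v, r)\<leftarrow>picks ws. lsplit_mom s [v] p * lcmom r) +
       (\<Sum>(v, r)\<leftarrow>picks ws. ?R v * lcmom r)"
      unfolding Cyc lcmom_recursion using split by (simp cong: map_cong)
    also have "\<dots> = (\<Sum>(v, r)\<leftarrow>picks ws. ((\<Sum>p\<leftarrow>splits V. lsplit_mom s [v] p) + ?R v) * lcmom r)"
      unfolding split_def sum_list_swap[of _ "picks ws"]
      by (simp add: distrib_right sum_list_addf sum_list_mult_const)
    finally show ?thesis unfolding two .
  qed
qed

definition lin_comb :: "(real \<times> cword) list \<Rightarrow> nat \<Rightarrow> (nat \<times> nat \<Rightarrow> real) \<Rightarrow> real" where
  "lin_comb cs N x = (\<Sum>(c, v)\<leftarrow>cs. c * centred N v x)"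

definition lin_cov :: "(real \<times> cword) list \<Rightarrow> cword \<Rightarrow> real" where
  "lin_cov cs w = (\<Sum>(c, v)\<leftarrow>cs. c * lcmom [w, v])"

definition lin_var :: "(real \<times> cword) list \<Rightarrow> real" where
  "lin_var cs = (\<Sum>(c, v)\<leftarrow>cs. c * lin_cov cs v)"

text \<open>
  Limits of the mixed moments of the words \<open>ws\<close> and the \<open>p\<close>-th power of a linear combination,
  obtained by multiplying out one factor of the power at a time.
\<close>

fun lpmom :: "(real \<times> cword) list \<Rightarrow> cword list \<Rightarrow> nat \<Rightarrow> real" where
  "lpmom cs ws 0 = lcmom ws"
| "lpmom cs ws (Suc p) = (\<Sum>(c, v)\<leftarrow>cs. c * lpmom cs (v # ws) p)"

lemma poly_fn_lin_comb: "poly_fn (lin_comb cs N)"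
  unfolding lin_comb_def[abs_def] by (auto intro!: poly_fn_intros poly_fn_centred)

lemma tendsto_lpmom:
  "(\<lambda>N. \<E> x. cprod N ws x * lin_comb cs N x ^ p) \<longlonglongrightarrow> lpmom cs ws p"
proof (induction p arbitrary: ws)
  case 0
  then show ?case using tendsto_cmom[of ws] by (simp add: cmom_def)
next
  case (Suc p)
  have I: "integrable gauss_array (\<lambda>x. c * (cprod N r x * lin_comb cs N x ^ p))" for c r N
    by (intro poly_fn_integrable poly_fn_intros poly_fn_cprod poly_fn_lin_comb)
  have "cprod N ws x * lin_comb cs N x ^ Suc p =
      (\<Sum>cv\<leftarrow>cs. fst cv * (cprod N (snd cv # ws) x * lin_comb cs N x ^ p))" for N x
  proof -
    have "cprod N ws x * lin_comb cs N x ^ Suc p =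
        (\<Sum>cv\<leftarrow>cs. fst cv * centred N (snd cv) x) * (cprod N ws x * lin_comb cs N x ^ p)"
      by (simp add: lin_comb_def split_def)
    also have "\<dots> = (\<Sum>cv\<leftarrow>cs. fst cv * centred N (snd cv) x * (cprod N ws x * lin_comb cs N x ^ p))"
      by (rule sum_list_mult_const[symmetric])
    also have "\<dots> = (\<Sum>cv\<leftarrow>cs. fst cv * (cprod N (snd cv # ws) x * lin_comb cs N x ^ p))"
      by (intro sum_list_map_cong) simp
    finally show ?thesis .
  qed
  then have "(\<E> x. cprod N ws x * lin_comb cs N x ^ Suc p) =
      (\<Sum>cv\<leftarrow>cs. fst cv * (\<E> x. cprod N (snd cv # ws) x * lin_comb cs N x ^ p))" for N
    by (simp only: integral_sum_list[OF I] integral_mult_right_zero)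
  then show ?case
    using tendsto_sum_list[where xs = cs and F = sequentially, OF tendsto_mult[OF tendsto_const Suc], of fst "\<lambda>cv. snd cv # ws"]
    by (simp add: split_def)
qed

lemma lpmom_swap: "lpmom cs (v # w # ws) p = lpmom cs (w # v # ws) p"
proof (rule LIMSEQ_unique[OF tendsto_lpmom])
  have eq: "cprod N (v # w # ws) x = cprod N (w # v # ws) x" for N x
    by simp
  show "(\<lambda>N. \<E> x. cprod N (v # w # ws) x * lin_comb cs N x ^ p) \<longlonglongrightarrow> lpmom cs (w # v # ws) p"
    unfolding eq by (rule tendsto_lpmom)
qed

text \<open>
  The first word is paired either with one of the other words or with one of the \<open>p\<close> factors of the
  power.
\<close>

lemma wick_lpmom:
  "lpmom cs (w # ws) p = (\<Sum>(v, r)\<leftarrow>picks ws. lcmom [w, v] * lpmom cs r p) +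
     real p * lin_cov cs w * lpmom cs ws (p - 1)"
proof (induction p arbitrary: ws)
  case 0
  show ?case unfolding lpmom.simps(1) using wick_lcmom[of w ws] by simp
next
  case (Suc p)
  have last: "(\<Sum>(c, v)\<leftarrow>cs. c * (real p * lin_cov cs w * lpmom cs (v # ws) (p - 1))) =
      real p * lin_cov cs w * lpmom cs ws p"
  proof (cases p)
    case (Suc q)
    have "(\<Sum>(c, v)\<leftarrow>cs. c * (real p * lin_cov cs w * lpmom cs (v # ws) q)) =
        (\<Sum>(c, v)\<leftarrow>cs. real p * lin_cov cs w * (c * lpmom cs (v # ws) q))"
      by (intro sum_list_map_cong) auto
    also have "\<dots> = real p * lin_cov cs w * lpmom cs ws (Suc q)"
      by (simp only: split_def sum_list_const_mult lpmom.simps)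
    finally show ?thesis using Suc by simp
  qed (simp add: split_def)
  have mid: "(\<Sum>(c, v)\<leftarrow>cs. c * (\<Sum>(v', r)\<leftarrow>L. lcmom [w, v'] * lpmom cs (v # r) p)) =
      (\<Sum>(v', r)\<leftarrow>L. lcmom [w, v'] * lpmom cs r (Suc p))" for L
  proof -
    have "(\<Sum>(c, v)\<leftarrow>cs. c * (\<Sum>(v', r)\<leftarrow>L. lcmom [w, v'] * lpmom cs (v # r) p)) =
        (\<Sum>cv\<leftarrow>cs. \<Sum>vr\<leftarrow>L. fst cv * (lcmom [w, fst vr] * lpmom cs (snd cv # snd vr) p))"
      by (simp only: split_def sum_list_const_mult)
    also have "\<dots> = (\<Sum>vr\<leftarrow>L. \<Sum>cv\<leftarrow>cs. lcmom [w, fst vr] * (fst cv * lpmom cs (snd cv # snd vr) p))"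
      by (subst sum_list_swap) (simp only: mult.left_commute)
    also have "\<dots> = (\<Sum>(v', r)\<leftarrow>L. lcmom [w, v'] * lpmom cs r (Suc p))"
      by (simp only: split_def sum_list_const_mult lpmom.simps)
    finally show ?thesis .
  qed
  have "lpmom cs (w # ws) (Suc p) = (\<Sum>(c, v)\<leftarrow>cs. c * lpmom cs (w # v # ws) p)"
    by (simp only: lpmom.simps lpmom_swap[of cs _ w])
  also have "\<dots> = (\<Sum>(c, v)\<leftarrow>cs. c * lcmom [w, v] * lpmom cs ws p) +
      (\<Sum>(c, v)\<leftarrow>cs. c * (\<Sum>(v', r)\<leftarrow>picks ws. lcmom [w, v'] * lpmom cs (v # r) p)) +
      (\<Sum>(c, v)\<leftarrow>cs. c * (real p * lin_cov cs w * lpmom cs (v # ws) (p - 1)))"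
    unfolding Suc sum_list_picks_map
    by (simp only: split_def distrib_left sum_list_addf mult.assoc fst_conv snd_conv)
  also have "\<dots> = (\<Sum>(v', r)\<leftarrow>picks ws. lcmom [w, v'] * lpmom cs r (Suc p)) +
      real (Suc p) * lin_cov cs w * lpmom cs ws p"
    unfolding last mid
    by (simp only: split_def sum_list_mult_const lin_cov_def) (simp add: algebra_simps del: lpmom.simps)
  finally show ?case by simp
qed

text \<open>
  The moment recursion of a centred normal law with variance \<open>lin_var cs\<close>.
\<close>

lemma lpmom_gaussian:
  "lpmom cs [] 0 = 1" "lpmom cs [] (Suc 0) = 0"
  "lpmom cs [] (Suc (Suc p)) = real (Suc p) * lin_var cs * lpmom cs [] p"
proof -
  show "lpmom cs [] 0 = 1" by (simp add: lcmom_Nil)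
  show "lpmom cs [] (Suc 0) = 0" by (simp add: lcmom_single split_def)
  have "lpmom cs [] (Suc (Suc p)) = (\<Sum>(c, v)\<leftarrow>cs. c * lpmom cs [v] (Suc p))" by simp
  also have "\<dots> = (\<Sum>(c, v)\<leftarrow>cs. c * (real (Suc p) * lin_cov cs v * lpmom cs [] p))"
    unfolding wick_lpmom by simp
  also have "\<dots> = real (Suc p) * lin_var cs * lpmom cs [] p"
    unfolding lin_var_def by (simp add: split_def sum_list_const_mult[symmetric] sum_list_mult_const[symmetric] mult_ac)
  finally show "lpmom cs [] (Suc (Suc p)) = real (Suc p) * lin_var cs * lpmom cs [] p" .
qed

lemma tendsto_moments_lin_comb:
  "(\<lambda>N. \<E> x. lin_comb cs N x ^ p) \<longlonglongrightarrow> lpmom cs [] p"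
  using tendsto_lpmom[of "[]" cs p] by simp

end

section \<open>Rectangular matrices as blocks of square ones\<close>

text \<open>
  The \<open>d \<times> e\<close> matrix \<open>A\<close> placed at row \<open>p\<close> and column \<open>q\<close> of a matrix that is zero elsewhere.
\<close>

definition block :: "nat \<Rightarrow> nat \<Rightarrow> nat \<Rightarrow> nat \<Rightarrow> real mat \<Rightarrow> kernel" where
  "block p d q e A = (\<lambda>i j. if p \<le> i \<and> i < p + d \<and> q \<le> j \<and> j < q + e then A $$ (i - p, j - q) else 0)"

lemma sum_block_index:
  fixes h :: "nat \<Rightarrow> real"
  assumes "q + e \<le> K" "\<And>k. k < K \<Longrightarrow> \<not> (q \<le> k \<and> k < q + e) \<Longrightarrow> h k = 0"
  shows "(\<Sum>k<K. h k) = (\<Sum>k<e. h (q + k))"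
proof -
  have "(\<Sum>k<K. h k) = (\<Sum>k\<in>{q..<q + e}. h k)"
    using assms by (intro sum.mono_neutral_right) auto
  also have "\<dots> = (\<Sum>k<e. h (q + k))"
    by (subst sum.atLeastLessThan_shift_0) (simp add: lessThan_atLeast0)
  finally show ?thesis .
qed

lemma kmul_block:
  assumes "A \<in> carrier_mat d e" "B \<in> carrier_mat e c" "q + e \<le> K"
  shows "kmul K (block p d q e A) (block q e u c B) = block p d u c (A * B)"
proof (intro ext)
  fix i j
  have "kmul K (block p d q e A) (block q e u c B) i j =
      (\<Sum>k<e. block p d q e A i (q + k) * block q e u c B (q + k) j)"
    unfolding kmul_def by (rule sum_block_index[OF assms(3)]) (auto simp: block_def)
  also have "\<dots> = block p d u c (A * B) i j"
    using assms by (auto simp: block_def scalar_prod_def lessThan_atLeast0)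
  finally show "kmul K (block p d q e A) (block q e u c B) i j = block p d u c (A * B) i j" .
qed

lemma kmul_block_disjoint:
  assumes "\<And>k. \<not> (q \<le> k \<and> k < q + e \<and> q' \<le> k \<and> k < q' + e')"
  shows "kmul K (block p d q e A) (block q' e' u c B) = (\<lambda>i j. 0)"
proof -
  have "block p d q e A i k * block q' e' u c B k j = 0" for i j k
    using assms[of k] by (auto simp: block_def)
  then show ?thesis by (simp only: kmul_def sum.neutral_const)
qed

lemma kmul_zero [simp]: "kmul K (\<lambda>i j. 0) B = (\<lambda>i j. 0)" "kmul K A (\<lambda>i j. 0) = (\<lambda>i j. 0)"
  by (simp_all add: kmul_def)

lemma ktransp_block:
  assumes "A \<in> carrier_mat d e"
  shows "ktransp (block p d q e A) = block q e p d (transpose_mat A)"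
  using assms by (auto simp: ktransp_def block_def fun_eq_iff)

lemma ktrace_block:
  assumes "p + d \<le> K"
  shows "ktrace K (block p d p d A) = (\<Sum>i<d. A $$ (i, i))"
  unfolding ktrace_def by (subst sum_block_index[OF assms]) (auto simp: block_def)

text \<open>
  Between two blocks, only the matching block of the middle factor contributes. This is why a full
  square Gaussian matrix can replace the rectangular matrix \<open>X\<close>.
\<close>

lemma kmul_block_sandwich:
  assumes "\<And>k l. p' \<le> k \<Longrightarrow> k < p' + d' \<Longrightarrow> q \<le> l \<Longrightarrow> l < q + e \<Longrightarrow> Z k l = block p' d' q e G k l"
  shows "kmul K (block p d p' d' A) (kmul K Z (block q e u c B)) =
    kmul K (block p d p' d' A) (kmul K (block p' d' q e G) (block q e u c B))"
proof -
  have "block p d p' d' A i k * (Z k l * block q e u c B l j) =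
      block p d p' d' A i k * (block p' d' q e G k l * block q e u c B l j)" for i j k l
    using assms[of k l] by (auto simp: block_def)
  then show ?thesis by (simp only: kmul_def sum_distrib_left)
qed

lemma ktrace_block_replace:
  assumes "\<And>k l. p \<le> k \<Longrightarrow> k < p + d \<Longrightarrow> q \<le> l \<Longrightarrow> l < q + e \<Longrightarrow> Z k l = block p d q e G k l"
  shows "ktrace K (kmul K Z (block q e p d B)) = ktrace K (kmul K (block p d q e G) (block q e p d B))"
proof -
  have "Z i k * block q e p d B k i = block p d q e G i k * block q e p d B k i" for i k
    using assms[of i k] by (auto simp: block_def)
  then show ?thesis by (simp only: kmul_def ktrace_def)
qed

lemma mat_prod_simps [simp]:
  "mat_prod d [] = 1\<^sub>m d" "mat_prod d (A # As) = A * mat_prod d As"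
  by (simp_all add: mat_prod_def)

lemma mat_prod_carrier: "(\<And>A. A \<in> set As \<Longrightarrow> A \<in> carrier_mat d d) \<Longrightarrow> mat_prod d As \<in> carrier_mat d d"
  by (induction As) (auto intro: mult_carrier_mat)

lemma mat_prod_append:
  assumes "\<And>A. A \<in> set As \<union> set Bs \<Longrightarrow> A \<in> carrier_mat d d"
  shows "mat_prod d (As @ Bs) = mat_prod d As * mat_prod d Bs"
  using assms
proof (induction As)
  case Nil
  then show ?case using mat_prod_carrier[of Bs d] by simp
next
  case (Cons A As)
  have c: "A \<in> carrier_mat d d" "mat_prod d As \<in> carrier_mat d d" "mat_prod d Bs \<in> carrier_mat d d"
    using Cons.prems by (auto intro!: mat_prod_carrier)
  then show ?case using Cons by (simp add: assoc_mult_mat[OF c])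
qed

lemma transpose_mat_prod:
  assumes "\<And>A. A \<in> set As \<Longrightarrow> A \<in> carrier_mat d d"
  shows "transpose_mat (mat_prod d As) = mat_prod d (rev (map transpose_mat As))"
  using assms
proof (induction As)
  case (Cons A As)
  have c: "A \<in> carrier_mat d d" "mat_prod d As \<in> carrier_mat d d"
    using Cons.prems by (auto intro!: mat_prod_carrier)
  have "mat_prod d (rev (map transpose_mat (A # As))) =
      mat_prod d (rev (map transpose_mat As)) * mat_prod d [transpose_mat A]"
    using Cons.prems by (simp only: list.map rev.simps) (rule mat_prod_append, auto)
  also have "mat_prod d [transpose_mat A] = transpose_mat A" using c by simp
  finally show ?case using Cons transpose_mult[OF c] by simp
qed (simp add: transpose_one)

locale block_model =
  fixes n :: nat and M :: "nat \<Rightarrow> nat" and D :: "nat \<Rightarrow> nat \<Rightarrow> real mat"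
  assumes D_odd: "\<And>N m. N > 0 \<Longrightarrow> m \<in> {1..2 * n} \<Longrightarrow> odd m \<Longrightarrow> D N m \<in> carrier_mat (M N) (M N)"
    and D_even: "\<And>N m. N > 0 \<Longrightarrow> m \<in> {1..2 * n} \<Longrightarrow> even m \<Longrightarrow> D N m \<in> carrier_mat N N"
begin

definition total :: "nat \<Rightarrow> nat" where "total N = M N + N"

text \<open>
  Matrices with odd index occupy the first \<open>M\<close> rows and columns and those with even index the last \<open>N\<close>,
  so that products of both kinds vanish.
\<close>

definition letter :: "nat \<Rightarrow> nat \<Rightarrow> kernel" where
  "letter N m = (if m \<in> {1..2 * n}
     then if odd m then block 0 (M N) 0 (M N) (D N m) else block (M N) N (M N) N (D N m)
     else (\<lambda>i j. 0))"

sublocale matrix_words total letter .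

definition part_off :: "bool \<Rightarrow> nat \<Rightarrow> nat" where "part_off par N = (if par then 0 else M N)"
definition part_dim :: "bool \<Rightarrow> nat \<Rightarrow> nat" where "part_dim par N = (if par then M N else N)"

definition word_block :: "bool \<Rightarrow> nat \<Rightarrow> (nat \<times> bool) list \<Rightarrow> kernel" where
  "word_block par N w = block (part_off par N) (part_dim par N) (part_off par N) (part_dim par N)
     (word_prod (part_dim par N) (D N) w)"

lemma opt_transpose_carrier: "A \<in> carrier_mat d d \<Longrightarrow> opt_transpose t A \<in> carrier_mat d d"
  by (auto simp: opt_transpose_def)

lemma word_factor_carrier:
  assumes "N > 0" "admissible_word n par w" "A \<in> set (map (\<lambda>(m, t). opt_transpose t (D N m)) w)"
  shows "A \<in> carrier_mat (part_dim par N) (part_dim par N)"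
proof -
  obtain m t where mt: "(m, t) \<in> set w" "A = opt_transpose t (D N m)" using assms(3) by auto
  then have "m \<in> {1..2 * n}" "odd m = par" using assms(2) by (auto simp: admissible_word_def)
  then show ?thesis
    using D_odd[OF assms(1)] D_even[OF assms(1)] by (auto simp: mt part_dim_def intro!: opt_transpose_carrier)
qed

lemma word_prod_carrier:
  assumes "N > 0" "admissible_word n par w"
  shows "word_prod (part_dim par N) (D N) w \<in> carrier_mat (part_dim par N) (part_dim par N)"
  unfolding word_prod_def by (intro mat_prod_carrier word_factor_carrier[OF assms])

lemma part_fits: "part_off par N + part_dim par N \<le> total N"
  by (simp add: part_off_def part_dim_def total_def)

lemma word_block_append:
  assumes "N > 0" "admissible_word n par w" "admissible_word n par v"
  shows "kmul (total N) (word_block par N w) (word_block par N v) = word_block par N (w @ v)"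
proof -
  have "word_prod (part_dim par N) (D N) (w @ v) =
      word_prod (part_dim par N) (D N) w * word_prod (part_dim par N) (D N) v"
    unfolding word_prod_def map_append
    by (rule mat_prod_append) (use word_factor_carrier[OF assms(1)] assms(2,3) in blast)
  then show ?thesis
    unfolding word_block_def
    using kmul_block[OF word_prod_carrier[OF assms(1,2)] word_prod_carrier[OF assms(1,3)] part_fits] by simp
qed

lemma word_block_transp:
  assumes "N > 0" "admissible_word n par w"
  shows "ktransp (word_block par N w) = word_block par N (rev (map (\<lambda>(m, t). (m, \<not> t)) w))"
proof -
  have "transpose_mat (opt_transpose t A) = opt_transpose (\<not> t) A" for t and A :: "real mat"
    by (simp add: opt_transpose_def)
  then have eq: "map transpose_mat (map (\<lambda>(m, t). opt_transpose t (D N m)) w) =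
      map (\<lambda>(m, t). opt_transpose t (D N m)) (map (\<lambda>(m, t). (m, \<not> t)) w)"
    by auto
  have "transpose_mat (word_prod (part_dim par N) (D N) w) =
      mat_prod (part_dim par N) (rev (map transpose_mat (map (\<lambda>(m, t). opt_transpose t (D N m)) w)))"
    unfolding word_prod_def by (rule transpose_mat_prod[OF word_factor_carrier[OF assms]])
  then have "transpose_mat (word_prod (part_dim par N) (D N) w) =
      word_prod (part_dim par N) (D N) (rev (map (\<lambda>(m, t). (m, \<not> t)) w))"
    unfolding eq by (simp only: word_prod_def rev_map)
  then show ?thesis
    unfolding word_block_def ktransp_block[OF word_prod_carrier[OF assms]] by simp
qed

lemma word_block_disjoint:
  assumes "par \<noteq> par'"
  shows "kmul (total N) (word_block par N w) (word_block par' N v) = (\<lambda>i j. 0)"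
  unfolding word_block_def
  by (rule kmul_block_disjoint) (use assms in \<open>cases par; auto simp: part_off_def part_dim_def\<close>)

text \<open>
  An atom vanishes if it has letters of both parities or a letter out of range. Every other atom is the
  block of an admissible word, and this word does not depend on \<open>N\<close>.
\<close>

lemma atom_val_cases:
  "(\<exists>par w. admissible_word n par w \<and> (\<forall>N>0. atom_val N a = word_block par N w)) \<or>
   (\<forall>N>0. atom_val N a = (\<lambda>i j. 0))"
proof (induction a)
  case (Base m)
  show ?case
  proof (cases "m \<in> {1..2 * n}")
    case True
    have "atom_val N (Base m) = word_block (odd m) N [(m, False)]" if "N > 0" for N
    proof -
      have "D N m * 1\<^sub>m (part_dim (odd m) N) = D N m"
        using D_odd[OF that True] D_even[OF that True] by (auto simp: part_dim_def)
      then show ?thesis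
        unfolding atom_val.simps
        using True by (simp add: letter_def word_block_def part_off_def part_dim_def word_prod_def opt_transpose_def)
    qed
    moreover have "admissible_word n (odd m) [(m, False)]" using True by (simp add: admissible_word_def)
    ultimately show ?thesis by blast
  next
    case False
    then have "letter N m = (\<lambda>i j. 0)" for N unfolding letter_def by auto
    then show ?thesis by (simp only: atom_val.simps) simp
  qed
next
  case (Mul a b)
  show ?case
  proof (cases "(\<forall>N>0. atom_val N a = (\<lambda>i j. 0)) \<or> (\<forall>N>0. atom_val N b = (\<lambda>i j. 0))")
    case False
    with Mul obtain par w par' v where
      a: "admissible_word n par w" "\<And>N. N > 0 \<Longrightarrow> atom_val N a = word_block par N w" and
      b: "admissible_word n par' v" "\<And>N. N > 0 \<Longrightarrow> atom_val N b = word_block par' N v" by metis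
    show ?thesis
    proof (cases "par = par'")
      case True
      have "admissible_word n par (w @ v)" using a(1) b(1) True by (auto simp: admissible_word_def)
      moreover have "atom_val N (Mul a b) = word_block par N (w @ v)" if "N > 0" for N
        using that a b True by (simp add: word_block_append)
      ultimately show ?thesis by blast
    next
      case False
      then have "atom_val N (Mul a b) = (\<lambda>i j. 0)" if "N > 0" for N
        using that a b by (simp add: word_block_disjoint)
      then show ?thesis by blast
    qed
  qed auto
next
  case (Transp a)
  then show ?case
  proof (elim disjE exE conjE)
    fix par w assume w: "admissible_word n par w" "\<forall>N>0. atom_val N a = word_block par N w"
    have "admissible_word n par (rev (map (\<lambda>(m, t). (m, \<not> t)) w))"
      using w(1) by (auto simp: admissible_word_def)
    moreover have "atom_val N (Transp a) = word_block par N (rev (map (\<lambda>(m, t). (m, \<not> t)) w))" if "N > 0" for N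
      using w that by (simp add: word_block_transp)
    ultimately show ?case by blast
  qed (auto simp: ktransp_def)
qed

lemma atom_trace_convergent_of_words:
  assumes odd_conv: "\<And>w. admissible_word n True w \<Longrightarrow> convergent (\<lambda>N. ntr N (word_prod (M N) (D N) w))"
    and even_conv: "\<And>w. admissible_word n False w \<Longrightarrow> convergent (\<lambda>N. ntr N (word_prod N (D N) w))"
  shows "convergent (\<lambda>N. ktrace (total N) (atom_val N a) / real N)"
  using atom_val_cases[of a]
proof (elim disjE exE conjE)
  fix par w assume w: "admissible_word n par w" "\<forall>N>0. atom_val N a = word_block par N w"
  have "ktrace (total N) (atom_val N a) / real N = ntr N (word_prod (part_dim par N) (D N) w)" if "N > 0" for N
    using w(2) that word_prod_carrier[OF that w(1)]
    by (simp add: word_block_def ktrace_block[OF part_fits] ntr_def)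
  moreover have "convergent (\<lambda>N. ntr N (word_prod (part_dim par N) (D N) w))"
    using odd_conv even_conv w(1) by (cases par) (auto simp: part_dim_def)
  then obtain l where "(\<lambda>N. ntr N (word_prod (part_dim par N) (D N) w)) \<longlonglongrightarrow> l"
    unfolding convergent_def by blast
  moreover have "\<forall>\<^sub>F N in sequentially. ntr N (word_prod (part_dim par N) (D N) w) = ktrace (total N) (atom_val N a) / real N"
    using eventually_gt_at_top[of 0] by eventually_elim (simp add: calculation(1))
  ultimately show ?thesis by (blast intro: convergentI Lim_transform_eventually)
next
  assume "\<forall>N>0. atom_val N a = (\<lambda>i j. 0)"
  then have "(\<lambda>N. ktrace (total N) (atom_val N a) / real N) = (\<lambda>N. 0)"
    by (intro ext, case_tac "N > 0") (simp_all add: ktrace_def)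
  then show ?thesis by (simp only: convergent_const)
qed

text \<open>
  The segment after the leading \<open>X\<^sup>T\<close> in the trace over the indices \<open>j\<close> in the list. The value for the
  empty list is a placeholder.
\<close>

fun cycle_seg :: "nat list \<Rightarrow> segment" where
  "cycle_seg [] = At (Base 0)"
| "cycle_seg [j] = Nd (Base (2 * j - 1)) False (At (Base (2 * j)))"
| "cycle_seg (j # js) = Nd (Base (2 * j - 1)) False (Nd (Base (2 * j)) True (cycle_seg js))"

definition cycle_trace :: "nat \<Rightarrow> (nat \<Rightarrow> nat \<Rightarrow> real) \<Rightarrow> nat list \<Rightarrow> real" where
  "cycle_trace N g js = ntr N (mat_prod N (map (\<lambda>j. transpose_mat (gauss_mat (M N) N g) *
     D N (2 * j - 1) * gauss_mat (M N) N g * D N (2 * j)) js))"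

text \<open>
  The constant matrices at both ends of every factor \<open>X\<close> cut out its block in the rows below \<open>M\<close> and
  the columns from \<open>M\<close> to \<open>M + N - 1\<close>, where \<open>x\<close> agrees with the given array \<open>g\<close>.
\<close>

lemma word_val_cycle:
  assumes N: "N > 0" and js: "js \<noteq> []" "set js \<subseteq> {1..n}"
    and x: "\<And>i j. i < M N \<Longrightarrow> j < N \<Longrightarrow> x (i, M N + j) = g i j"
  shows "word_val N x (Cyc True (cycle_seg js)) / real N =
    cycle_trace N g js"
proof -
  define X where "X = gauss_mat (M N) N g"
  let ?M = "M N" and ?K = "total N"
  let ?f = "\<lambda>j. transpose_mat X * D N (2 * j - 1) * X * D N (2 * j)"
  have X: "X \<in> carrier_mat ?M N" and Xt: "transpose_mat X \<in> carrier_mat N ?M"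
    by (auto simp: X_def gauss_mat_def)
  have Kf: "0 + ?M \<le> ?K" "?M + N \<le> ?K" by (simp_all add: total_def)
  have x1: "xval N x False k l = block 0 ?M ?M N X k l" if "0 \<le> k" "k < 0 + ?M" "?M \<le> l" "l < ?M + N" for k l
    using that x[of k "l - ?M"] by (simp add: xval_def block_def X_def gauss_mat_def)
  have x2: "xval N x True k l = block ?M N 0 ?M (transpose_mat X) k l"
    if "?M \<le> k" "k < ?M + N" "0 \<le> l" "l < 0 + ?M" for k l
    using that x[of l "k - ?M"] by (simp add: xval_def block_def X_def gauss_mat_def)
  have c: "D N (2 * j - 1) \<in> carrier_mat ?M ?M" "D N (2 * j) \<in> carrier_mat N N"
    and l: "letter N (2 * j - 1) = block 0 ?M 0 ?M (D N (2 * j - 1))" "letter N (2 * j) = block ?M N ?M N (D N (2 * j))"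
    if "j \<in> {1..n}" for j
  proof -
    have "2 * j - 1 \<in> {1..2 * n}" "2 * j \<in> {1..2 * n}" "odd (2 * j - 1)" "even (2 * j)" using that by auto
    then show "D N (2 * j - 1) \<in> carrier_mat ?M ?M" "D N (2 * j) \<in> carrier_mat N N"
      "letter N (2 * j - 1) = block 0 ?M 0 ?M (D N (2 * j - 1))" "letter N (2 * j) = block ?M N ?M N (D N (2 * j))"
      using D_odd[OF N] D_even[OF N] unfolding letter_def by auto
  qed
  have fc: "?f j \<in> carrier_mat N N" if "j \<in> {1..n}" for j
    using c[OF that] X Xt by (auto intro!: mult_carrier_mat)
  have "\<exists>W. W \<in> carrier_mat ?M N \<and> seg_val N x (cycle_seg js) = block 0 ?M ?M N W \<and>
      transpose_mat X * W = mat_prod N (map ?f js)"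
    using js
  proof (induction js rule: list_nonempty_induct)
    case (single j)
    have j: "j \<in> {1..n}" using single by simp
    let ?A = "D N (2 * j - 1)" and ?B = "D N (2 * j)"
    have "seg_val N x (cycle_seg [j]) = kmul ?K (block 0 ?M 0 ?M ?A) (kmul ?K (block 0 ?M ?M N X) (block ?M N ?M N ?B))"
      unfolding cycle_seg.simps seg_val.simps atom_val.simps l[OF j]
      by (rule kmul_block_sandwich) (rule x1)
    also have "\<dots> = block 0 ?M ?M N (?A * (X * ?B))"
      unfolding kmul_block[OF X c(2)[OF j] Kf(2)]
      by (rule kmul_block[OF c(1)[OF j] mult_carrier_mat[OF X c(2)[OF j]] Kf(1)])
    finally have "seg_val N x (cycle_seg [j]) = block 0 ?M ?M N (?A * (X * ?B))" .
    moreover have "transpose_mat X * (?A * (X * ?B)) = mat_prod N (map ?f [j])"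
    proof -
      have "transpose_mat X * ?A * X * ?B = transpose_mat X * ?A * (X * ?B)"
        using c[OF j] X Xt by (intro assoc_mult_mat) (auto intro!: mult_carrier_mat)
      also have "\<dots> = transpose_mat X * (?A * (X * ?B))"
        using c[OF j] X Xt by (intro assoc_mult_mat) (auto intro!: mult_carrier_mat)
      finally have e: "?f j = transpose_mat X * (?A * (X * ?B))" .
      have "mat_prod N (map ?f [j]) = ?f j"
        by (simp only: list.map mat_prod_simps right_mult_one_mat[OF fc[OF j]])
      then show ?thesis by (simp only: e)
    qed
    moreover have "?A * (X * ?B) \<in> carrier_mat ?M N" using c[OF j] X by (auto intro!: mult_carrier_mat)
    ultimately show ?case by blast
  next
    case (cons j js)
    have j: "j \<in> {1..n}" using cons by simp
    let ?A = "D N (2 * j - 1)" and ?B = "D N (2 * j)"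
    obtain W where W: "W \<in> carrier_mat ?M N" "seg_val N x (cycle_seg js) = block 0 ?M ?M N W"
      "transpose_mat X * W = mat_prod N (map ?f js)"
      using cons by auto
    have cyc: "cycle_seg (j # js) = Nd (Base (2 * j - 1)) False (Nd (Base (2 * j)) True (cycle_seg js))"
      using cons(1) by (cases js) auto
    have XW: "transpose_mat X * W \<in> carrier_mat N N" using Xt W(1) by (rule mult_carrier_mat)
    have BXW: "?B * (transpose_mat X * W) \<in> carrier_mat N N" using c(2)[OF j] XW by (rule mult_carrier_mat)
    have "kmul ?K (letter N (2 * j)) (kmul ?K (xval N x True) (block 0 ?M ?M N W)) =
        kmul ?K (block ?M N ?M N ?B) (kmul ?K (block ?M N 0 ?M (transpose_mat X)) (block 0 ?M ?M N W))"
      unfolding l[OF j] by (rule kmul_block_sandwich) (rule x2)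
    also have "\<dots> = block ?M N ?M N (?B * (transpose_mat X * W))"
      unfolding kmul_block[OF Xt W(1) Kf(1)] by (rule kmul_block[OF c(2)[OF j] XW Kf(2)])
    finally have 1: "kmul ?K (letter N (2 * j)) (kmul ?K (xval N x True) (block 0 ?M ?M N W)) =
        block ?M N ?M N (?B * (transpose_mat X * W))" .
    have XBXW: "X * (?B * (transpose_mat X * W)) \<in> carrier_mat ?M N" using X BXW by (rule mult_carrier_mat)
    have "seg_val N x (cycle_seg (j # js)) = kmul ?K (block 0 ?M 0 ?M ?A)
        (kmul ?K (block 0 ?M ?M N X) (block ?M N ?M N (?B * (transpose_mat X * W))))"
      unfolding cyc seg_val.simps W(2) atom_val.simps 1 unfolding l[OF j]
      by (rule kmul_block_sandwich) (rule x1)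
    also have "\<dots> = block 0 ?M ?M N (?A * (X * (?B * (transpose_mat X * W))))"
      unfolding kmul_block[OF X BXW Kf(2)] by (rule kmul_block[OF c(1)[OF j] XBXW Kf(1)])
    finally have 2: "seg_val N x (cycle_seg (j # js)) = block 0 ?M ?M N (?A * (X * (?B * (transpose_mat X * W))))" .
    have "?f j * (transpose_mat X * W) = transpose_mat X * ?A * X * (?B * (transpose_mat X * W))"
      using c[OF j] X Xt XW by (intro assoc_mult_mat) (auto intro!: mult_carrier_mat)
    also have "\<dots> = transpose_mat X * ?A * (X * (?B * (transpose_mat X * W)))"
      using c[OF j] X Xt BXW by (intro assoc_mult_mat) (auto intro!: mult_carrier_mat)
    also have "\<dots> = transpose_mat X * (?A * (X * (?B * (transpose_mat X * W))))"
      using c[OF j] X Xt XBXW by (intro assoc_mult_mat) (auto intro!: mult_carrier_mat)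
    finally have "transpose_mat X * (?A * (X * (?B * (transpose_mat X * W)))) = mat_prod N (map ?f (j # js))"
      by (simp add: W(3))
    moreover have "?A * (X * (?B * (transpose_mat X * W))) \<in> carrier_mat ?M N"
      using c(1)[OF j] XBXW by (rule mult_carrier_mat)
    ultimately show ?case using 2 by blast
  qed
  then obtain W where W: "W \<in> carrier_mat ?M N" "seg_val N x (cycle_seg js) = block 0 ?M ?M N W"
      "transpose_mat X * W = mat_prod N (map ?f js)" by blast
  have "word_val N x (Cyc True (cycle_seg js)) =
      ktrace ?K (kmul ?K (block ?M N 0 ?M (transpose_mat X)) (block 0 ?M ?M N W))"
    unfolding word_val.simps W(2) by (rule ktrace_block_replace) (rule x2)
  also have "\<dots> = (\<Sum>i<N. (transpose_mat X * W) $$ (i, i))"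
    unfolding kmul_block[OF Xt W(1) Kf(1)] by (rule ktrace_block[OF Kf(2)])
  finally have "word_val N x (Cyc True (cycle_seg js)) = (\<Sum>i<N. mat_prod N (map ?f js) $$ (i, i))"
    unfolding W(3) .
  moreover have "dim_row (mat_prod N (map ?f js)) = N" using Xt W(1) unfolding W(3)[symmetric] by simp
  ultimately show ?thesis unfolding cycle_trace_def X_def ntr_def by simp
qed

end

section \<open>The limit theorem\<close>

text \<open>
  Both arrays consist of independent standard normal variables, and the index map of the second one is
  injective.
\<close>

lemma distr_array_eq_gauss:
  fixes P :: "'w measure" and f :: "nat \<Rightarrow> nat \<Rightarrow> 'w \<Rightarrow> real"
  assumes P: "prob_space P" and pos: "N > 0" "M > 0"
    and f: "\<And>i j. i < M \<Longrightarrow> j < N \<Longrightarrow> distributed P lborel (f i j) (normal_density 0 1)"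
    and ind: "prob_space.indep_vars P (\<lambda>_. borel) (\<lambda>(i, j). f i j) ({..<M} \<times> {..<N})"
  defines "J \<equiv> {..<M} \<times> {..<N}"
  shows "distr P (\<Pi>\<^sub>M e\<in>J. borel) (\<lambda>\<omega>. \<lambda>e\<in>J. f (fst e) (snd e) \<omega>) =
    distr gauss_array (\<Pi>\<^sub>M e\<in>J. borel) (\<lambda>x. \<lambda>e\<in>J. x (fst e, M + snd e))"
proof -
  interpret prob_space P by fact
  have J: "J \<noteq> {}" using pos by (auto simp: J_def)
  have rv: "f (fst e) (snd e) \<in> borel_measurable P" if "e \<in> J" for e
    using f[of "fst e" "snd e"] that by (auto simp: J_def distributed_def)
  have law: "distr P borel (f (fst e) (snd e)) = std_normal_distribution" if "e \<in> J" for e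
    using f[of "fst e" "snd e"] that by (auto simp: J_def distributed_def cong: distr_cong)
  have "indep_vars (\<lambda>_. borel) (\<lambda>e. f (fst e) (snd e)) J"
    using ind by (simp add: J_def split_def)
  then have "distr P (\<Pi>\<^sub>M e\<in>J. borel) (\<lambda>\<omega>. \<lambda>e\<in>J. f (fst e) (snd e) \<omega>) =
      (\<Pi>\<^sub>M e\<in>J. distr P borel (f (fst e) (snd e)))"
    using indep_vars_iff_distr_eq_PiM'[OF J, where M' = "\<lambda>_. borel" and X = "\<lambda>e. f (fst e) (snd e)"] rv by simp
  also have "\<dots> = (\<Pi>\<^sub>M e\<in>J. std_normal_distribution)" by (intro PiM_cong refl law)
  also have "\<dots> = distr gauss_array (\<Pi>\<^sub>M e\<in>J. std_normal_distribution) (\<lambda>x. \<lambda>e\<in>J. x (fst e, M + snd e))"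
    unfolding gauss_array_def
    by (rule distr_PiM_reindex[of UNIV "\<lambda>_. std_normal_distribution" "\<lambda>e. (fst e, M + snd e)" J, symmetric])
       (auto simp: prob_space_std_normal inj_on_def)
  also have "\<dots> = distr gauss_array (\<Pi>\<^sub>M e\<in>J. borel) (\<lambda>x. \<lambda>e\<in>J. x (fst e, M + snd e))"
    by (rule distr_cong) (auto intro!: sets_PiM_cong)
  finally show ?thesis .
qed

text \<open>
  The traces are the same function of the random array \<open>f\<close> and of the upper right block of the
  Gaussian array, which have the same law. Padding with zeros extends the former to a full array.
\<close>

lemma (in block_model) law_of_traces:
  fixes P :: "'w measure" and f :: "nat \<Rightarrow> nat \<Rightarrow> 'w \<Rightarrow> real"
  assumes P: "prob_space P" and pos: "N > 0" "M N > 0"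
    and f: "\<And>i j. i < M N \<Longrightarrow> j < N \<Longrightarrow> distributed P lborel (f i j) (normal_density 0 1)"
    and ind: "prob_space.indep_vars P (\<lambda>_. borel) (\<lambda>(i, j). f i j) ({..<M N} \<times> {..<N})"
    and js: "\<And>k. k \<in> I \<Longrightarrow> js k \<noteq> [] \<and> set (js k) \<subseteq> {1..n}"
  defines "y \<equiv> (\<lambda>k \<omega>. cycle_trace N (\<lambda>i j. f i j \<omega>) (js k))"
  shows "(\<lambda>\<omega>. \<lambda>k\<in>I. y k \<omega>) \<in> measurable P (euclid I)"
    and "distr P (euclid I) (\<lambda>\<omega>. \<lambda>k\<in>I. y k \<omega>) =
      distr gauss_array (euclid I) (\<lambda>x. \<lambda>k\<in>I. word_val N x (Cyc True (cycle_seg (js k))) / real N)"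
proof -
  define J where "J = {..<M N} \<times> {..<N}"
  define w where "w k = Cyc True (cycle_seg (js k))" for k
  define pad where "pad z = (\<lambda>e. if fst e < M N \<and> M N \<le> snd e \<and> snd e < M N + N
      then z (fst e, snd e - M N) else 0)" for z :: "nat \<times> nat \<Rightarrow> real"
  define \<Phi> where "\<Phi> z = (\<lambda>k\<in>I. word_val N (pad z) (w k) / real N)" for z
  have pad: "pad \<in> measurable (\<Pi>\<^sub>M e\<in>J. borel) gauss_array"
    unfolding gauss_array_def pad_def
  proof (rule measurable_abs_UNIV)
    fix e :: "nat \<times> nat"
    have "(\<lambda>z. if fst e < M N \<and> M N \<le> snd e \<and> snd e < M N + N then z (fst e, snd e - M N) else (0::real))
        \<in> borel_measurable (\<Pi>\<^sub>M e\<in>J. borel)"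
    proof (cases "fst e < M N \<and> M N \<le> snd e \<and> snd e < M N + N")
      case True
      then have "(fst e, snd e - M N) \<in> J" by (auto simp: J_def)
      from measurable_component_singleton[OF this] True show ?thesis by simp
    next
      case False
      show ?thesis unfolding if_not_P[OF False] by simp
    qed
    then show "(\<lambda>z. if fst e < M N \<and> M N \<le> snd e \<and> snd e < M N + N then z (fst e, snd e - M N) else (0::real))
        \<in> measurable (\<Pi>\<^sub>M e\<in>J. borel) std_normal_distribution"
      by (simp cong: measurable_cong_sets)
  qed
  have mw: "(\<lambda>x. word_val N x v) \<in> borel_measurable gauss_array" for v
    by (rule borel_measurable_integrable[OF poly_fn_integrable[OF poly_fn_word_val]])
  have m\<Phi>: "\<Phi> \<in> measurable (\<Pi>\<^sub>M e\<in>J. borel) (euclid I)"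
    unfolding \<Phi>_def[abs_def] euclid_def
    by (intro measurable_restrict borel_measurable_divide measurable_compose[OF pad mw]) simp
  have rv: "f (fst e) (snd e) \<in> borel_measurable P" if "e \<in> J" for e
    using f[of "fst e" "snd e"] that by (auto simp: J_def distributed_def)
  have mF: "(\<lambda>\<omega>. \<lambda>e\<in>J. f (fst e) (snd e) \<omega>) \<in> measurable P (\<Pi>\<^sub>M e\<in>J. borel)"
    by (intro measurable_restrict rv)
  have mG: "(\<lambda>x. \<lambda>e\<in>J. x (fst e, M N + snd e)) \<in> measurable gauss_array (\<Pi>\<^sub>M e\<in>J. borel)"
    by (intro measurable_restrict measurable_gauss_array_coord)
  have y: "(\<lambda>k\<in>I. y k \<omega>) = \<Phi> (\<lambda>e\<in>J. f (fst e) (snd e) \<omega>)" for \<omega>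
  proof (unfold \<Phi>_def, rule restrict_ext)
    fix k assume k: "k \<in> I"
    show "y k \<omega> = word_val N (pad (\<lambda>e\<in>J. f (fst e) (snd e) \<omega>)) (w k) / real N"
      unfolding y_def w_def
      by (rule word_val_cycle[symmetric]) (use js[OF k] pos in \<open>auto simp: pad_def J_def\<close>)
  qed
  have g: "(\<lambda>k\<in>I. word_val N x (w k) / real N) = \<Phi> (\<lambda>e\<in>J. x (fst e, M N + snd e))" for x
  proof (unfold \<Phi>_def, rule restrict_ext)
    fix k assume k: "k \<in> I"
    have "word_val N x (w k) / real N = cycle_trace N (\<lambda>i j. x (i, M N + j)) (js k)"
      unfolding w_def by (rule word_val_cycle) (use js[OF k] pos in auto)
    also have "\<dots> = word_val N (pad (\<lambda>e\<in>J. x (fst e, M N + snd e))) (w k) / real N"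
      unfolding w_def by (rule word_val_cycle[symmetric]) (use js[OF k] pos in \<open>auto simp: pad_def J_def\<close>)
    finally show "word_val N x (w k) / real N = word_val N (pad (\<lambda>e\<in>J. x (fst e, M N + snd e))) (w k) / real N" .
  qed
  show "(\<lambda>\<omega>. \<lambda>k\<in>I. y k \<omega>) \<in> measurable P (euclid I)"
    unfolding y by (rule measurable_compose[OF mF m\<Phi>])
  have "distr P (euclid I) (\<lambda>\<omega>. \<lambda>k\<in>I. y k \<omega>) =
      distr (distr P (\<Pi>\<^sub>M e\<in>J. borel) (\<lambda>\<omega>. \<lambda>e\<in>J. f (fst e) (snd e) \<omega>)) (euclid I) \<Phi>"
    unfolding y by (simp add: distr_distr[OF m\<Phi> mF] o_def)
  also have "\<dots> = distr (distr gauss_array (\<Pi>\<^sub>M e\<in>J. borel) (\<lambda>x. \<lambda>e\<in>J. x (fst e, M N + snd e))) (euclid I) \<Phi>"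
    unfolding J_def using distr_array_eq_gauss[OF P pos f ind] by simp
  also have "\<dots> = distr gauss_array (euclid I) (\<lambda>x. \<lambda>k\<in>I. word_val N x (w k) / real N)"
    unfolding g by (simp add: distr_distr[OF m\<Phi> mG] o_def)
  finally show "distr P (euclid I) (\<lambda>\<omega>. \<lambda>k\<in>I. y k \<omega>) =
      distr gauss_array (euclid I) (\<lambda>x. \<lambda>k\<in>I. word_val N x (Cyc True (cycle_seg (js k))) / real N)"
    unfolding w_def .
qed

context matrix_model
begin

lemma lin_comb_char:
  "(\<lambda>N. \<E> x. iexp (lin_comb cs N x)) \<longlonglongrightarrow> complex_of_real (exp (- lin_var cs / 2))"
proof (rule gaussian_char_of_moments[OF prob_space_gauss_array])
  show "integrable gauss_array (\<lambda>x. lin_comb cs N x ^ p)" for N p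
    by (intro poly_fn_integrable poly_fn_power poly_fn_lin_comb)
  show "(\<lambda>N. \<E> x. lin_comb cs N x ^ p) \<longlonglongrightarrow> lpmom cs [] p" for p
    by (rule tendsto_moments_lin_comb)
  show "lpmom cs [] 0 = 1" "lpmom cs [] 1 = 0"
    using lpmom_gaussian(1,2)[of cs] by (simp_all only: One_nat_def)
  show "lpmom cs [] (Suc (Suc p)) = real (Suc p) * lin_var cs * lpmom cs [] p" for p
    by (rule lpmom_gaussian)
qed

text \<open>
  The variance is a limit of second moments.
\<close>

lemma lin_var_nonneg: "0 \<le> lin_var cs"
proof -
  have "lpmom cs [] (Suc (Suc 0)) = lin_var cs"
    unfolding lpmom_gaussian(3) lpmom_gaussian(1) by simp
  then have "(\<lambda>N. \<E> x. lin_comb cs N x ^ Suc (Suc 0)) \<longlonglongrightarrow> lin_var cs"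
    using tendsto_moments_lin_comb[of cs "Suc (Suc 0)"] by simp
  then show ?thesis
    by (rule LIMSEQ_le_const) (auto intro!: exI[of _ 0] Bochner_Integration.integral_nonneg)
qed

definition upto_comb :: "nat \<Rightarrow> (nat \<Rightarrow> cword) \<Rightarrow> (nat \<Rightarrow> real) \<Rightarrow> (real \<times> cword) list" where
  "upto_comb r w a = map (\<lambda>i. (a i, w i)) [1..<Suc r]"

lemma lin_comb_upto_comb: "lin_comb (upto_comb r w a) N x = (\<Sum>i\<in>{1..r}. a i * centred N (w i) x)"
  unfolding lin_comb_def upto_comb_def
  by (simp add: o_def interv_sum_list_conv_sum_set_nat atLeastLessThanSuc_atLeastAtMost del: upt_Suc)

lemma lin_var_upto_comb:
  "lin_var (upto_comb r w a) = (\<Sum>i\<in>{1..r}. \<Sum>j\<in>{1..r}. a i * a j * lcmom [w i, w j])"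
  unfolding lin_var_def lin_cov_def upto_comb_def
  by (simp add: o_def interv_sum_list_conv_sum_set_nat atLeastLessThanSuc_atLeastAtMost
      sum_distrib_left mult.assoc del: upt_Suc)

lemma lcmom_commute: "lcmom [v, w] = lcmom [w, v]"
proof -
  have "cprod N [v, w] = cprod N [w, v]" for N
    by (rule ext) (simp add: mult.commute)
  then show ?thesis unfolding lcmom_def cmom_def by simp
qed

text \<open>
  Dividing the centred trace by \<open>N\<close> once more makes all its moments of positive order vanish in the
  limit, which is the moment criterion with variance zero.
\<close>

lemma word_val_mean_char:
  "(\<lambda>N. \<E> x. iexp (t * (word_val N x w / real N))) \<longlonglongrightarrow> iexp (t * lmean w)"
proof -
  let ?S = "\<lambda>N x. t / real N * centred N w x"
  have S: "poly_fn (?S N)" for N by (intro poly_fn_intros poly_fn_centred)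
  have "(\<lambda>N. \<E> x. iexp (?S N x)) \<longlonglongrightarrow> complex_of_real (exp (- 0 / 2))"
  proof (rule gaussian_char_of_moments[OF prob_space_gauss_array, where m = "\<lambda>p. if p = 0 then 1 else 0"])
    show "integrable gauss_array (\<lambda>x. ?S N x ^ p)" for N p
      by (intro poly_fn_integrable poly_fn_power S)
    show "(\<lambda>N. \<E> x. ?S N x ^ p) \<longlonglongrightarrow> (if p = 0 then 1 else 0)" for p
    proof (cases "p = 0")
      case False
      have "(\<lambda>N. t / real N) \<longlonglongrightarrow> 0"
        by (rule tendsto_over_N[OF tendsto_const])
      then have "(\<lambda>N. (t / real N) ^ p * (\<E> x. lin_comb [(1, w)] N x ^ p))
          \<longlonglongrightarrow> 0 ^ p * lpmom [(1, w)] [] p"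
        by (intro tendsto_mult tendsto_power tendsto_moments_lin_comb)
      moreover have "(\<E> x. ?S N x ^ p) =
          (t / real N) ^ p * (\<E> x. lin_comb [(1, w)] N x ^ p)" for N
        unfolding power_mult_distrib integral_mult_right_zero by (simp add: lin_comb_def)
      moreover have "0 ^ p * lpmom [(1, w)] [] p = 0" using False by (simp del: lpmom.simps)
      ultimately show ?thesis using False by (simp only: if_False)
    qed (simp add: gauss.prob_space)
  qed auto
  then have 1: "(\<lambda>N. \<E> x. iexp (?S N x)) \<longlonglongrightarrow> 1" by simp
  have 2: "(\<lambda>N. iexp (t * mean N w)) \<longlonglongrightarrow> iexp (t * lmean w)"
    by (intro tendsto_intros tendsto_mean)
  have "iexp (t * (word_val N x w / real N)) = iexp (t * mean N w) * iexp (?S N x)" for N x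
  proof -
    have "t * (word_val N x w / real N) = t * mean N w + ?S N x"
      by (simp add: mean_def centred_def diff_divide_distrib algebra_simps)
    then show ?thesis by (simp only: of_real_add distrib_left exp_add)
  qed
  then have "(\<lambda>N. \<E> x. iexp (t * (word_val N x w / real N))) =
      (\<lambda>N. iexp (t * mean N w) * (\<E> x. iexp (?S N x)))"
    by (simp only: integral_mult_right_zero)
  with tendsto_mult[OF 2 1] show ?thesis by (simp only: mult_1_right)
qed

end


theorem theorem6p1:
  fixes r n :: nat and ns :: "nat \<Rightarrow> nat"
    and M :: "nat \<Rightarrow> nat"
    and P :: "nat \<Rightarrow> 'w measure"
    and f :: "nat \<Rightarrow> nat \<Rightarrow> nat \<Rightarrow> 'w \<Rightarrow> real"
    and X :: "nat \<Rightarrow> 'w \<Rightarrow> real mat"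
    and D :: "nat \<Rightarrow> nat \<Rightarrow> real mat"
    and Y :: "nat \<Rightarrow> nat \<Rightarrow> 'w \<Rightarrow> real"
  assumes r_pos: "r > 0"
    and ns_pos: "\<And>k. k \<in> {1..r} \<Longrightarrow> ns k > 0"
    and n_eq: "n = (\<Sum>k = 1..r. ns k)"
    and M_pos: "\<And>N. N > 0 \<Longrightarrow> M N > 0"
    and M_lim: "filterlim M at_top sequentially"
    and prob: "\<And>N. N > 0 \<Longrightarrow> prob_space (P N)"
    and f_normal: "\<And>N i j. N > 0 \<Longrightarrow> i < M N \<Longrightarrow> j < N \<Longrightarrow>
        distributed (P N) lborel (f N i j) (normal_density 0 1)"
    and f_indep: "\<And>N. N > 0 \<Longrightarrow>
        prob_space.indep_vars (P N) (\<lambda>_. borel) (\<lambda>(i, j). f N i j) ({..<M N} \<times> {..<N})"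
    and X_eq: "\<And>N \<omega>. X N \<omega> = gauss_mat (M N) N (\<lambda>i j. f N i j \<omega>)"
    and D_odd: "\<And>N m. N > 0 \<Longrightarrow> m \<in> {1..2 * n} \<Longrightarrow> odd m \<Longrightarrow> D N m \<in> carrier_mat (M N) (M N)"
    and D_even: "\<And>N m. N > 0 \<Longrightarrow> m \<in> {1..2 * n} \<Longrightarrow> even m \<Longrightarrow> D N m \<in> carrier_mat N N"
    and D_lim_odd: "\<And>w. admissible_word n True w \<Longrightarrow>
        convergent (\<lambda>N. ntr N (word_prod (M N) (D N) w))"
    and D_lim_even: "\<And>w. admissible_word n False w \<Longrightarrow>
        convergent (\<lambda>N. ntr N (word_prod N (D N) w))"
    and Y_eq: "\<And>N k \<omega>. Y N k \<omega> = alternating_trace N ns (D N) (X N \<omega>) k"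
  shows "(\<forall>k\<in>{1..r}.
            convergent (\<lambda>N. cumulant1 (P N) (Y N k)) \<and>
            weak_conv_m (\<lambda>N. distr (P N) borel (Y N k))
              (return borel (lim (\<lambda>N. cumulant1 (P N) (Y N k)))))
       \<and> (\<forall>k\<in>{1..r}. \<forall>l\<in>{1..r}.
            convergent (\<lambda>N. (real N)\<^sup>2 * cumulant2 (P N) (Y N k) (Y N l)))
       \<and> (\<exists>\<nu>. centred_gaussian_vec {1..r}
                (\<lambda>k l. lim (\<lambda>N. (real N)\<^sup>2 * cumulant2 (P N) (Y N k) (Y N l))) \<nu> \<and>
              weak_conv_vec {1..r}
                (\<lambda>N. joint_law (P N) {1..r}
                       (\<lambda>k \<omega>. real N * (Y N k \<omega> - cumulant1 (P N) (Y N k)))) \<nu>)"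
proof -
  interpret block_model n M D
    by unfold_locales (use D_odd D_even in auto)
  interpret matrix_model total letter
    by unfold_locales (rule atom_trace_convergent_of_words[OF D_lim_odd D_lim_even])
  define I where "I = {1..r}"
  define js where "js k = [psum ns (k - 1) + 1 ..< psum ns k + 1]" for k
  define w where "w k = Cyc True (cycle_seg (js k))" for k
  have js: "js k \<noteq> [] \<and> set (js k) \<subseteq> {1..n}" if "k \<in> I" for k
  proof -
    have k: "1 \<le> k" "k \<le> r" using that by (auto simp: I_def)
    have "psum ns k = psum ns (k - 1) + ns k"
      using k by (cases k) (simp_all add: psum_def)
    moreover have "ns k > 0" using ns_pos k by simp
    moreover have "psum ns k \<le> n"
      unfolding n_eq psum_def using k by (intro sum_mono2) auto
    ultimately show ?thesis by (auto simp: js_def)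
  qed
  have Y: "Y N k \<omega> = cycle_trace N (\<lambda>i j. f N i j \<omega>) (js k)" for N k \<omega>
    unfolding Y_eq alternating_trace_def X_eq js_def cycle_trace_def ..
  define y where "y N \<omega> = (\<lambda>k\<in>I. Y N k \<omega>)" for N \<omega>
  define z where "z N x = (\<lambda>k\<in>I. word_val N x (w k) / real N)" for N x
  have my: "y N \<in> measurable (P N) (euclid I)"
    and law: "distr (P N) (euclid I) (y N) = distr gauss_array (euclid I) (z N)" if "N > 0" for N
    unfolding y_def[abs_def] z_def[abs_def] Y w_def
    by (rule law_of_traces[OF prob[OF that] that M_pos[OF that] f_normal[OF that] f_indep[OF that] js]; assumption)+
  have mw: "(\<lambda>x. word_val N x v) \<in> borel_measurable gauss_array" for N v
    by (rule borel_measurable_integrable[OF poly_fn_integrable[OF poly_fn_word_val]])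
  have mz: "z N \<in> measurable gauss_array (euclid I)" for N
    unfolding z_def[abs_def] euclid_def by (intro measurable_restrict borel_measurable_divide mw) simp
  have mc: "(\<lambda>v. v k) \<in> borel_measurable (euclid I)" if "k \<in> I" for k
    unfolding euclid_def by (rule measurable_component_singleton[OF that])

  have transfer: "(\<integral>\<omega>. h (y N \<omega>) \<partial>P N) = (\<E> x. h (z N x))"
    if "N > 0" "h \<in> borel_measurable (euclid I)" for N and h :: "(nat \<Rightarrow> real) \<Rightarrow> real"
    using integral_distr[OF my[OF that(1)] that(2)] integral_distr[OF mz[of N] that(2)] law[OF that(1)] by simp
  have mean_Y: "cumulant1 (P N) (Y N k) = mean N (w k)" if "N > 0" "k \<in> I" for N k
    using transfer[OF that(1) mc[OF that(2)]] that(2)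
    by (simp add: cumulant1_def y_def z_def mean_def)
  have cov_Y: "(real N)\<^sup>2 * cumulant2 (P N) (Y N k) (Y N l) = cmom N [w k, w l]"
    if N: "N > 0" and k: "k \<in> I" and l: "l \<in> I" for N k l
  proof -
    have "(\<integral>\<omega>. Y N k \<omega> * Y N l \<omega> \<partial>P N) = (\<E> x. word_val N x (w k) / real N * (word_val N x (w l) / real N))"
      using transfer[OF N borel_measurable_times[OF mc[OF k] mc[OF l]]] k l by (simp add: y_def z_def)
    also have "\<dots> = (\<E> x. word_val N x (w k) * word_val N x (w l)) / (real N)\<^sup>2"
      by (simp add: power2_eq_square)
    finally have E2: "(real N)\<^sup>2 * (\<integral>\<omega>. Y N k \<omega> * Y N l \<omega> \<partial>P N) =
        (\<E> x. word_val N x (w k) * word_val N x (w l))"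
      using N by simp
    have "(\<E> x. word_val N x (w k) * word_val N x (w l)) =
        cmom N [w k, w l] + real N * mean N (w k) * (real N * mean N (w l))"
    proof -
      have "(\<E> x. word_val N x (w k) * cprod N [w l] x) = cmom N [w k, w l]"
        unfolding expectation_mult_cprod[OF N] by (simp add: cmom_single)
      moreover have "word_val N x (w k) * word_val N x (w l) =
          word_val N x (w k) * cprod N [w l] x + real N * mean N (w l) * word_val N x (w k)" for x
        using N by (simp add: centred_def mean_def algebra_simps)
      moreover have "integrable gauss_array (\<lambda>x. word_val N x (w k) * cprod N [w l] x)"
        "integrable gauss_array (\<lambda>x. word_val N x (w k))"
        by (intro poly_fn_integrable poly_fn_mult poly_fn_word_val poly_fn_cprod)+
      moreover have "(\<E> x. word_val N x (w k)) = real N * mean N (w k)"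
        using N by (simp add: mean_def)
      ultimately show ?thesis
        by (simp only: Bochner_Integration.integral_add integrable_mult_right integral_mult_right_zero mult_ac)
    qed
    then show ?thesis
      using E2 mean_Y[OF N k] mean_Y[OF N l] unfolding cumulant2_def cumulant1_def
      by (simp add: right_diff_distrib power2_eq_square mult_ac)
  qed
  have ev: "\<forall>\<^sub>F N in sequentially. N > (0::nat)" by (rule eventually_gt_at_top)
  have mean_lim: "(\<lambda>N. cumulant1 (P N) (Y N k)) \<longlonglongrightarrow> lmean (w k)" if "k \<in> I" for k
    by (rule Lim_transform_eventually[OF tendsto_mean eventually_mono[OF ev]]) (simp add: mean_Y that)
  have cov_lim: "(\<lambda>N. (real N)\<^sup>2 * cumulant2 (P N) (Y N k) (Y N l)) \<longlonglongrightarrow> lcmom [w k, w l]"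
    if "k \<in> I" "l \<in> I" for k l
    by (rule Lim_transform_eventually[OF tendsto_cmom eventually_mono[OF ev]]) (simp add: cov_Y that)

  have weak1: "weak_conv_m (\<lambda>N. distr (P N) borel (Y N k)) (return borel (lmean (w k)))" if k: "k \<in> I" for k
  proof -
    have yk: "(\<lambda>v. v k) \<circ> y N = Y N k" for N using k by (simp add: y_def fun_eq_iff)
    have mY: "Y N k \<in> borel_measurable (P N)" if "N > 0" for N
      using measurable_comp[OF my[OF that] mc[OF k]] by (simp only: yk)
    have law1: "distr (P N) borel (Y N k) = distr gauss_array borel (\<lambda>x. word_val N x (w k) / real N)" if "N > 0" for N
    proof -
      have "distr (P N) borel (Y N k) = distr (distr (P N) (euclid I) (y N)) borel (\<lambda>v. v k)"
        by (simp only: distr_distr[OF mc[OF k] my[OF that]] yk)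
      also have "\<dots> = distr gauss_array borel (\<lambda>x. word_val N x (w k) / real N)"
        unfolding law[OF that] distr_distr[OF mc[OF k] mz] using k by (simp add: z_def o_def)
      finally show ?thesis .
    qed
    have mwN: "(\<lambda>x. word_val N x (w k) / real N) \<in> borel_measurable gauss_array" for N
      by (intro borel_measurable_divide mw) simp
    \<comment> \<open>The index is shifted because \<open>P 0\<close> need not be a probability measure.\<close>
    have "weak_conv_m (\<lambda>N. distr (P (Suc N)) borel (Y (Suc N) k)) (return borel (lmean (w k)))"
    proof (rule levy_continuity)
      show "real_distribution (distr (P (Suc N)) borel (Y (Suc N) k))" for N
        unfolding law1[OF zero_less_Suc] by (rule gauss.real_distribution_distr[OF mwN])
      show "real_distribution (return borel (lmean (w k)))"
        unfolding real_distribution_def real_distribution_axioms_def by (simp add: prob_space_return)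
      fix t
      have "char (distr (P (Suc N)) borel (Y (Suc N) k)) t =
          (\<E> x. iexp (t * (word_val (Suc N) x (w k) / real (Suc N))))" for N
        unfolding law1[OF zero_less_Suc] char_def by (rule integral_distr[OF mwN]) measurable
      moreover have "char (return borel (lmean (w k))) t = iexp (t * lmean (w k))"
        unfolding char_def by (subst integral_return) auto
      ultimately show "(\<lambda>N. char (distr (P (Suc N)) borel (Y (Suc N) k)) t) \<longlonglongrightarrow> char (return borel (lmean (w k))) t"
        using LIMSEQ_Suc[OF word_val_mean_char[of t "w k"]] by (simp only:)
    qed
    then show ?thesis
      unfolding weak_conv_m_def weak_conv_def by (auto intro: LIMSEQ_imp_Suc)
  qed

  define C where "C k l = lim (\<lambda>N. (real N)\<^sup>2 * cumulant2 (P N) (Y N k) (Y N l))" for k l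
  have C: "C k l = lcmom [w k, w l]" if "k \<in> I" "l \<in> I" for k l
    unfolding C_def by (rule limI[OF cov_lim[OF that]])
  have quad: "quad_form I C a = lin_var (upto_comb r w a)" for a
    unfolding lin_var_upto_comb using C by (simp add: I_def)
  have Csym: "C i j = C j i" if "i \<in> I" "j \<in> I" for i j
    using C that lcmom_commute by simp
  have Cpsd: "0 \<le> quad_form I C a" for a
    unfolding quad by (rule lin_var_nonneg)
  have finI: "finite I" by (simp add: I_def)
  obtain \<nu> where \<nu>: "centred_gaussian_vec I C \<nu>"
    and \<nu>char: "\<And>a. (\<integral>x. iexp (\<Sum>i\<in>I. a i * x i) \<partial>\<nu>) = complex_of_real (exp (- quad_form I C a / 2))"
    and \<nu>sq: "\<And>i. i \<in> I \<Longrightarrow> integrable \<nu> (\<lambda>x. (x i)\<^sup>2)"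
    using gaussian_vector_exists[OF finI Csym Cpsd] by blast
  have \<nu>p: "prob_space \<nu>" "sets \<nu> = sets (euclid I)"
    using \<nu> unfolding centred_gaussian_vec_def gaussian_vec_def by auto

  define \<mu> where "\<mu> N = joint_law (P N) I (\<lambda>k \<omega>. real N * (Y N k \<omega> - cumulant1 (P N) (Y N k)))" for N
  define c where "c N x = (\<lambda>k\<in>I. centred N (w k) x)" for N x
  have mcen: "centred N v \<in> borel_measurable gauss_array" for N v
    by (rule borel_measurable_integrable[OF poly_fn_integrable[OF poly_fn_centred]])
  have mcN: "c N \<in> measurable gauss_array (euclid I)" for N
    unfolding c_def[abs_def] euclid_def by (intro measurable_restrict mcen)
  have \<mu>: "\<mu> N = distr gauss_array (euclid I) (c N)" if N: "N > 0" for N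
  proof -
    let ?\<psi> = "\<lambda>v. \<lambda>k\<in>I. real N * (v k - cumulant1 (P N) (Y N k))"
    have m\<psi>: "?\<psi> \<in> measurable (euclid I) (euclid I)"
      unfolding euclid_def
      by (intro measurable_restrict borel_measurable_times borel_measurable_diff borel_measurable_const)
         (rule measurable_component_singleton)
    have "\<mu> N = distr (P N) (euclid I) (?\<psi> \<circ> y N)"
      unfolding \<mu>_def joint_law_def by (intro arg_cong[where f = "distr _ _"] ext) (simp add: y_def restrict_def)
    also have "\<dots> = distr (distr gauss_array (euclid I) (z N)) (euclid I) ?\<psi>"
      by (simp only: distr_distr[OF m\<psi> my[OF N], symmetric] law[OF N])
    also have "\<dots> = distr gauss_array (euclid I) (?\<psi> \<circ> z N)"
      by (rule distr_distr[OF m\<psi> mz])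
    also have "?\<psi> \<circ> z N = c N"
    proof
      fix x
      show "(?\<psi> \<circ> z N) x = c N x"
        unfolding c_def o_def
        by (rule restrict_ext) (use N mean_Y[OF N] in \<open>simp add: z_def centred_def mean_def right_diff_distrib\<close>)
    qed
    finally show ?thesis .
  qed
  have weak2: "weak_conv_vec I \<mu> \<nu>"
  proof (rule weak_conv_vec_of_char[OF finI _ \<nu>p(1) _ \<nu>p(2) _ \<nu>sq])
    show "prob_space (\<mu> N)" if "N > 0" for N
      unfolding \<mu>[OF that] by (rule gauss.prob_space_distr[OF mcN])
    show "sets (\<mu> N) = sets (euclid I)" if "N > 0" for N unfolding \<mu>[OF that] by simp
    have sq: "(\<lambda>v. (v i)\<^sup>2) \<in> borel_measurable (euclid I)" if "i \<in> I" for i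
      by (intro borel_measurable_power mc that)
    show "integrable (\<mu> N) (\<lambda>x. (x i)\<^sup>2)" if "N > 0" "i \<in> I" for N i
    proof -
      have "integrable gauss_array (\<lambda>x. (centred N (w i) x)\<^sup>2)"
        by (intro poly_fn_integrable poly_fn_power poly_fn_centred)
      then show ?thesis
        unfolding \<mu>[OF that(1)] integrable_distr_eq[OF mcN sq[OF that(2)]] using that(2) by (simp add: c_def)
    qed
    show "convergent (\<lambda>N. \<integral>x. (x i)\<^sup>2 \<partial>\<mu> N)" if "i \<in> I" for i
    proof -
      have "cmom N [w i, w i] = (\<integral>x. (x i)\<^sup>2 \<partial>\<mu> N)" if "N > 0" for N
        unfolding \<mu>[OF that] integral_distr[OF mcN sq[OF \<open>i \<in> I\<close>]] cmom_def
        using \<open>i \<in> I\<close> by (simp add: c_def cprod_def[abs_def] power2_eq_square)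
      then have "\<forall>\<^sub>F N in sequentially. cmom N [w i, w i] = (\<integral>x. (x i)\<^sup>2 \<partial>\<mu> N)"
        by (auto intro: eventually_mono[OF ev])
      then show ?thesis by (rule convergentI[OF Lim_transform_eventually[OF tendsto_cmom]])
    qed
    fix a
    have lin: "(\<lambda>v. \<Sum>i\<in>I. a i * v i) \<in> borel_measurable (euclid I)"
      by (intro borel_measurable_sum borel_measurable_times borel_measurable_const mc)
    have "(\<E> x. iexp (lin_comb (upto_comb r w a) N x)) = (\<integral>x. iexp (\<Sum>i\<in>I. a i * x i) \<partial>\<mu> N)" if "N > 0" for N
    proof -
      have "(\<lambda>s. iexp s) \<in> borel_measurable borel" by measurable
      from measurable_compose[OF lin this]
      have "(\<integral>x. iexp (\<Sum>i\<in>I. a i * x i) \<partial>\<mu> N) = (\<E> x. iexp (\<Sum>i\<in>I. a i * c N x i))"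
        unfolding \<mu>[OF that] by (rule integral_distr[OF mcN])
      moreover have "(\<Sum>i\<in>I. a i * c N x i) = lin_comb (upto_comb r w a) N x" for x
        unfolding lin_comb_upto_comb by (simp add: c_def I_def)
      ultimately show ?thesis by simp
    qed
    then have "\<forall>\<^sub>F N in sequentially. (\<E> x. iexp (lin_comb (upto_comb r w a) N x)) = (\<integral>x. iexp (\<Sum>i\<in>I. a i * x i) \<partial>\<mu> N)"
      by (auto intro: eventually_mono[OF ev])
    from Lim_transform_eventually[OF lin_comb_char this]
    show "(\<lambda>N. \<integral>x. iexp (\<Sum>i\<in>I. a i * x i) \<partial>\<mu> N) \<longlonglongrightarrow> (\<integral>x. iexp (\<Sum>i\<in>I. a i * x i) \<partial>\<nu>)"
      unfolding \<nu>char quad .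
  qed

  have "convergent (\<lambda>N. cumulant1 (P N) (Y N k)) \<and>
      weak_conv_m (\<lambda>N. distr (P N) borel (Y N k)) (return borel (lim (\<lambda>N. cumulant1 (P N) (Y N k))))"
    if "k \<in> {1..r}" for k
  proof -
    have k: "k \<in> I" using that by (simp add: I_def)
    show ?thesis using convergentI[OF mean_lim[OF k]] weak1[OF k] unfolding limI[OF mean_lim[OF k]] by blast
  qed
  moreover have "convergent (\<lambda>N. (real N)\<^sup>2 * cumulant2 (P N) (Y N k) (Y N l))"
    if "k \<in> {1..r}" "l \<in> {1..r}" for k l
    using convergentI[OF cov_lim[of k l]] that by (simp add: I_def)
  moreover have "\<exists>\<nu>. centred_gaussian_vec {1..r}
                (\<lambda>k l. lim (\<lambda>N. (real N)\<^sup>2 * cumulant2 (P N) (Y N k) (Y N l))) \<nu> \<and>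
              weak_conv_vec {1..r}
                (\<lambda>N. joint_law (P N) {1..r}
                       (\<lambda>k \<omega>. real N * (Y N k \<omega> - cumulant1 (P N) (Y N k)))) \<nu>"
    using \<nu> weak2 unfolding C_def[abs_def] \<mu>_def[abs_def] I_def by blast
  ultimately show ?thesis by blast
qed

end
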